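(* Let $M$ be a smooth manifold, $\mu$ a smooth positive density on $M$, and $X$ a smooth complete time-dependent vector field on $M$ with time-dependent flow $\{\phi_X^{t,s}\}_{s,t\in\mathbb{R}}$. Let $\rho_0\in C^\infty(M)$ and for $t\in\mathbb{R}$ let $\rho_t$ be the smooth function on $M$ determined by $$\rho_t\,\mu=(\phi_X^{0,t})^*(\rho_0\,\mu).$$ Then the function $\rho\in C^\infty(M\times\mathbb{R})$, $\rho(\cdot,t)=\rho_t$, satisfies the linear PDE $$X_t(\rho_t)+\rho_t\,\mathrm{div}_\mu(X_t)=-\partial_t\rho .$$
   Context: A density on an $n$-dimensional real vector space $V$ is a function $\mu:V^n\to\mathbb{R}$ with $\mu(Tv_1,\dots,Tv_n)=|\det T|\,\mu(v_1,\dots,v_n)$ for every linear $T:V\to V$; it is positive if it is $>0$ on linearly independent tuples. A (positive) density on $M$ is a section of the line bundle $\mathcal{D}M=\bigsqcup_q\mathcal{D}(T_qM)$ (positive at each point). Pullback: $(F^*\mu)_p(v_1,\dots,v_n)=\mu_{F(p)}(dF_pv_1,\dots,dF_pv_n)$. A time-dependent vector field is a map $X:\mathbb{R}\times M\to TM$ such that each $X_t:=X(t,\cdot)$ is a vector field on $M$; it is complete if for every $(t_0,q_0)\in\mathbb{R}\times M$ the maximal solution $\gamma(t;t_0,q_0)$ of $\dot\gamma(t)=X(t,\gamma(t))$, $\gamma(t_0)=q_0$, is defined for all $t\in\mathbb{R}$. Its time-dependent flow is $\phi_X^{t_1,t_0}(q)=\gamma(t_1;t_0,q)$, i.e. it maps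 the position at time $t_0$ to the position at time $t_1$. For a smooth vector field $Y$, the divergence $\mathrm{div}_\mu(Y)\in C^\infty(M)$ is defined by $\mathcal{L}_Y\mu=\mathrm{div}_\mu(Y)\,\mu$, where $\mathcal{L}_Y\mu=\frac{d}{dt}\big|_{t=0}(\phi_Y^t)^*\mu$ is the Lie derivative along the (local) flow of $Y$. $Y(f)$ denotes the derivative of the function $f$ along $Y$. *)

theory Defs
  imports "HOL-Analysis.Analysis" "HOL-Library.Function_Algebras"
begin

text \<open>Tangent vectors will be functions from charts to the model space; with the pointwise
  operations they live in a real vector space, so the library notions \<^term>\<open>subspace\<close>,
  \<^term>\<open>independent\<close>, \<^term>\<open>span\<close> and \<^term>\<open>representation\<close> apply to them.\<close>

instantiation "fun" :: (type, real_vector) real_vector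
begin

definition scaleR_fun :: "real \<Rightarrow> ('a \<Rightarrow> 'b) \<Rightarrow> 'a \<Rightarrow> 'b"
  where "scaleR_fun r f = (\<lambda>x. r *\<^sub>R f x)"

instance
  by standard (auto simp: scaleR_fun_def plus_fun_def algebra_simps)

end


subsection \<open>Smooth functions on open subsets of normed spaces\<close>

text \<open>Intended for open \<open>S\<close> and finite-dimensional domain.\<close>

primrec C_k_on :: "nat \<Rightarrow> 'a::real_normed_vector set \<Rightarrow> ('a \<Rightarrow> 'b::real_normed_vector) \<Rightarrow> bool" where
  "C_k_on 0 S f \<longleftrightarrow> continuous_on S f"
| "C_k_on (Suc k) S f \<longleftrightarrow>
     (\<forall>x\<in>S. f differentiable (at x)) \<and> (\<forall>v. C_k_on k S (\<lambda>x. frechet_derivative f (at x) v))"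

definition smooth_on :: "'a::real_normed_vector set \<Rightarrow> ('a \<Rightarrow> 'b::real_normed_vector) \<Rightarrow> bool" where
  "smooth_on S f \<longleftrightarrow> (\<forall>k. C_k_on k S f)"


subsection \<open>Charts, manifolds, smooth maps\<close>

text \<open>A chart is a pair of its domain and its coordinate map; values of the coordinate map
  outside the domain are irrelevant.\<close>

type_synonym ('m, 'e) chart = "'m set \<times> ('m \<Rightarrow> 'e)"

definition chart_inv :: "('m, 'e) chart \<Rightarrow> 'e \<Rightarrow> 'm" where
  "chart_inv c = inv_into (fst c) (snd c)"

definition transition :: "('m, 'e) chart \<Rightarrow> ('m, 'f) chart \<Rightarrow> 'e \<Rightarrow> 'f" where
  "transition c d = snd d \<circ> chart_inv c"

definition charts_at :: "('m, 'e) chart set \<Rightarrow> 'm \<Rightarrow> ('m, 'e) chart set" where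
  "charts_at A q = {c \<in> A. q \<in> fst c}"

text \<open>The manifold is the whole type \<open>'m\<close>, Hausdorff and second countable by its sort, with the
  smooth structure generated by the (not necessarily maximal) atlas \<open>A\<close>.\<close>

definition smooth_manifold ::
    "('m::{t2_space,second_countable_topology}, 'e::euclidean_space) chart set \<Rightarrow> bool" where
  "smooth_manifold A \<longleftrightarrow>
     (\<Union>c\<in>A. fst c) = UNIV \<and>
     (\<forall>c\<in>A. open (fst c) \<and> open (snd c ` fst c) \<and>
            homeomorphism (fst c) (snd c ` fst c) (snd c) (chart_inv c)) \<and>
     (\<forall>c\<in>A. \<forall>d\<in>A. smooth_on (snd c ` (fst c \<inter> fst d)) (transition c d))"

text \<open>The set \<open>W\<close> is a coordinate neighbourhood of \<open>p\<close> that is mapped into the domain of \<open>d\<close>;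
  it is needed because the atlases are not assumed to be maximal.\<close>

definition smooth_map ::
    "('m, 'e::euclidean_space) chart set \<Rightarrow> ('k, 'f::euclidean_space) chart set \<Rightarrow> ('m \<Rightarrow> 'k) \<Rightarrow> bool" where
  "smooth_map A B F \<longleftrightarrow>
     (\<forall>p \<in> (\<Union>c\<in>A. fst c). \<exists>c \<in> charts_at A p. \<exists>d\<in>B. \<exists>W.
        open W \<and> snd c p \<in> W \<and> W \<subseteq> snd c ` fst c \<and>
        F ` chart_inv c ` W \<subseteq> fst d \<and> smooth_on W (snd d \<circ> F \<circ> chart_inv c))"

definition real_atlas :: "(real, real) chart set" where
  "real_atlas = {(UNIV, \<lambda>x. x)}"

definition prod_atlas ::
    "('m, 'e) chart set \<Rightarrow> ('k, 'f) chart set \<Rightarrow> ('m \<times> 'k, 'e \<times> 'f) chart set" where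
  "prod_atlas A B = {(fst c \<times> fst d, map_prod (snd c) (snd d)) | c d. c \<in> A \<and> d \<in> B}"

abbreviation smooth_fun :: "('m, 'e::euclidean_space) chart set \<Rightarrow> ('m \<Rightarrow> real) \<Rightarrow> bool" where
  "smooth_fun A f \<equiv> smooth_map A real_atlas f"


subsection \<open>Tangent spaces and differentials\<close>

text \<open>A tangent vector at \<open>q\<close> is the family of its components in all charts around \<open>q\<close>, related by
  the Jacobians of the transition maps, i.e. the class of the pairs (chart, components).
  The value \<open>0\<close> at charts not around \<open>q\<close> makes the representation unique.\<close>

definition tangent_space ::
    "('m, 'e::euclidean_space) chart set \<Rightarrow> 'm \<Rightarrow> (('m, 'e) chart \<Rightarrow> 'e) set" where
  "tangent_space A q =
     {v. (\<forall>c. c \<notin> charts_at A q \<longrightarrow> v c = 0) \<and>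
         (\<forall>c \<in> charts_at A q. \<forall>d \<in> charts_at A q.
            v d = frechet_derivative (transition c d) (at (snd c q)) (v c))}"

text \<open>The tangent vector at \<open>q\<close> with components \<open>w\<close> in the chart \<open>c\<close>.\<close>

definition tangent_of ::
    "('m, 'e::euclidean_space) chart set \<Rightarrow> 'm \<Rightarrow> ('m, 'e) chart \<Rightarrow> 'e \<Rightarrow> ('m, 'e) chart \<Rightarrow> 'e" where
  "tangent_of A q c w =
     (\<lambda>d. if d \<in> charts_at A q then frechet_derivative (transition c d) (at (snd c q)) w else 0)"

text \<open>The differential at \<open>p\<close>; it does not depend on the chart \<open>c\<close> around \<open>p\<close> and only on the
  germ of \<open>F\<close> at \<open>p\<close>.\<close>

definition differential ::
    "('m, 'e::euclidean_space) chart set \<Rightarrow> ('k, 'f::euclidean_space) chart set \<Rightarrow> ('m \<Rightarrow> 'k) \<Rightarrow>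
     'm \<Rightarrow> (('m, 'e) chart \<Rightarrow> 'e) \<Rightarrow> ('k, 'f) chart \<Rightarrow> 'f" where
  "differential A B F p v =
     (let c = SOME c. c \<in> charts_at A p in
      (\<lambda>d. if d \<in> charts_at B (F p)
           then frechet_derivative (snd d \<circ> F \<circ> chart_inv c) (at (snd c p)) (v c) else 0))"

text \<open>The derivative \<open>Y(f)\<close> of a function along a vector field.\<close>

definition directional ::
    "('m, 'e::euclidean_space) chart set \<Rightarrow> ('m \<Rightarrow> ('m, 'e) chart \<Rightarrow> 'e) \<Rightarrow> ('m \<Rightarrow> real) \<Rightarrow> 'm \<Rightarrow> real" where
  "directional A Y f q =
     (let c = SOME c. c \<in> charts_at A q in
      frechet_derivative (f \<circ> chart_inv c) (at (snd c q)) (Y q c))"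

definition tangent_bundle_atlas ::
    "('m, 'e::euclidean_space) chart set \<Rightarrow> ('m \<times> (('m, 'e) chart \<Rightarrow> 'e), 'e \<times> 'e) chart set" where
  "tangent_bundle_atlas A =
     {({(q, v). q \<in> fst c \<and> v \<in> tangent_space A q}, \<lambda>(q, v). (snd c q, v c)) | c. c \<in> A}"


subsection \<open>Densities\<close>

definition linear_endo :: "'v::real_vector set \<Rightarrow> ('v \<Rightarrow> 'v) \<Rightarrow> bool" where
  "linear_endo V T \<longleftrightarrow>
     (\<forall>x\<in>V. T x \<in> V) \<and> (\<forall>x\<in>V. \<forall>y\<in>V. T (x + y) = T x + T y) \<and> (\<forall>r. \<forall>x\<in>V. T (r *\<^sub>R x) = r *\<^sub>R T x)"

definition independent_tuple :: "('n::finite \<Rightarrow> 'v::real_vector) \<Rightarrow> bool" where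
  "independent_tuple b \<longleftrightarrow> inj b \<and> independent (range b)"

definition basis_tuple :: "'v::real_vector set \<Rightarrow> ('n::finite \<Rightarrow> 'v) \<Rightarrow> bool" where
  "basis_tuple V b \<longleftrightarrow> independent_tuple b \<and> span (range b) = V"

definition matrix_wrt :: "('n::finite \<Rightarrow> 'v::real_vector) \<Rightarrow> ('v \<Rightarrow> 'v) \<Rightarrow> real ^ 'n ^ 'n" where
  "matrix_wrt b T = (\<chi> i j. representation (range b) (T (b j)) (b i))"

text \<open>The determinant of an endomorphism of a vector space of dimension \<open>CARD('n)\<close>, computed
  in an arbitrary basis.\<close>

definition endo_det :: "'n::finite itself \<Rightarrow> 'v::real_vector set \<Rightarrow> ('v \<Rightarrow> 'v) \<Rightarrow> real" where
  "endo_det _ V T = det (matrix_wrt (SOME b :: 'n \<Rightarrow> 'v. basis_tuple V b) T)"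

text \<open>Densities on \<open>V\<close>; extended by \<open>0\<close> outside \<open>V\<^sup>n\<close>, so that equality of densities is equality
  of functions.\<close>

definition densities :: "'v::real_vector set \<Rightarrow> (('n::finite \<Rightarrow> 'v) \<Rightarrow> real) set" where
  "densities V =
     {\<mu>. (\<forall>v. \<not> range v \<subseteq> V \<longrightarrow> \<mu> v = 0) \<and>
         (\<forall>T v. linear_endo V T \<longrightarrow> range v \<subseteq> V \<longrightarrow>
            \<mu> (\<lambda>i. T (v i)) = \<bar>endo_det TYPE('n) V T\<bar> * \<mu> v)}"

type_synonym ('m, 'n) tangent = "('m, real ^ 'n) chart \<Rightarrow> real ^ 'n"

type_synonym ('m, 'n) density = "'m \<Rightarrow> ('n \<Rightarrow> ('m, 'n) tangent) \<Rightarrow> real"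

text \<open>A chart of \<open>M\<close> identifies a density at \<open>q\<close> with its value on the coordinate frame at \<open>q\<close>.\<close>

definition density_bundle_atlas ::
    "('m, real ^ 'n) chart set \<Rightarrow>
     ('m \<times> (('n::finite \<Rightarrow> ('m, 'n) tangent) \<Rightarrow> real), (real ^ 'n) \<times> real) chart set" where
  "density_bundle_atlas A =
     {({(q, \<delta>). q \<in> fst c \<and> \<delta> \<in> densities (tangent_space A q)},
       \<lambda>(q, \<delta>). (snd c q, \<delta> (\<lambda>i. tangent_of A q c (axis i 1)))) | c. c \<in> A}"

definition smooth_density ::
    "('m, real ^ 'n) chart set \<Rightarrow> ('m, 'n::finite) density \<Rightarrow> bool" where
  "smooth_density A \<mu> \<longleftrightarrow>
     (\<forall>q. \<mu> q \<in> densities (tangent_space A q)) \<and>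
     smooth_map A (density_bundle_atlas A) (\<lambda>q. (q, \<mu> q))"

definition positive_density ::
    "('m, real ^ 'n) chart set \<Rightarrow> ('m, 'n::finite) density \<Rightarrow> bool" where
  "positive_density A \<mu> \<longleftrightarrow>
     (\<forall>q v. range v \<subseteq> tangent_space A q \<longrightarrow> independent_tuple v \<longrightarrow> \<mu> q v > 0)"

definition scale_density :: "('m \<Rightarrow> real) \<Rightarrow> ('m, 'n::finite) density \<Rightarrow> ('m, 'n) density" where
  "scale_density f \<mu> = (\<lambda>q v. f q * \<mu> q v)"

definition pullback ::
    "('m, real ^ 'n) chart set \<Rightarrow> ('m \<Rightarrow> 'm) \<Rightarrow> ('m, 'n::finite) density \<Rightarrow> ('m, 'n) density" where
  "pullback A F \<mu> =
     (\<lambda>p v. if range v \<subseteq> tangent_space A p then \<mu> (F p) (\<lambda>i. differential A A F p (v i)) else 0)"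


subsection \<open>Time-dependent vector fields and flows\<close>

definition smooth_td_vector_field ::
    "('m, 'e::euclidean_space) chart set \<Rightarrow> (real \<Rightarrow> 'm \<Rightarrow> ('m, 'e) chart \<Rightarrow> 'e) \<Rightarrow> bool" where
  "smooth_td_vector_field A X \<longleftrightarrow>
     (\<forall>t q. X t q \<in> tangent_space A q) \<and>
     smooth_map (prod_atlas real_atlas A) (tangent_bundle_atlas A) (\<lambda>(t, q). (q, X t q))"

text \<open>Continuity ensures that \<open>\<gamma>\<close> stays in the domain of \<open>d\<close> near \<open>t\<close>.\<close>

definition integral_curve ::
    "('m::topological_space, 'e::euclidean_space) chart set \<Rightarrow> (real \<Rightarrow> 'm \<Rightarrow> ('m, 'e) chart \<Rightarrow> 'e) \<Rightarrow>
     real set \<Rightarrow> (real \<Rightarrow> 'm) \<Rightarrow> bool" where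
  "integral_curve A X I \<gamma> \<longleftrightarrow>
     (\<forall>t\<in>I. isCont \<gamma> t \<and>
        (\<forall>d \<in> charts_at A (\<gamma> t). ((snd d \<circ> \<gamma>) has_vector_derivative X t (\<gamma> t) d) (at t)))"

definition solution ::
    "('m::topological_space, 'e::euclidean_space) chart set \<Rightarrow> (real \<Rightarrow> 'm \<Rightarrow> ('m, 'e) chart \<Rightarrow> 'e) \<Rightarrow>
     real \<Rightarrow> 'm \<Rightarrow> real set \<Rightarrow> (real \<Rightarrow> 'm) \<Rightarrow> bool" where
  "solution A X t0 q0 I \<gamma> \<longleftrightarrow>
     open I \<and> is_interval I \<and> t0 \<in> I \<and> \<gamma> t0 = q0 \<and> integral_curve A X I \<gamma>"

definition maximal_solution ::
    "('m::topological_space, 'e::euclidean_space) chart set \<Rightarrow> (real \<Rightarrow> 'm \<Rightarrow> ('m, 'e) chart \<Rightarrow> 'e) \<Rightarrow>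
     real \<Rightarrow> 'm \<Rightarrow> real set \<Rightarrow> (real \<Rightarrow> 'm) \<Rightarrow> bool" where
  "maximal_solution A X t0 q0 I \<gamma> \<longleftrightarrow>
     solution A X t0 q0 I \<gamma> \<and>
     (\<forall>J \<eta>. solution A X t0 q0 J \<eta> \<and> I \<subseteq> J \<and> (\<forall>t\<in>I. \<eta> t = \<gamma> t) \<longrightarrow> J = I)"

definition complete_td_vector_field ::
    "('m::topological_space, 'e::euclidean_space) chart set \<Rightarrow> (real \<Rightarrow> 'm \<Rightarrow> ('m, 'e) chart \<Rightarrow> 'e) \<Rightarrow> bool" where
  "complete_td_vector_field A X \<longleftrightarrow> (\<forall>t0 q0. \<exists>\<gamma>. maximal_solution A X t0 q0 UNIV \<gamma>)"

text \<open>The position at time \<open>t1\<close> of the maximal solution that is at \<open>q\<close> at time \<open>t0\<close>; unspecified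
  if that solution does not exist up to time \<open>t1\<close>.\<close>

definition td_flow ::
    "('m::topological_space, 'e::euclidean_space) chart set \<Rightarrow> (real \<Rightarrow> 'm \<Rightarrow> ('m, 'e) chart \<Rightarrow> 'e) \<Rightarrow>
     real \<Rightarrow> real \<Rightarrow> 'm \<Rightarrow> 'm" where
  "td_flow A X t1 t0 q = (THE p. \<exists>I \<gamma>. maximal_solution A X t0 q I \<gamma> \<and> t1 \<in> I \<and> p = \<gamma> t1)"

definition local_flow ::
    "('m::topological_space, 'e::euclidean_space) chart set \<Rightarrow> ('m \<Rightarrow> ('m, 'e) chart \<Rightarrow> 'e) \<Rightarrow>
     real \<Rightarrow> 'm \<Rightarrow> 'm" where
  "local_flow A Y t = td_flow A (\<lambda>_. Y) t 0"


subsection \<open>Lie derivative and divergence\<close>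

definition lie_derivative ::
    "('m::topological_space, real ^ 'n) chart set \<Rightarrow> ('m \<Rightarrow> ('m, 'n::finite) tangent) \<Rightarrow>
     ('m, 'n) density \<Rightarrow> ('m, 'n) density" where
  "lie_derivative A Y \<mu> = (\<lambda>q v. deriv (\<lambda>t. pullback A (local_flow A Y t) \<mu> q v) 0)"

definition divergence ::
    "('m::topological_space, real ^ 'n) chart set \<Rightarrow> ('m, 'n::finite) density \<Rightarrow>
     ('m \<Rightarrow> ('m, 'n) tangent) \<Rightarrow> 'm \<Rightarrow> real" where
  "divergence A \<mu> Y = (THE f. lie_derivative A Y \<mu> = scale_density f \<mu>)"

end

theory Submission
  imports Defs
begin

text \<open>In charts, \<open>\<rho>\<^sub>t\<close> is the product of \<open>\<rho>\<^sub>0\<close> and the coefficient of \<open>\<mu>\<close>, both transported along the flow,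
  with the absolute Jacobian determinant of \<open>\<phi>\<^sup>0\<^sup>,\<^sup>t\<close>, divided by the coefficient of \<open>\<mu>\<close>; so \<open>\<rho>\<close> is as smooth as the flow.
  As \<open>\<phi>\<^sup>0\<^sup>,\<^sup>t = \<phi>\<^sup>0\<^sup>,\<^sup>s \<circ> \<phi>\<^sup>s\<^sup>,\<^sup>t\<close>, the density \<open>\<rho>\<^sub>t \<mu>\<close> is the pullback of \<open>\<rho>\<^sub>s \<mu>\<close> by the short-time map \<open>\<phi>\<^sup>s\<^sup>,\<^sup>t\<close>, which
  stays in one chart and has velocity \<open>- X\<^sub>s\<close> at \<open>t = s\<close>. Liouville's formula evaluates its derivative at \<open>t = s\<close>, and
  the same computation for the flow of the frozen field \<open>X\<^sub>s\<close> evaluates the divergence; comparing the two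
  gives the equation.

  Smooth dependence of local flows on the initial point: the solution curve is the fixed point of a
  contraction \<open>y \<mapsto> x + a \<integral> g \<circ> y\<close> of the Banach space of bounded continuous curves, so it is differentiable
  in \<open>(a, x)\<close> and its derivative solves a linear fixed point equation whose coefficients are one
  degree less smooth. Smoothness of the global flow then follows by propagation along trajectories.\<close>

section \<open>Calculus of smooth maps\<close>

text \<open>\<open>C_k_on\<close> differentiates in one fixed direction at a time, so no space of
  linear maps is needed; the price is that a derivative applied to a moving vector has to be
  expanded over \<open>Basis\<close>. This is why the linearised fixed point equation is a finite
  sum of bilinear terms instead of having one operator-valued coefficient.

  The factor a in front of the integral turns time into a parameter: all curves live on [-1,1], and
  the end point of the curve with speed a is the flow at time a. One smoothness statement in (a, x)
  thus covers time and initial point together.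

  In the transport formula it is the initial time of the flow that varies, so smoothness in the
  initial time is carried along throughout. The absolute value of the Jacobian does no harm: it is
  differentiated only where the determinant is 1, and elsewhere invertibility of the flow keeps the
  determinant away from 0. Since atlases need not be maximal, \<open>smooth_map\<close> supplies
  only some chart near a point, and smoothness has to be transferred to prescribed charts before
  computing.\<close>

lemma C_k_on_subset: "C_k_on k S f \<Longrightarrow> T \<subseteq> S \<Longrightarrow> C_k_on k T f"
  by (induction k arbitrary: f) (auto intro: continuous_on_subset)

text \<open>\<open>C_k_on\<close> uses derivatives in the full space, taken at points of S. They
  inherit agreement on S only through openness of S: near each point the two functions
  coincide.\<close>

lemma C_k_on_cong:
  assumes "open S" "\<And>x. x \<in> S \<Longrightarrow> f x = g x" "C_k_on k S f"
  shows "C_k_on k S g"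
  using assms(2,3)
proof (induction k arbitrary: f g)
  case 0
  then show ?case by (simp cong: continuous_on_cong)
next
  case (Suc k)
  have diff: "f differentiable (at x)" if "x \<in> S" for x using Suc.prems(2) that by simp
  have D: "frechet_derivative f (at x) = frechet_derivative g (at x)" if "x \<in> S" for x
    using frechet_derivative_transform_within_open[OF diff assms(1)] that Suc.prems(1) by blast
  have "g differentiable (at x)" if "x \<in> S" for x
    using diff[OF that] has_derivative_transform_within_open[of f _ x UNIV S g] assms(1) that Suc.prems(1)
    unfolding differentiable_def by blast
  moreover have "C_k_on k S (\<lambda>x. frechet_derivative g (at x) v)" for v
    by (rule Suc.IH[of "\<lambda>x. frechet_derivative f (at x) v"]) (use Suc.prems(2) D in auto)
  ultimately show ?case by simp
qed

text \<open>Derivatives at a point are unique, so any explicit formula may stand in for the one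
  selected by \<open>frechet_derivative\<close>. Most closure properties below are inductions
  through this rule.\<close>

lemma C_k_on_SucI:
  assumes "open S" "\<And>x. x \<in> S \<Longrightarrow> (f has_derivative f' x) (at x)"
    and "\<And>v. C_k_on k S (\<lambda>x. f' x v)"
  shows "C_k_on (Suc k) S f"
proof -
  have "frechet_derivative f (at x) = f' x" if "x \<in> S" for x
    using frechet_derivative_at[OF assms(2)[OF that]] by simp
  then have "C_k_on k S (\<lambda>x. frechet_derivative f (at x) v)" for v
    by (intro C_k_on_cong[OF assms(1) _ assms(3)[of v]]) auto
  then show ?thesis using assms(2) by (auto simp: differentiable_def)
qed

lemma C_k_on_SucD:
  assumes "C_k_on (Suc k) S f"
  shows "x \<in> S \<Longrightarrow> (f has_derivative frechet_derivative f (at x)) (at x)"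
    and "C_k_on k S (\<lambda>x. frechet_derivative f (at x) v)"
  using assms by (auto simp: frechet_derivative_works)

text \<open>The recursion in \<open>C_k_on\<close> asks for continuity only at its last stage, so
  monotonicity in k rests on differentiability implying continuity at the bottom.\<close>

lemma C_k_on_Suc_imp: "C_k_on (Suc k) S f \<Longrightarrow> C_k_on k S f"
proof (induction k arbitrary: f)
  case 0
  then have "f differentiable (at x within S)" if "x \<in> S" for x
    using that differentiable_at_withinI by auto
  then show ?case by (auto intro!: differentiable_imp_continuous_on simp: differentiable_on_def)
next
  case (Suc k)
  from Suc.prems have "\<forall>x\<in>S. f differentiable (at x)"
    and "\<forall>v. C_k_on (Suc k) S (\<lambda>x. frechet_derivative f (at x) v)" by auto
  then show ?case using Suc.IH by (subst C_k_on.simps) blast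
qed

lemma C_k_on_local:
  assumes "\<And>x. x \<in> S \<Longrightarrow> \<exists>T. open T \<and> x \<in> T \<and> C_k_on k T f"
  shows "C_k_on k S f"
  using assms
proof (induction k arbitrary: f)
  case 0
  have "isCont f x" if "x \<in> S" for x
    using 0[OF that] by (auto simp: continuous_on_eq_continuous_at)
  then show ?case by (auto intro: continuous_at_imp_continuous_on)
next
  case (Suc k)
  have "f differentiable (at x)" if "x \<in> S" for x using Suc.prems[OF that] by auto
  moreover have "C_k_on k S (\<lambda>x. frechet_derivative f (at x) v)" for v
    by (rule Suc.IH) (use Suc.prems in \<open>force\<close>)
  ultimately show ?case by simp
qed

lemma C_k_on_const: "C_k_on k S (\<lambda>_. c)"
proof (induction k arbitrary: c)
  case (Suc k)
  have "frechet_derivative (\<lambda>_. c) (at x) = (\<lambda>_. 0)" for x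
    using frechet_derivative_at[OF has_derivative_const] by metis
  then show ?case using Suc by simp
qed simp

lemma C_k_on_linear:
  assumes "bounded_linear L"
  shows "C_k_on k S L"
proof (cases k)
  case 0
  then show ?thesis using linear_continuous_on[OF assms] by simp
next
  case (Suc j)
  have *: "(L has_derivative L) (at x)" for x using bounded_linear_imp_has_derivative[OF assms] .
  have "frechet_derivative L (at x) = L" for x using frechet_derivative_at[OF *] by simp
  then show ?thesis using * Suc by (auto simp: differentiable_def C_k_on_const)
qed

lemma C_k_on_bounded_linear:
  assumes "bounded_linear L" "open S" "C_k_on k S f"
  shows "C_k_on k S (\<lambda>x. L (f x))"
  using assms(3)
proof (induction k arbitrary: f)
  case 0
  then show ?case using bounded_linear.continuous_on[OF assms(1)] by simp
next
  case (Suc k)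
  show ?case
    by (rule C_k_on_SucI[OF assms(2) bounded_linear.has_derivative[OF assms(1) C_k_on_SucD(1)[OF Suc.prems]]])
      (use Suc in auto)
qed

lemma C_k_on_add:
  assumes "open S" "C_k_on k S f" "C_k_on k S g"
  shows "C_k_on k S (\<lambda>x. f x + g x)"
  using assms(2,3)
proof (induction k arbitrary: f g)
  case 0
  then show ?case by (auto intro: continuous_intros)
next
  case (Suc k)
  show ?case
    by (rule C_k_on_SucI[OF assms(1) has_derivative_add[OF C_k_on_SucD(1)[OF Suc.prems(1)] C_k_on_SucD(1)[OF Suc.prems(2)]]])
      (use Suc in auto)
qed

lemma C_k_on_sum:
  assumes "open S" "\<And>i. i \<in> I \<Longrightarrow> C_k_on k S (f i)"
  shows "C_k_on k S (\<lambda>x. \<Sum>i\<in>I. f i x)"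
  using assms(2)
  by (induction I rule: infinite_finite_induct) (auto simp: C_k_on_const intro!: C_k_on_add[OF assms(1)])

lemma C_k_on_bilinear:
  assumes "bounded_bilinear B" "open S" "C_k_on k S f" "C_k_on k S g"
  shows "C_k_on k S (\<lambda>x. B (f x) (g x))"
  using assms(3,4)
proof (induction k arbitrary: f g)
  case 0
  then show ?case using bounded_bilinear.continuous_on[OF assms(1)] by auto
next
  case (Suc k)
  note fg = C_k_on_Suc_imp[OF Suc.prems(1)] C_k_on_Suc_imp[OF Suc.prems(2)]
  show ?case
    by (rule C_k_on_SucI[OF assms(2) bounded_bilinear.FDERIV[OF assms(1) C_k_on_SucD(1)[OF Suc.prems(1)] C_k_on_SucD(1)[OF Suc.prems(2)]]])
      (use Suc fg in \<open>auto intro!: C_k_on_add assms(2)\<close>)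
qed

lemma linear_Basis_expansion:
  fixes L :: "'a::euclidean_space \<Rightarrow> 'b::real_vector"
  assumes "linear L"
  shows "L v = (\<Sum>i\<in>Basis. (v \<bullet> i) *\<^sub>R L i)"
  using linear_sum[OF assms, of "\<lambda>i. (v \<bullet> i) *\<^sub>R i" Basis] euclidean_representation[of v]
  by (simp add: linear_scale[OF assms])

text \<open>The chain rule applies the derivative of g to a vector that itself moves with x, whereas
  \<open>C_k_on\<close> controls that derivative only in fixed directions. Expanding the vector over
  \<open>Basis\<close> separates the two dependences and leaves products of functions of degree
  k.\<close>

lemma C_k_on_compose:
  fixes g :: "'a::euclidean_space \<Rightarrow> 'b::real_normed_vector"
  assumes "open S" "open T" "C_k_on k S f" "C_k_on k T g" "f ` S \<subseteq> T"
  shows "C_k_on k S (\<lambda>x. g (f x))"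
  using assms(3,4)
proof (induction k arbitrary: g)
  case 0
  then show ?case using continuous_on_compose2[of T g S f] assms(5) by simp
next
  case (Suc k)
  note f = C_k_on_SucD[OF Suc.prems(1)] and g = C_k_on_SucD[OF Suc.prems(2)]
  have gT: "f x \<in> T" if "x \<in> S" for x using assms(5) that by auto
  have lin: "linear (frechet_derivative g (at (f x)))" if "x \<in> S" for x
    using has_derivative_linear[OF g(1)[OF gT[OF that]]] .
  have *: "((\<lambda>x. g (f x)) has_derivative
      (\<lambda>v. \<Sum>i\<in>Basis. (frechet_derivative f (at x) v \<bullet> i) *\<^sub>R frechet_derivative g (at (f x)) i)) (at x)"
    if "x \<in> S" for x
    using has_derivative_compose[OF f(1)[OF that] g(1)[OF gT[OF that]]]
    by (simp flip: linear_Basis_expansion[OF lin[OF that]])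
  show ?case
  proof (rule C_k_on_SucI[OF assms(1) *])
    fix v
    show "C_k_on k S (\<lambda>x. \<Sum>i\<in>Basis. (frechet_derivative f (at x) v \<bullet> i) *\<^sub>R frechet_derivative g (at (f x)) i)"
      by (intro C_k_on_sum assms(1) C_k_on_bilinear[OF bounded_bilinear_scaleR]
          C_k_on_bounded_linear[OF bounded_linear_inner_left] f(2) Suc.IH C_k_on_Suc_imp[OF Suc.prems(1)] g(2))
  qed
qed

section \<open>Closure properties of smooth functions\<close>

lemma smooth_on_subset: "smooth_on S f \<Longrightarrow> T \<subseteq> S \<Longrightarrow> smooth_on T f"
  unfolding smooth_on_def using C_k_on_subset by blast

lemma smooth_on_cong:
  "open S \<Longrightarrow> (\<And>x. x \<in> S \<Longrightarrow> f x = g x) \<Longrightarrow> smooth_on S f \<Longrightarrow> smooth_on S g"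
  unfolding smooth_on_def using C_k_on_cong by blast

lemma smooth_on_local:
  assumes "\<And>x. x \<in> S \<Longrightarrow> \<exists>T. open T \<and> x \<in> T \<and> smooth_on T f"
  shows "smooth_on S f"
  using assms unfolding smooth_on_def by (meson C_k_on_local)

lemma smooth_on_const: "smooth_on S (\<lambda>_. c)"
  by (simp add: smooth_on_def C_k_on_const)

lemma smooth_on_linear: "bounded_linear L \<Longrightarrow> smooth_on S L"
  by (simp add: smooth_on_def C_k_on_linear)

lemma smooth_on_bounded_linear:
  "bounded_linear L \<Longrightarrow> open S \<Longrightarrow> smooth_on S f \<Longrightarrow> smooth_on S (\<lambda>x. L (f x))"
  by (simp add: smooth_on_def C_k_on_bounded_linear)

lemma smooth_on_add:
  "open S \<Longrightarrow> smooth_on S f \<Longrightarrow> smooth_on S g \<Longrightarrow> smooth_on S (\<lambda>x. f x + g x)"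
  by (simp add: smooth_on_def C_k_on_add)

lemma smooth_on_sum:
  "open S \<Longrightarrow> (\<And>i. i \<in> I \<Longrightarrow> smooth_on S (f i)) \<Longrightarrow> smooth_on S (\<lambda>x. \<Sum>i\<in>I. f i x)"
  by (simp add: smooth_on_def C_k_on_sum)

lemma smooth_on_bilinear:
  "bounded_bilinear B \<Longrightarrow> open S \<Longrightarrow> smooth_on S f \<Longrightarrow> smooth_on S g \<Longrightarrow> smooth_on S (\<lambda>x. B (f x) (g x))"
  by (simp add: smooth_on_def C_k_on_bilinear)

lemma smooth_on_scaleR:
  "open S \<Longrightarrow> smooth_on S f \<Longrightarrow> smooth_on S g \<Longrightarrow> smooth_on S (\<lambda>x. f x *\<^sub>R g x)"
  by (rule smooth_on_bilinear[OF bounded_bilinear_scaleR])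

lemma smooth_on_mult:
  fixes f g :: "'a::real_normed_vector \<Rightarrow> real"
  shows "open S \<Longrightarrow> smooth_on S f \<Longrightarrow> smooth_on S g \<Longrightarrow> smooth_on S (\<lambda>x. f x * g x)"
  by (rule smooth_on_bilinear[OF bounded_bilinear_mult])

lemma smooth_on_prod:
  fixes f :: "'i \<Rightarrow> 'a::real_normed_vector \<Rightarrow> real"
  assumes "open S" "\<And>i. i \<in> I \<Longrightarrow> smooth_on S (f i)"
  shows "smooth_on S (\<lambda>x. \<Prod>i\<in>I. f i x)"
  using assms(2)
  by (induction I rule: infinite_finite_induct) (auto simp: smooth_on_const intro!: smooth_on_mult assms(1))

lemma smooth_on_Pair:
  assumes "open S" "smooth_on S f" "smooth_on S g"
  shows "smooth_on S (\<lambda>x. (f x, g x))"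
proof -
  have "bounded_linear (\<lambda>a::'b. (a, 0::'c))" "bounded_linear (\<lambda>b::'c. (0::'b, b))"
    by (auto intro!: bounded_linear_Pair bounded_linear_ident bounded_linear_zero)
  then have "smooth_on S (\<lambda>x. (f x, 0) + (0, g x))"
    using smooth_on_add[OF assms(1) smooth_on_bounded_linear[OF _ assms(1,2)] smooth_on_bounded_linear[OF _ assms(1,3)]]
    by blast
  then show ?thesis by simp
qed

lemma smooth_on_compose:
  fixes g :: "'a::euclidean_space \<Rightarrow> 'b::real_normed_vector"
  shows "open S \<Longrightarrow> open T \<Longrightarrow> smooth_on S f \<Longrightarrow> smooth_on T g \<Longrightarrow> f ` S \<subseteq> T \<Longrightarrow> smooth_on S (\<lambda>x. g (f x))"
  unfolding smooth_on_def using C_k_on_compose by blast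

lemma smooth_on_imp_continuous_on: "smooth_on S f \<Longrightarrow> continuous_on S f"
  unfolding smooth_on_def by (metis C_k_on.simps(1))

lemma smooth_on_has_derivative:
  "smooth_on S f \<Longrightarrow> x \<in> S \<Longrightarrow> (f has_derivative frechet_derivative f (at x)) (at x)"
  unfolding smooth_on_def using C_k_on_SucD(1) by blast

lemma smooth_on_frechet_derivative:
  "smooth_on S f \<Longrightarrow> smooth_on S (\<lambda>x. frechet_derivative f (at x) v)"
  unfolding smooth_on_def using C_k_on_SucD(2) by blast

text \<open>Base point and direction both move with x; as in the chain rule, the direction is
  expanded over \<open>Basis\<close>. Meant for Jacobians of transition maps applied to the
  components of a vector field.\<close>

lemma smooth_on_frechet_derivative_apply:
  fixes f :: "'a::euclidean_space \<Rightarrow> 'b::real_normed_vector"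
  assumes "open S" "open T" "smooth_on S f" "smooth_on T g" "smooth_on T w" "g ` T \<subseteq> S"
  shows "smooth_on T (\<lambda>x. frechet_derivative f (at (g x)) (w x))"
proof -
  have "smooth_on T (\<lambda>x. \<Sum>i\<in>Basis. (w x \<bullet> i) *\<^sub>R frechet_derivative f (at (g x)) i)"
    by (intro smooth_on_sum smooth_on_scaleR assms smooth_on_bounded_linear[OF bounded_linear_inner_left]
        smooth_on_compose[OF assms(2,1,4) smooth_on_frechet_derivative])
  moreover have "(\<Sum>i\<in>Basis. (w x \<bullet> i) *\<^sub>R frechet_derivative f (at (g x)) i)
      = frechet_derivative f (at (g x)) (w x)" if "x \<in> T" for x
  proof -
    have "g x \<in> S" using assms(6) that by auto
    from linear_Basis_expansion[OF has_derivative_linear[OF smooth_on_has_derivative[OF assms(3) this]], of "w x"]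
    show ?thesis by simp
  qed
  ultimately show ?thesis by (rule smooth_on_cong[OF assms(2), rotated])
qed

text \<open>The derivative is, up to sign and a constant, a product of two copies of the function
  itself, so degree k already yields degree k + 1.\<close>

lemma smooth_on_inverse_real: "smooth_on (- {0}) (inverse :: real \<Rightarrow> real)"
proof -
  have op: "open (- {0::real})" by auto
  have "C_k_on k (- {0}) (inverse :: real \<Rightarrow> real)" for k
  proof (induction k)
    case 0
    then show ?case by (auto intro!: continuous_intros)
  next
    case (Suc k)
    have "bounded_linear (\<lambda>y. - (y * v))" for v :: real
      by (simp add: bounded_linear_minus bounded_linear_mult_left)
    note C_k_on_bounded_linear[OF this op C_k_on_bilinear[OF bounded_bilinear_mult op Suc Suc]]
    moreover have "(inverse has_derivative (\<lambda>v. - (inverse x * inverse x * v))) (at x)" if "x \<in> - {0}" for x :: real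
      using that by (auto intro!: derivative_eq_intros)
    ultimately show ?case by (intro C_k_on_SucI[OF op])
  qed
  then show ?thesis by (simp add: smooth_on_def)
qed

lemma smooth_on_divide:
  fixes f g :: "'a::real_normed_vector \<Rightarrow> real"
  assumes "open S" "smooth_on S f" "smooth_on S g" "\<And>x. x \<in> S \<Longrightarrow> g x \<noteq> 0"
  shows "smooth_on S (\<lambda>x. f x / g x)"
  unfolding divide_inverse
  by (intro smooth_on_mult assms smooth_on_compose[OF assms(1) _ assms(3) smooth_on_inverse_real])
    (use assms(4) in auto)

lemma smooth_on_abs:
  fixes f :: "'a::real_normed_vector \<Rightarrow> real"
  assumes "open S" "smooth_on S f" "\<And>x. x \<in> S \<Longrightarrow> f x \<noteq> 0"
  shows "smooth_on S (\<lambda>x. \<bar>f x\<bar>)"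
proof -
  have "smooth_on (- {0}) (abs :: real \<Rightarrow> real)"
  proof (rule smooth_on_local)
    fix x :: real assume "x \<in> - {0}"
    then consider "x \<in> {0<..}" | "x \<in> {..<0}" by fastforce
    then show "\<exists>T. open T \<and> x \<in> T \<and> smooth_on T (abs :: real \<Rightarrow> real)"
    proof cases
      case 1
      have "smooth_on {0::real<..} abs"
        by (rule smooth_on_cong[OF _ _ smooth_on_linear[OF bounded_linear_ident]]) auto
      then show ?thesis using 1 by (intro exI[of _ "{0<..}"]) simp
    next
      case 2
      have "smooth_on {..<0::real} abs"
        by (rule smooth_on_cong[OF _ _ smooth_on_linear[OF bounded_linear_minus[OF bounded_linear_ident]]]) auto
      then show ?thesis using 2 by (intro exI[of _ "{..<0}"]) simp
    qed
  qed
  then show ?thesis by (intro smooth_on_compose[OF assms(1) _ assms(2)]) (use assms(3) in auto)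
qed

lemma smooth_on_det:
  fixes f :: "'a::real_normed_vector \<Rightarrow> real ^ 'n ^ 'n"
  assumes "open S" "\<And>i j. smooth_on S (\<lambda>x. f x $ i $ j)"
  shows "smooth_on S (\<lambda>x. det (f x))"
  unfolding det_def
  by (intro smooth_on_sum smooth_on_mult smooth_on_prod assms smooth_on_const)

section \<open>Uniform estimates for derivatives on compact sets\<close>

text \<open>Continuity of the derivative is available in one direction at a time. Compactness bounds
  the finitely many partial derivatives, and these bounds add up to one for all directions.\<close>

lemma smooth_on_derivative_bound:
  fixes f :: "'a::euclidean_space \<Rightarrow> 'b::real_normed_vector"
  assumes "smooth_on S f" "compact K" "K \<subseteq> S"
  obtains B where "B > 0" "\<And>x v. x \<in> K \<Longrightarrow> norm (frechet_derivative f (at x) v) \<le> B * norm v"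
proof -
  have "\<exists>B. \<forall>x\<in>K. norm (frechet_derivative f (at x) i) \<le> B" for i
  proof -
    have "continuous_on K (\<lambda>x. frechet_derivative f (at x) i)"
      using smooth_on_imp_continuous_on[OF smooth_on_frechet_derivative[OF assms(1)]] assms(3)
      by (rule continuous_on_subset)
    from compact_imp_bounded[OF compact_continuous_image[OF this assms(2)]]
    show ?thesis by (auto simp: bounded_iff)
  qed
  then obtain B where B: "\<And>i x. x \<in> K \<Longrightarrow> norm (frechet_derivative f (at x) i) \<le> B i" by metis
  \<comment> \<open>The summand 1 makes the constant positive even if all partial derivatives
    vanish; the absolute values are there because \<open>B i\<close> may be negative when K is
    empty.\<close>
  define C where "C = 1 + (\<Sum>i\<in>(Basis::'a set). \<bar>B i\<bar>)"
  have "C > 0" unfolding C_def by (smt (verit) sum_nonneg abs_ge_zero)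
  moreover have "norm (frechet_derivative f (at x) v) \<le> C * norm v" if "x \<in> K" for x v
  proof -
    have "frechet_derivative f (at x) v = (\<Sum>i\<in>Basis. (v \<bullet> i) *\<^sub>R frechet_derivative f (at x) i)"
      using linear_Basis_expansion[OF has_derivative_linear[OF smooth_on_has_derivative[OF assms(1)]]] assms(3) that
      by blast
    also have "norm \<dots> \<le> (\<Sum>i\<in>Basis. \<bar>B i\<bar> * norm v)"
    proof (rule sum_norm_le)
      fix i :: 'a assume i: "i \<in> Basis"
      have "norm ((v \<bullet> i) *\<^sub>R frechet_derivative f (at x) i) = \<bar>v \<bullet> i\<bar> * norm (frechet_derivative f (at x) i)" by simp
      also have "\<dots> \<le> norm v * \<bar>B i\<bar>"
        using Basis_le_norm[OF i] B[OF that, of i] by (intro mult_mono) auto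
      finally show "norm ((v \<bullet> i) *\<^sub>R frechet_derivative f (at x) i) \<le> \<bar>B i\<bar> * norm v" by (simp add: mult.commute)
    qed
    also have "\<dots> \<le> C * norm v" by (simp add: C_def distrib_right flip: sum_distrib_right)
    finally show ?thesis .
  qed
  ultimately show ?thesis using that by blast
qed

lemma smooth_on_lipschitz:
  fixes f :: "'a::euclidean_space \<Rightarrow> 'b::real_normed_vector"
  assumes "smooth_on S f" "compact K" "convex K" "K \<subseteq> S"
  obtains B where "B > 0" "\<And>x y. x \<in> K \<Longrightarrow> y \<in> K \<Longrightarrow> norm (f x - f y) \<le> B * norm (x - y)"
    "\<And>x v. x \<in> K \<Longrightarrow> norm (frechet_derivative f (at x) v) \<le> B * norm v"
proof -
  obtain B where B: "B > 0" "\<And>x v. x \<in> K \<Longrightarrow> norm (frechet_derivative f (at x) v) \<le> B * norm v"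
    using smooth_on_derivative_bound[OF assms(1,2,4)] by blast
  have "norm (f x - f y) \<le> B * norm (x - y)" if "x \<in> K" "y \<in> K" for x y
  proof (rule differentiable_bound[OF assms(3) _ _ that])
    fix x assume x: "x \<in> K"
    then show "(f has_derivative frechet_derivative f (at x)) (at x within K)"
      using has_derivative_at_withinI[OF smooth_on_has_derivative[OF assms(1)]] assms(4) by blast
    show "onorm (frechet_derivative f (at x)) \<le> B"
      using onorm_bound[OF less_imp_le[OF B(1)] B(2)[OF x]] .
  qed
  with B show ?thesis using that by blast
qed

text \<open>Uniformity in the base point is what differentiability of superposition operators in the
  supremum norm requires. It comes from uniform continuity of the partial derivatives on a compact
  neighbourhood of K, followed by the mean value inequality on a small ball.\<close>

lemma smooth_on_uniform_taylor:
  fixes f :: "'a::euclidean_space \<Rightarrow> 'b::real_normed_vector"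
  assumes f: "smooth_on S f" and "open S" and K: "compact K" "K \<subseteq> S" and "e > 0"
  obtains d where "d > 0"
    "\<And>x h. x \<in> K \<Longrightarrow> norm h < d \<Longrightarrow> x + h \<in> S \<and> norm (f (x + h) - f x - frechet_derivative f (at x) h) \<le> e * norm h"
proof -
  obtain r where r: "r > 0" "(\<Union>x\<in>K. cball x r) \<subseteq> S"
    using compact_subset_open_imp_cball_epsilon_subset[OF K(1) assms(2) K(2)] by blast
  have K': "(\<Union>x\<in>K. cball x r) = {x + y | x y. x \<in> K \<and> y \<in> cball 0 r}"
    by (auto simp: dist_norm) (metis add.commute diff_add_cancel norm_minus_commute)
  \<comment> \<open>K is thickened because derivatives are compared at x and at nearby points
    outside K; as a sum of two compact sets the thickening is compact.\<close>
  define K' where "K' = (\<Union>x\<in>K. cball x r)"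
  have cK': "compact K'" unfolding K'_def K' using compact_sums[OF K(1) compact_cball] .
  \<comment> \<open>Each basis direction gets the share e / D of the tolerance.\<close>
  define D where "D = real (DIM('a))"
  have D: "D > 0" by (simp add: D_def)
  have "\<exists>d>0. \<forall>x\<in>K'. \<forall>y\<in>K'. dist x y < d \<longrightarrow>
     dist (frechet_derivative f (at x) i) (frechet_derivative f (at y) i) < e / D" for i
  proof -
    have "continuous_on K' (\<lambda>x. frechet_derivative f (at x) i)"
      using smooth_on_imp_continuous_on[OF smooth_on_frechet_derivative[OF f]] r(2)
      unfolding K'_def by (rule continuous_on_subset)
    from compact_uniformly_continuous[OF this cK'] show ?thesis
      unfolding uniformly_continuous_on_def using divide_pos_pos[OF \<open>e > 0\<close> D] by (meson dist_commute_lessI)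
  qed
  then obtain d where d: "\<And>i. d i > 0" "\<And>i x y. x \<in> K' \<Longrightarrow> y \<in> K' \<Longrightarrow> dist x y < d i \<Longrightarrow>
     dist (frechet_derivative f (at x) i) (frechet_derivative f (at y) i) < e / D" by metis
  define \<delta> where "\<delta> = Min (insert r (d ` Basis))"
  have "\<delta> > 0" unfolding \<delta>_def using d(1) r(1) by (subst Min_gr_iff) auto
  moreover have "\<delta> \<le> r" "\<And>i. i \<in> Basis \<Longrightarrow> \<delta> \<le> d i" unfolding \<delta>_def by (rule Min_le; simp)+
  ultimately have \<delta>: "\<delta> > 0" "\<delta> \<le> r" "\<And>i. i \<in> Basis \<Longrightarrow> \<delta> \<le> d i" by auto
  have lin: "linear (frechet_derivative f (at x))" if "x \<in> K'" for x
    using has_derivative_linear[OF smooth_on_has_derivative[OF f]] that r(2) K'_def by blast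
  have *: "norm (frechet_derivative f (at y) v - frechet_derivative f (at x) v) \<le> e * norm v"
    if "x \<in> K" "norm (y - x) < \<delta>" for x y v
  proof -
    have xy: "x \<in> K'" "y \<in> K'" using that r(1) \<delta>(2) by (force simp: K'_def dist_norm norm_minus_commute)+
    have "frechet_derivative f (at y) v - frechet_derivative f (at x) v =
       (\<Sum>i\<in>Basis. (v \<bullet> i) *\<^sub>R (frechet_derivative f (at y) i - frechet_derivative f (at x) i))"
      using linear_Basis_expansion[OF lin[OF xy(1)], of v] linear_Basis_expansion[OF lin[OF xy(2)], of v]
      by (simp add: scaleR_diff_right sum_subtractf)
    also have "norm \<dots> \<le> (\<Sum>i\<in>(Basis::'a set). norm v * (e / D))"
    proof (rule sum_norm_le)
      fix i :: 'a assume i: "i \<in> Basis"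
      have "norm (frechet_derivative f (at y) i - frechet_derivative f (at x) i) \<le> e / D"
        using d(2)[OF xy(2,1), of i] \<delta>(3)[OF i] that(2) by (auto simp: dist_norm)
      then show "norm ((v \<bullet> i) *\<^sub>R (frechet_derivative f (at y) i - frechet_derivative f (at x) i)) \<le> norm v * (e / D)"
        using Basis_le_norm[OF i, of v] by (simp only: norm_scaleR) (intro mult_mono; simp)
    qed
    also have "\<dots> = e * norm v" using D by (simp add: D_def)
    finally show ?thesis .
  qed
  have "x + h \<in> S \<and> norm (f (x + h) - f x - frechet_derivative f (at x) h) \<le> e * norm h"
    if "x \<in> K" "norm h < \<delta>" for x h
  proof -
    have sub: "ball x \<delta> \<subseteq> S" using r(2) \<delta>(2) that(1) by force
    have "norm (f (x + h) - f x - frechet_derivative f (at x) (x + h - x)) \<le> norm (x + h - x) * e"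
    proof (rule differentiable_bound_linearization[where S = "ball x \<delta>"])
      show "x + t *\<^sub>R (x + h - x) \<in> ball x \<delta>" if "t \<in> {0..1}" for t
      proof -
        have "\<bar>t\<bar> * norm h \<le> 1 * norm h" using that by (intro mult_right_mono) auto
        then show ?thesis using \<open>norm h < \<delta>\<close> by (simp add: dist_norm)
      qed
      show "(f has_derivative frechet_derivative f (at y)) (at y within ball x \<delta>)" if "y \<in> ball x \<delta>" for y
        using has_derivative_at_withinI[OF smooth_on_has_derivative[OF f]] that sub by blast
      show "onorm (frechet_derivative f (at y) - frechet_derivative f (at x)) \<le> e" if "y \<in> ball x \<delta>" for y
        by (rule onorm_bound) (use *[OF \<open>x \<in> K\<close>, of y] that \<open>e > 0\<close> in \<open>auto simp: dist_norm norm_minus_commute fun_diff_def\<close>)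
      show "x \<in> ball x \<delta>" using \<delta>(1) by simp
    qed
    moreover have "x + h \<in> S" using sub that(2) by (auto simp: dist_norm subset_iff)
    ultimately show ?thesis by (simp add: mult.commute)
  qed
  with \<delta>(1) show ?thesis using that by blast
qed

section \<open>Smooth dependence of fixed points on parameters\<close>

lemma fixed_point_continuous:
  fixes F :: "'p::real_normed_vector \<Rightarrow> 'y::real_normed_vector \<Rightarrow> 'y"
  assumes eq: "\<And>p. p \<in> U \<Longrightarrow> z p = F p (z p)"
    and contr: "\<And>p q. p \<in> U \<Longrightarrow> q \<in> U \<Longrightarrow> norm (F p (z p) - F p (z q)) \<le> 1/2 * norm (z p - z q)"
    and cont: "\<And>q. q \<in> U \<Longrightarrow> continuous_on U (\<lambda>p. F p (z q))"
  shows "continuous_on U z"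
  unfolding continuous_on_def
proof
  fix q assume q: "q \<in> U"
  have "((\<lambda>p. F p (z q)) \<longlongrightarrow> F q (z q)) (at q within U)"
    using cont[OF q] q unfolding continuous_on_def by blast
  then have lim: "((\<lambda>p. 2 * norm (F p (z q) - F q (z q))) \<longlongrightarrow> 0) (at q within U)"
    by (intro tendsto_mult_right_zero tendsto_norm_zero) (simp add: LIM_zero_iff)
  have "((\<lambda>p. z p - z q) \<longlongrightarrow> 0) (at q within U)"
  proof (rule Lim_null_comparison[OF _ lim])
    show "\<forall>\<^sub>F p in at q within U. norm (z p - z q) \<le> 2 * norm (F p (z q) - F q (z q))"
      unfolding eventually_at_filter
    proof (rule always_eventually, intro allI impI)
      fix p assume p: "p \<in> U"
      have "z p - z q = (F p (z p) - F p (z q)) + (F p (z q) - F q (z q))"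
        using eq[OF p] eq[OF q] by simp
      then have "norm (z p - z q) \<le> norm (F p (z p) - F p (z q)) + norm (F p (z q) - F q (z q))"
        by (metis norm_triangle_ineq)
      then show "norm (z p - z q) \<le> 2 * norm (F p (z q) - F q (z q))" using contr[OF p q] by linarith
    qed
  qed
  then show "(z \<longlongrightarrow> z q) (at q within U)" by (simp add: LIM_zero_iff)
qed

text \<open>The derivative is forced: it must send h to the unique fixed point W h of w \<mapsto> F'
  (h, w). The increment D of z satisfies this linear equation up to o(|h| + |D|), so it is close to
  W h on that scale; this first gives |D| = O(|h|) and then the remainder estimate.\<close>

lemma fixed_point_has_derivative:
  fixes F :: "'p::real_normed_vector \<Rightarrow> 'y::banach \<Rightarrow> 'y"
  assumes U: "open U" "p \<in> U"
    and eq: "\<And>q. q \<in> U \<Longrightarrow> z q = F q (z q)"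
    and cont: "isCont z p"
    and F': "((\<lambda>(q, y). F q y) has_derivative F') (at (p, z p))"
    and contr: "\<And>w. norm (F' (0, w)) \<le> 1/2 * norm w"
  shows "\<exists>z'. (z has_derivative z') (at p) \<and> (\<forall>h. z' h = F' (h, z' h))"
proof -
  interpret F': bounded_linear F' using has_derivative_bounded_linear[OF F'] .
  have split: "F' (h, a) - F' (h, b) = F' (0, a - b)" for h a b
    using F'.diff[of "(h, a)" "(h, b)"] by simp
  have "\<exists>!w. F' (h, w) = w" for h
  proof (rule banach_fix_type[where c = "1/2"])
    show "\<forall>x y. dist (F' (h, x)) (F' (h, y)) \<le> 1 / 2 * dist x y"
      using contr by (auto simp: dist_norm split)
  qed auto
  then obtain W where W: "\<And>h. F' (h, W h) = W h" by metis
  \<comment> \<open>A residual bound: how badly D violates the linear equation controls its distance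
    to the solution. It yields linearity of W (residual zero), boundedness of W (D = 0) and the
    final remainder estimate.\<close>
  have key: "norm (D - W h) \<le> 2 * norm (D - F' (h, D))" for D h
  proof -
    have "D - W h = (D - F' (h, D)) + F' (0, D - W h)" by (simp add: W split[of h D "W h", symmetric])
    then have "norm (D - W h) \<le> norm (D - F' (h, D)) + norm (F' (0, D - W h))" by (metis norm_triangle_ineq)
    with contr[of "D - W h"] show ?thesis by linarith
  qed
  obtain K where K: "K > 0" "\<And>x. norm (F' x) \<le> norm x * K" using F'.pos_bounded by blast
  have Wb: "norm (W h) \<le> 2 * K * norm h" for h
    using key[of 0 h] K(2)[of "(h, 0)"] by (simp add: norm_Pair mult.commute[of K] mult.assoc)
  have "bounded_linear W"
  proof (rule bounded_linear_intro[where K = "2 * K"])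
    fix x y r
    have "F' (x + y, W x + W y) = W x + W y" using F'.add[of "(x, W x)" "(y, W y)"] W by simp
    then show "W (x + y) = W x + W y" using key[of "W x + W y" "x + y"] by simp
    have "F' (r *\<^sub>R x, r *\<^sub>R W x) = r *\<^sub>R W x" using F'.scaleR[of r "(x, W x)"] W by simp
    then show "W (r *\<^sub>R x) = r *\<^sub>R W x" using key[of "r *\<^sub>R W x" "r *\<^sub>R x"] by simp
    show "norm (W x) \<le> norm x * (2 * K)" using Wb[of x] by (simp add: mult.commute mult.left_commute)
  qed
  moreover have "\<exists>d>0. \<forall>q. norm (q - p) < d \<longrightarrow> norm (z q - z p - W (q - p)) \<le> e * norm (q - p)" if "e > 0" for e
  proof -
    \<comment> \<open>The bound 1/4 lets |D| be absorbed, giving |D| \<le> (4 K + 1) |h|; the other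
      bound makes the resulting remainder 2 e' (4 K + 2) |h| at most e |h|.\<close>
    define e' where "e' = min (1/4) (e / (2 * (4 * K + 2)))"
    have e': "e' > 0" "e' \<le> 1/4" "2 * e' * (4 * K + 2) \<le> e"
    proof -
      show "e' > 0" using that K(1) by (simp add: e'_def)
      show "e' \<le> 1/4" unfolding e'_def by (rule min.cobounded1)
      have "e' \<le> e / (2 * (4 * K + 2))" by (simp add: e'_def)
      then show "2 * e' * (4 * K + 2) \<le> e" using K(1) by (simp add: field_simps)
    qed
    obtain d' where d': "d' > 0" "\<And>q y. norm ((q, y) - (p, z p)) < d' \<Longrightarrow>
        norm (F q y - F p (z p) - F' ((q, y) - (p, z p))) \<le> e' * norm ((q, y) - (p, z p))"
      using F' e'(1) unfolding has_derivative_at_alt by fastforce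
    obtain d1 where d1: "d1 > 0" "\<And>q. norm (q - p) < d1 \<Longrightarrow> norm (z q - z p) < d' / 2"
      using cont d'(1) unfolding isCont_def LIM_def dist_norm
      by (metis (no_types, lifting) cancel_comm_monoid_add_class.diff_cancel half_gt_zero norm_zero)
    obtain d2 where d2: "d2 > 0" "ball p d2 \<subseteq> U" using U openE by blast
    define d where "d = min (min d1 d2) (d' / 2)"
    have "norm (z q - z p - W (q - p)) \<le> e * norm (q - p)" if q: "norm (q - p) < d" for q
    proof -
      have qU: "q \<in> U" using q d2(2) by (auto simp: d_def dist_norm norm_minus_commute)
      define h D where "h = q - p" and "D = z q - z p"
      have nP: "norm ((q, z q) - (p, z p)) \<le> norm h + norm D"
        unfolding h_def D_def using norm_Pair_le by (metis diff_Pair)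
      also have "\<dots> < d'" using q d1(2)[of q] by (simp add: h_def D_def d_def)
      finally have "norm (F q (z q) - F p (z p) - F' ((q, z q) - (p, z p))) \<le> e' * norm ((q, z q) - (p, z p))"
        by (rule d'(2))
      also have "\<dots> \<le> e' * (norm h + norm D)" using nP e'(1) by (intro mult_left_mono) auto
      finally have "norm (D - F' (h, D)) \<le> e' * (norm h + norm D)"
        using eq[OF qU] eq[OF U(2)] by (simp add: D_def h_def)
      then have R: "norm (D - W h) \<le> 2 * e' * (norm h + norm D)" using key[of D h] by linarith
      also have "\<dots> \<le> 1/2 * (norm h + norm D)" using e'(2) by (intro mult_right_mono) auto
      finally have "norm (D - W h) \<le> 1/2 * (norm h + norm D)" .
      moreover have "norm D \<le> norm (D - W h) + norm (W h)" by (metis diff_add_cancel norm_triangle_ineq)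
      ultimately have "norm D \<le> (4 * K + 1) * norm h" using Wb[of h] by (simp add: algebra_simps)
      then have "2 * e' * (norm h + norm D) \<le> 2 * e' * ((4 * K + 2) * norm h)"
        using e'(1) by (intro mult_left_mono) (auto simp: algebra_simps)
      also have "\<dots> = (2 * e' * (4 * K + 2)) * norm h" by simp
      also have "\<dots> \<le> e * norm h" using e'(3) by (rule mult_right_mono) simp
      finally show ?thesis using R by (simp add: D_def h_def)
    qed
    moreover have "d > 0" using d1(1) d2(1) d'(1) by (simp add: d_def)
    ultimately show ?thesis by blast
  qed
  ultimately have "(z has_derivative W) (at p)" unfolding has_derivative_at_alt by blast
  then show ?thesis using W by metis
qed

text \<open>Differentiating the equation in a direction v gives an equation for the derivative of w
  with the same coefficients \<open>A i\<close> and a new inhomogeneity. The contraction bound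
  concerns the coefficients alone, so it survives, and the induction runs over k with w and b
  arbitrary.\<close>

lemma C_k_on_linear_fixed_point:
  fixes w :: "'p::real_normed_vector \<Rightarrow> 'y::banach" and A :: "'i \<Rightarrow> 'p \<Rightarrow> 'c::real_normed_vector"
  assumes U: "open U" and \<beta>: "\<And>i. i \<in> I \<Longrightarrow> bounded_bilinear (\<beta> i)"
    and A: "\<And>i. i \<in> I \<Longrightarrow> C_k_on k U (A i)" and b: "C_k_on k U b"
    and eq: "\<And>p. p \<in> U \<Longrightarrow> w p = (\<Sum>i\<in>I. \<beta> i (A i p) (w p)) + b p"
    and contr: "\<And>p y. p \<in> U \<Longrightarrow> norm (\<Sum>i\<in>I. \<beta> i (A i p) y) \<le> 1/2 * norm y"
  shows "C_k_on k U w"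
  using A b eq
proof (induction k arbitrary: w b)
  case 0
  have bil: "(\<Sum>i\<in>I. \<beta> i (A i p) x) - (\<Sum>i\<in>I. \<beta> i (A i p) y) = (\<Sum>i\<in>I. \<beta> i (A i p) (x - y))" for p x y
    using bounded_bilinear.diff_right[OF \<beta>] by (simp flip: sum_subtractf)
  have "continuous_on U w"
  proof (rule fixed_point_continuous[where F = "\<lambda>p y. (\<Sum>i\<in>I. \<beta> i (A i p) y) + b p"])
    show "norm (((\<Sum>i\<in>I. \<beta> i (A i p) (w p)) + b p) - ((\<Sum>i\<in>I. \<beta> i (A i p) (w q)) + b p)) \<le> 1 / 2 * norm (w p - w q)"
      if "p \<in> U" for p q using contr[OF that, of "w p - w q"] bil[of p "w p" "w q"] by simp
    show "continuous_on U (\<lambda>p. (\<Sum>i\<in>I. \<beta> i (A i p) (w q)) + b p)" for q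
      using 0(1,2) by (auto intro!: continuous_intros bounded_bilinear.continuous_on[OF \<beta>])
  qed (use 0 in auto)
  then show ?case by simp
next
  case (Suc k)
  note A1 = C_k_on_Suc_imp[OF Suc.prems(1)] and b1 = C_k_on_Suc_imp[OF Suc.prems(2)]
  have wk: "C_k_on k U w" by (rule Suc.IH[OF A1 b1 Suc.prems(3)])
  then have "C_k_on 0 U w" by (induction k) (use C_k_on_Suc_imp in blast)+
  then have cont: "isCont w p" if "p \<in> U" for p using U that by (simp add: continuous_on_eq_continuous_at)
  define F' where "F' p = (\<lambda>(h, y). (\<Sum>i\<in>I. \<beta> i (A i p) y + \<beta> i (frechet_derivative (A i) (at p) h) (w p))
      + frechet_derivative b (at p) h)" for p
  have "\<exists>w'. (w has_derivative w') (at p) \<and> (\<forall>h. w' h = F' p (h, w' h))" if p: "p \<in> U" for p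
  proof (rule fixed_point_has_derivative[where F = "\<lambda>p y. (\<Sum>i\<in>I. \<beta> i (A i p) y) + b p", OF U p])
    have fstd: "((\<lambda>x. f (fst x)) has_derivative (\<lambda>x. f' (fst x))) (at (p, w p))"
      if "(f has_derivative f') (at p)" for f :: "'p \<Rightarrow> 'z::real_normed_vector" and f'
      using has_derivative_compose[OF bounded_linear_imp_has_derivative[OF bounded_linear_fst], of f f' "(p, w p)" UNIV] that
      by simp
    have *: "((\<lambda>x. (\<Sum>i\<in>I. \<beta> i (A i (fst x)) (snd x)) + b (fst x)) has_derivative
        (\<lambda>x. (\<Sum>i\<in>I. \<beta> i (A i (fst (p, w p))) (snd x) + \<beta> i (frechet_derivative (A i) (at p) (fst x)) (snd (p, w p)))
          + frechet_derivative b (at p) (fst x))) (at (p, w p))"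
      by (intro has_derivative_add has_derivative_sum bounded_bilinear.FDERIV[OF \<beta>] fstd
          bounded_linear_imp_has_derivative[OF bounded_linear_snd] C_k_on_SucD(1)[OF Suc.prems(1) p]
          C_k_on_SucD(1)[OF Suc.prems(2) p])
    then show "((\<lambda>(p, y). (\<Sum>i\<in>I. \<beta> i (A i p) y) + b p) has_derivative F' p) (at (p, w p))"
      by (simp add: F'_def case_prod_unfold)
    have "linear (frechet_derivative b (at p))" "\<And>i. i \<in> I \<Longrightarrow> linear (frechet_derivative (A i) (at p))"
      using has_derivative_linear[OF C_k_on_SucD(1)[OF Suc.prems(2) p]]
        has_derivative_linear[OF C_k_on_SucD(1)[OF Suc.prems(1) p]] by auto
    then have "F' p (0, y) = (\<Sum>i\<in>I. \<beta> i (A i p) y)" for y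
      unfolding F'_def by (auto simp: linear_0 bounded_bilinear.zero_left[OF \<beta>] intro!: sum.cong)
    then show "norm (F' p (0, y)) \<le> 1/2 * norm y" for y using contr[OF p] by simp
  qed (use Suc.prems(3) cont[OF p] in auto)
  then obtain w' where w': "\<And>p. p \<in> U \<Longrightarrow> (w has_derivative w' p) (at p)"
    "\<And>p h. p \<in> U \<Longrightarrow> w' p h = F' p (h, w' p h)" by metis
  show ?case
  proof (rule C_k_on_SucI[OF U w'(1)])
    fix v
    show "C_k_on k U (\<lambda>p. w' p v)"
    \<comment> \<open>The new inhomogeneity contains w itself next to the derivatives of
      \<open>A i\<close>; this is why \<open>wk\<close>, degree k for w, has to be established
      first.\<close>
    proof (rule Suc.IH[OF A1, of "\<lambda>p. (\<Sum>i\<in>I. \<beta> i (frechet_derivative (A i) (at p) v) (w p)) + frechet_derivative b (at p) v"])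
      show "C_k_on k U (\<lambda>p. (\<Sum>i\<in>I. \<beta> i (frechet_derivative (A i) (at p) v) (w p)) + frechet_derivative b (at p) v)"
        by (intro C_k_on_add C_k_on_sum C_k_on_bilinear[OF \<beta>] U wk C_k_on_SucD(2)[OF Suc.prems(1)] C_k_on_SucD(2)[OF Suc.prems(2)])
      show "w' p v = (\<Sum>i\<in>I. \<beta> i (A i p) (w' p v)) +
         ((\<Sum>i\<in>I. \<beta> i (frechet_derivative (A i) (at p) v) (w p)) + frechet_derivative b (at p) v)" if "p \<in> U" for p
        using w'(2)[OF that, of v] by (simp add: F'_def sum.distrib add.assoc)
    qed
  qed
qed

section \<open>Integral and superposition operators on curves\<close>

text \<open>Curves on [-1,1] are represented by bounded continuous functions on the whole line that
  are constant beyond the end points; this type carries the supremum norm and is a Banach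
  space.\<close>

definition clamp1 :: "real \<Rightarrow> real" where "clamp1 s = max (-1) (min 1 s)"

lemma clamp1_mem: "clamp1 s \<in> {-1..1}" by (auto simp: clamp1_def)
lemma clamp1_id: "s \<in> {-1..1} \<Longrightarrow> clamp1 s = s" by (auto simp: clamp1_def)
lemma clamp1_idem [simp]: "clamp1 (clamp1 s) = clamp1 s" by (rule clamp1_id[OF clamp1_mem])
lemma continuous_on_clamp1: "continuous_on S clamp1" unfolding clamp1_def by (intro continuous_intros)

definition curve :: "(real \<Rightarrow> 'e::real_normed_vector) \<Rightarrow> (real \<Rightarrow>\<^sub>C 'e)" where
  "curve u = Bcontfun (\<lambda>s. u (clamp1 s))"

lemma apply_curve:
  assumes "continuous_on {-1..1} u"
  shows "apply_bcontfun (curve u) s = u (clamp1 s)"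
proof -
  have "continuous_on UNIV (\<lambda>s. u (clamp1 s))"
    by (rule continuous_on_compose2[OF assms continuous_on_clamp1]) (use clamp1_mem in auto)
  moreover have "bounded (range (\<lambda>s. u (clamp1 s)))"
    by (rule bounded_subset[OF compact_imp_bounded[OF compact_continuous_image[OF assms]]]) (use clamp1_mem in auto)
  ultimately show ?thesis unfolding curve_def by (subst Bcontfun_inverse) (auto simp: bcontfun_def)
qed

text \<open>Bilinear building block for applying a curve of linear maps to a curve w of vectors: u
  is the curve of images of the basis vector i, and summing over i gives the whole action.\<close>

definition component_scale :: "'e::real_inner \<Rightarrow> (real \<Rightarrow>\<^sub>C 'f::real_normed_vector) \<Rightarrow> (real \<Rightarrow>\<^sub>C 'e) \<Rightarrow> (real \<Rightarrow>\<^sub>C 'f)" where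
  "component_scale i u w = curve (\<lambda>s. (w s \<bullet> i) *\<^sub>R u s)"

lemma apply_component_scale:
  "apply_bcontfun (component_scale i u w) s = (w (clamp1 s) \<bullet> i) *\<^sub>R u (clamp1 s)"
  unfolding component_scale_def by (subst apply_curve) (auto intro!: continuous_intros)

lemma bounded_bilinear_component_scale:
  fixes i :: "'e::real_inner"
  shows "bounded_bilinear (component_scale i :: (real \<Rightarrow>\<^sub>C 'f::real_normed_vector) \<Rightarrow> _)"
proof
  show "\<exists>K. \<forall>(a :: real \<Rightarrow>\<^sub>C 'f) b. norm (component_scale i a b) \<le> norm a * norm b * K"
  proof (rule exI[of _ "norm i"], intro allI norm_bound)
    fix a :: "real \<Rightarrow>\<^sub>C 'f" and b :: "real \<Rightarrow>\<^sub>C 'e" and s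
    have "\<bar>b (clamp1 s) \<bullet> i\<bar> \<le> norm b * norm i"
      by (rule order_trans[OF Cauchy_Schwarz_ineq2]) (intro mult_right_mono norm_bounded; simp)
    then have "\<bar>b (clamp1 s) \<bullet> i\<bar> * norm (a (clamp1 s)) \<le> (norm b * norm i) * norm a"
      by (intro mult_mono norm_bounded) auto
    then show "norm (component_scale i a b s) \<le> norm a * norm b * norm i"
      by (simp add: apply_component_scale mult_ac)
  qed
qed (auto intro!: bcontfun_eqI simp: apply_component_scale algebra_simps inner_add_left)

section \<open>Integration from 0 as a bounded operator on curves\<close>

text \<open>The integral from 0 to s, written as a difference of integrals from -1 so that negative
  s needs no separate case.\<close>

definition primitive :: "(real \<Rightarrow>\<^sub>C 'e::euclidean_space) \<Rightarrow> (real \<Rightarrow>\<^sub>C 'e)" where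
  "primitive y = curve (\<lambda>s. integral {-1..s} y - integral {-1..0} y)"

lemma has_vector_derivative_primitive_aux:
  fixes y :: "real \<Rightarrow>\<^sub>C 'e::euclidean_space"
  shows "s \<in> {-1..1} \<Longrightarrow> ((\<lambda>s. integral {-1..s} (apply_bcontfun y) - integral {-1..0} (apply_bcontfun y)) has_vector_derivative y s) (at s within {-1..1})"
  using integral_has_vector_derivative[of "-1" 1 y s]
  by (auto intro!: derivative_eq_intros)

lemma apply_primitive:
  fixes y :: "real \<Rightarrow>\<^sub>C 'e::euclidean_space"
  shows "apply_bcontfun (primitive y) s = integral {-1..clamp1 s} y - integral {-1..0} y"
  unfolding primitive_def
  by (rule apply_curve, rule continuous_on_vector_derivative) (rule has_vector_derivative_primitive_aux)

lemma primitive_0 [simp]: "apply_bcontfun (primitive y) 0 = 0"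
  by (simp add: apply_primitive clamp1_id)

lemma has_vector_derivative_primitive:
  assumes "s \<in> {-1..1}"
  shows "(apply_bcontfun (primitive y) has_vector_derivative y s) (at s within {-1..1})"
  by (rule has_vector_derivative_transform[OF assms _ has_vector_derivative_primitive_aux[OF assms]])
    (simp add: apply_primitive clamp1_id)

text \<open>The two integrals run over intervals of length at most 2 and 1. The crude constant 3
  reappears in the choice of the parameter range for the fixed point equation.\<close>

lemma norm_primitive_le: "norm (primitive y) \<le> 3 * norm y"
proof (rule norm_bound)
  fix s
  have *: "norm (integral {-1..s} y) \<le> norm y * (s - (-1))" if "s \<in> {-1..1}" for s
    using that by (intro integral_bound norm_bounded) auto
  have "norm (integral {-1..clamp1 s} y) \<le> norm y * 2"
    by (rule order_trans[OF *[OF clamp1_mem]]) (use clamp1_mem[of s] in \<open>intro mult_left_mono; auto\<close>)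
  moreover have "norm (integral {-1..0} y) \<le> norm y" using *[of 0] by simp
  ultimately show "norm (primitive y s) \<le> 3 * norm y"
    unfolding apply_primitive using norm_triangle_ineq4[of "integral {-1..clamp1 s} y" "integral {-1..0} y"] by linarith
qed

lemma bounded_linear_primitive: "bounded_linear primitive"
proof (rule bounded_linear_intro[where K = 3])
  have int: "(\<lambda>x. apply_bcontfun y x) integrable_on {a..b}" for y :: "real \<Rightarrow>\<^sub>C 'a" and a b
    by (intro integrable_continuous_real) simp
  show "primitive (x + y) = primitive x + primitive y" for x y :: "real \<Rightarrow>\<^sub>C 'a"
    by (rule bcontfun_eqI) (simp add: apply_primitive Henstock_Kurzweil_Integration.integral_add int)
  show "primitive (r *\<^sub>R x) = r *\<^sub>R primitive x" for r and x :: "real \<Rightarrow>\<^sub>C 'a"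
    by (rule bcontfun_eqI) (simp add: apply_primitive scaleR_diff_right)
qed (use norm_primitive_le in \<open>simp add: mult.commute\<close>)

lemma bounded_linear_const_bcontfun: "bounded_linear const_bcontfun"
  by (rule bounded_linear_intro[where K = 1]) (auto intro!: bcontfun_eqI norm_bound)

lemma bounded_linear_apply_bcontfun_at: "bounded_linear (\<lambda>y. apply_bcontfun y s)"
  by (rule bounded_linear_intro[where K = 1]) (auto intro!: norm_bounded)

section \<open>Superposition operators and their derivatives\<close>

definition superposition :: "('e::real_normed_vector \<Rightarrow> 'f::real_normed_vector) \<Rightarrow> (real \<Rightarrow>\<^sub>C 'e) \<Rightarrow> (real \<Rightarrow>\<^sub>C 'f)" where
  "superposition f y = curve (\<lambda>s. f (y s))"

lemma apply_superposition:
  "continuous_on S f \<Longrightarrow> apply_bcontfun y ` {-1..1} \<subseteq> S \<Longrightarrow> apply_bcontfun (superposition f y) s = f (y (clamp1 s))"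
  unfolding superposition_def by (subst apply_curve) (auto intro: continuous_on_compose2)

text \<open>The derivative of the superposition operator at y in direction h, arranged as a sum of
  bilinear terms whose coefficients are superpositions of partial derivatives of f; higher
  regularity in y is then a matter of induction.\<close>

definition superposition' :: "('e::euclidean_space \<Rightarrow> 'f::real_normed_vector) \<Rightarrow> (real \<Rightarrow>\<^sub>C 'e) \<Rightarrow> (real \<Rightarrow>\<^sub>C 'e) \<Rightarrow> (real \<Rightarrow>\<^sub>C 'f)" where
  "superposition' f y h = (\<Sum>i\<in>Basis. component_scale i (superposition (\<lambda>x. frechet_derivative f (at x) i) y) h)"

lemma apply_sum_bcontfun: "apply_bcontfun (\<Sum>i\<in>I. f i) s = (\<Sum>i\<in>I. apply_bcontfun (f i) s)"
  by (induction I rule: infinite_finite_induct) auto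

lemma apply_superposition':
  assumes f: "smooth_on S f" and y: "apply_bcontfun y ` {-1..1} \<subseteq> S"
  shows "apply_bcontfun (superposition' f y h) s = frechet_derivative f (at (y (clamp1 s))) (h (clamp1 s))"
proof -
  have yS: "y (clamp1 s) \<in> S" using y clamp1_mem by blast
  have "linear (frechet_derivative f (at (y (clamp1 s))))"
    using has_derivative_linear[OF smooth_on_has_derivative[OF f yS]] .
  then show ?thesis
    unfolding superposition'_def apply_sum_bcontfun apply_component_scale
      apply_superposition[OF smooth_on_imp_continuous_on[OF smooth_on_frechet_derivative[OF f]] y] clamp1_idem
    by (rule linear_Basis_expansion[symmetric])
qed

text \<open>At every curve parameter the remainder is a Taylor remainder based at a point of the
  compact image of y, so the uniform Taylor estimate is an estimate in the supremum norm. The same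
  radius keeps nearby curves inside S.\<close>

lemma superposition_has_derivative:
  assumes f: "smooth_on S f" and S: "open S" and y: "apply_bcontfun y ` {-1..1} \<subseteq> S"
  shows "(superposition f has_derivative superposition' f y) (at y)"
  unfolding has_derivative_at_alt
proof (intro conjI allI impI)
  show "bounded_linear (superposition' f y)"
    unfolding superposition'_def
    by (intro bounded_linear_sum bounded_bilinear.bounded_linear_right[OF bounded_bilinear_component_scale])
next
  fix e :: real assume "0 < e"
  have "compact (apply_bcontfun y ` {-1..1})" by (intro compact_continuous_image) auto
  from smooth_on_uniform_taylor[OF f S this y \<open>0 < e\<close>] obtain d where d: "d > 0"
    "\<And>x h. x \<in> apply_bcontfun y ` {-1..1} \<Longrightarrow> norm h < d \<Longrightarrow>
       x + h \<in> S \<and> norm (f (x + h) - f x - frechet_derivative f (at x) h) \<le> e * norm h"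
    by blast
  have "norm (superposition f y' - superposition f y - superposition' f y (y' - y)) \<le> e * norm (y' - y)"
    if "norm (y' - y) < d" for y'
  proof (rule norm_bound)
    fix s
    define h where "h = y' - y"
    have small: "norm (h r) < d" for r using norm_bounded[of h r] that by (simp add: h_def)
    have "y' r \<in> S" if "r \<in> {-1..1}" for r using d(2)[of "y r" "h r"] small that by (auto simp: h_def)
    then have y': "apply_bcontfun y' ` {-1..1} \<subseteq> S" by auto
    note cf = smooth_on_imp_continuous_on[OF f]
    have "norm (f (y (clamp1 s) + h (clamp1 s)) - f (y (clamp1 s)) - frechet_derivative f (at (y (clamp1 s))) (h (clamp1 s)))
       \<le> e * norm (h (clamp1 s))"
      using d(2)[of "y (clamp1 s)"] small clamp1_mem by blast
    also have "\<dots> \<le> e * norm h" using \<open>0 < e\<close> by (intro mult_left_mono norm_bounded) auto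
    finally show "norm ((superposition f y' - superposition f y - superposition' f y (y' - y)) s) \<le> e * norm (y' - y)"
      by (simp add: apply_superposition[OF cf y] apply_superposition[OF cf y'] apply_superposition'[OF f y] h_def)
  qed
  then show "\<exists>d>0. \<forall>y'. norm (y' - y) < d \<longrightarrow>
      norm (superposition f y' - superposition f y - superposition' f y (y' - y)) \<le> e * norm (y' - y)"
    using d(1) by (intro exI[of _ d]) simp
qed

text \<open>The induction must range over all smooth f, because the derivative involves
  superpositions of the partial derivatives of f.\<close>

lemma C_k_on_superposition:
  fixes z :: "'p::real_normed_vector \<Rightarrow> (real \<Rightarrow>\<^sub>C 'e::euclidean_space)"
    and f :: "'e \<Rightarrow> 'f::real_normed_vector"
  assumes U: "open U" and S: "open S" and "C_k_on k U z" and "smooth_on S f"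
    and z: "\<And>p. p \<in> U \<Longrightarrow> apply_bcontfun (z p) ` {-1..1} \<subseteq> S"
  shows "C_k_on k U (\<lambda>p. superposition f (z p))"
  using assms(3,4)
proof (induction k arbitrary: f)
  case 0
  have "isCont (\<lambda>p. superposition f (z p)) p" if "p \<in> U" for p
  proof (rule isCont_o2[of p z])
    show "isCont z p" using 0(1) U that by (simp add: continuous_on_eq_continuous_at)
    show "isCont (superposition f) (z p)"
      using has_derivative_continuous[OF superposition_has_derivative[OF 0(2) S z[OF that]]] .
  qed
  then show ?case by (auto intro: continuous_at_imp_continuous_on)
next
  case (Suc k)
  show ?case
  proof (rule C_k_on_SucI[OF U])
    show "((\<lambda>p. superposition f (z p)) has_derivative
        (\<lambda>v. superposition' f (z p) (frechet_derivative z (at p) v))) (at p)" if "p \<in> U" for p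
      using has_derivative_compose[OF C_k_on_SucD(1)[OF Suc.prems(1) that] superposition_has_derivative[OF Suc.prems(2) S z[OF that]]] .
    show "C_k_on k U (\<lambda>p. superposition' f (z p) (frechet_derivative z (at p) v))" for v
      unfolding superposition'_def
      by (intro C_k_on_sum U C_k_on_bilinear[OF bounded_bilinear_component_scale] Suc.IH
          C_k_on_Suc_imp[OF Suc.prems(1)] smooth_on_frechet_derivative Suc.prems(2) C_k_on_SucD(2)[OF Suc.prems(1)])
  qed
qed

section \<open>Local flows of smooth vector fields on open subsets of Euclidean space\<close>

instance bcontfun :: (metric_space, banach) banach ..

text \<open>Turns a differential equation into the fixed point equation, so that uniqueness of fixed
  points can identify curves: y minus the scaled primitive has derivative zero. Condition
  \<open>cl\<close>, constancy beyond the end points, extends the identity from [-1,1] to the whole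
  line.\<close>

lemma eq_const_plus_primitive:
  fixes g :: "'e::euclidean_space \<Rightarrow> 'e"
  assumes g: "continuous_on S g" and y: "apply_bcontfun y ` {-1..1} \<subseteq> S"
    and cl: "\<And>s. apply_bcontfun y (clamp1 s) = y s" and y0: "apply_bcontfun y 0 = x"
    and der: "\<And>s. s \<in> {-1..1} \<Longrightarrow> (apply_bcontfun y has_vector_derivative a *\<^sub>R g (y s)) (at s within {-1..1})"
  shows "y = const_bcontfun x + a *\<^sub>R primitive (superposition g y)"
proof -
  define d where "d s = y s - a *\<^sub>R primitive (superposition g y) s" for s
  have "(d has_vector_derivative 0) (at s within {-1..1})" if s: "s \<in> {-1..1}" for s
    unfolding d_def
    using has_vector_derivative_diff[OF der[OF s]
        bounded_linear.has_vector_derivative[OF bounded_linear_scaleR_right has_vector_derivative_primitive[OF s, of "superposition g y"], of a]]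
    by (simp add: apply_superposition[OF g y] clamp1_id[OF s])
  then obtain c where c: "\<And>s. s \<in> {-1..1} \<Longrightarrow> d s = c"
    using has_vector_derivative_zero_constant[of "{-1..1}" d] by auto
  have "y s = x + a *\<^sub>R primitive (superposition g y) s" for s
  proof -
    have "d (clamp1 s) = d 0" using c[OF clamp1_mem, of s] c[of 0] by simp
    moreover have "primitive (superposition g y) (clamp1 s) = primitive (superposition g y) s"
      by (simp add: apply_primitive)
    ultimately show ?thesis using y0 by (simp add: d_def cl algebra_simps)
  qed
  then show ?thesis by (intro bcontfun_eqI) simp
qed

lemma has_vector_derivative_fixed_curve:
  fixes g :: "'e::euclidean_space \<Rightarrow> 'e"
  assumes g: "continuous_on S g" and y: "apply_bcontfun y ` {-1..1} \<subseteq> S"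
    and eq: "y = const_bcontfun x + a *\<^sub>R primitive (superposition g y)"
  shows "apply_bcontfun y 0 = x"
    and "s \<in> {-1..1} \<Longrightarrow> (apply_bcontfun y has_vector_derivative a *\<^sub>R g (y s)) (at s within {-1..1})"
proof -
  have ys: "y s = x + a *\<^sub>R primitive (superposition g y) s" for s
    by (subst eq) simp
  show "y 0 = x" using ys[of 0] by simp
  assume s: "s \<in> {-1..1}"
  have "((\<lambda>s. x + a *\<^sub>R primitive (superposition g y) s) has_vector_derivative a *\<^sub>R g (y s)) (at s within {-1..1})"
    using has_vector_derivative_add[OF has_vector_derivative_const[of x]
        bounded_linear.has_vector_derivative[OF bounded_linear_scaleR_right has_vector_derivative_primitive[OF s, of "superposition g y"], of a]]
    by (simp add: apply_superposition[OF g y] clamp1_id[OF s])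
  then show "(apply_bcontfun y has_vector_derivative a *\<^sub>R g (y s)) (at s within {-1..1})"
    by (simp flip: ys)
qed

lemma bounded_bilinear_linear_compose:
  assumes "bounded_linear L" "bounded_bilinear B"
  shows "bounded_bilinear (\<lambda>x y. L (B x y))"
proof -
  interpret L: bounded_linear L by fact
  interpret B: bounded_bilinear B by fact
  obtain K where K: "K > 0" "\<And>x. norm (L x) \<le> norm x * K" using L.pos_bounded by blast
  obtain M where M: "\<And>x y. norm (B x y) \<le> norm x * norm y * M" using B.bounded by blast
  show ?thesis
  proof
    have "norm (L (B a b)) \<le> norm a * norm b * (M * K)" for a b
      using order_trans[OF K(2) mult_right_mono[OF M, of K]] K(1) by (simp add: mult.assoc)
    then show "\<exists>K. \<forall>a b. norm (L (B a b)) \<le> norm a * norm b * K" by blast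
  qed (simp_all add: B.add_left B.add_right B.scaleR_left B.scaleR_right L.add L.scaleR)
qed

text \<open>Solutions are sought among curves in a closed ball, where g and its derivative are
  bounded; uniqueness is claimed only there. Every degree k gets the same parameter set, as
  smoothness requires.\<close>

lemma smooth_solution_curves:
  fixes g :: "'e::euclidean_space \<Rightarrow> 'e"
  assumes g: "smooth_on S g" and S: "open S" and z0: "z0 \<in> S"
  shows "\<exists>\<alpha>>0. \<exists>r>0. \<exists>R. \<exists>z :: real \<times> 'e \<Rightarrow> (real \<Rightarrow>\<^sub>C 'e).
    cball z0 R \<subseteq> S \<and>
    (\<forall>k. C_k_on k ({-\<alpha><..<\<alpha>} \<times> ball z0 r) z) \<and>
    (\<forall>a x. a \<in> {-\<alpha><..<\<alpha>} \<longrightarrow> x \<in> ball z0 r \<longrightarrow>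
       (\<forall>s. apply_bcontfun (z (a, x)) s \<in> cball z0 R) \<and>
       z (a, x) = const_bcontfun x + a *\<^sub>R primitive (superposition g (z (a, x))) \<and>
       (\<forall>y. (\<forall>s. apply_bcontfun y s \<in> cball z0 R) \<and>
            y = const_bcontfun x + a *\<^sub>R primitive (superposition g y) \<longrightarrow> y = z (a, x)))"
proof -
  obtain R where R: "R > 0" "cball z0 R \<subseteq> S" using S z0 open_contains_cball by blast
  define B where "B = cball z0 R"
  have B: "compact B" "convex B" "B \<subseteq> S" using R by (auto simp: B_def)
  note cg = smooth_on_imp_continuous_on[OF g]
  obtain M where M: "\<And>x. x \<in> B \<Longrightarrow> norm (g x) \<le> M"
    using compact_imp_bounded[OF compact_continuous_image[OF continuous_on_subset[OF cg B(3)] B(1)]]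
    by (auto simp: bounded_iff)
  have M0: "M \<ge> 0" using M[of z0] R(1) by (auto simp: B_def intro: order_trans[OF norm_ge_zero])
  obtain K where K: "K > 0" "\<And>x y. x \<in> B \<Longrightarrow> y \<in> B \<Longrightarrow> norm (g x - g y) \<le> K * norm (x - y)"
    "\<And>x v. x \<in> B \<Longrightarrow> norm (frechet_derivative g (at x) v) \<le> K * norm v"
    using smooth_on_lipschitz[OF g B] by blast
  \<comment> \<open>With the constant 3 of \<open>norm_primitive_le\<close>, the first bound moves a
    curve by at most R / 2, so starting points within R / 2 of z0 keep it in the ball; the second
    makes the map a contraction with factor 1/2. M + 1 avoids a zero denominator.\<close>
  define \<alpha> where "\<alpha> = min (R / (6 * (M + 1))) (1 / (6 * K))"
  have \<alpha>: "\<alpha> > 0" using R(1) M0 K(1) by (simp add: \<alpha>_def)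
  have "\<alpha> \<le> R / (6 * (M + 1))" "\<alpha> \<le> 1 / (6 * K)" by (simp_all add: \<alpha>_def)
  then have \<alpha>M: "\<alpha> * (3 * M) \<le> R / 2" and \<alpha>K: "\<alpha> * (3 * K) \<le> 1/2"
    using M0 K(1) \<alpha> by (simp_all add: field_simps)
  define Y where "Y = {y :: real \<Rightarrow>\<^sub>C 'e. \<forall>s. y s \<in> B}"
  have Y: "apply_bcontfun y ` {-1..1} \<subseteq> B" "apply_bcontfun y ` {-1..1} \<subseteq> S" if "y \<in> Y" for y
    using that B(3) by (auto simp: Y_def)
  have sup: "superposition g y s = g (y (clamp1 s))" if "y \<in> Y" for y s
    by (rule apply_superposition[OF cg Y(2)[OF that]])
  have "closed Y"
  proof -
    have "Y = PiC UNIV (\<lambda>_. B)" by (auto simp: Y_def mem_PiC_iff Pi_iff)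
    then show ?thesis using closed_PiC[of UNIV "\<lambda>_. B"] B(1) compact_imp_closed by metis
  qed
  define F where "F = (\<lambda>(a, x) y. const_bcontfun x + a *\<^sub>R primitive (superposition g y))"
  define U where "U = {-\<alpha><..<\<alpha>} \<times> ball z0 (R / 2)"
  have U: "open U" by (simp add: U_def open_Times)
  have Fmem: "F (a, x) y \<in> Y" if "(a, x) \<in> U" "y \<in> Y" for a x y
  proof -
    have "norm (superposition g y) \<le> M"
      by (rule norm_bound) (use M \<open>y \<in> Y\<close> in \<open>auto simp: sup Y_def\<close>)
    then have P: "norm (primitive (superposition g y)) \<le> 3 * M" using norm_primitive_le[of "superposition g y"] by linarith
    have "dist z0 (F (a, x) y s) \<le> R" for s
    proof -
      have "norm (a *\<^sub>R primitive (superposition g y) s) \<le> \<alpha> * (3 * M)"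
        using that(1) order_trans[OF norm_bounded P, of s] \<alpha> unfolding norm_scaleR
        by (intro mult_mono) (auto simp: U_def)
      then have "norm (a *\<^sub>R primitive (superposition g y) s) \<le> R / 2" using \<alpha>M by linarith
      moreover have "norm (z0 - x) < R / 2" using that(1) by (simp add: U_def dist_norm)
      moreover have "z0 - F (a, x) y s = (z0 - x) - a *\<^sub>R primitive (superposition g y) s" by (simp add: F_def)
      then have "norm (z0 - F (a, x) y s) \<le> norm (z0 - x) + norm (a *\<^sub>R primitive (superposition g y) s)"
        by (metis norm_triangle_ineq4)
      ultimately show ?thesis unfolding dist_norm by linarith
    qed
    then show ?thesis by (simp add: Y_def B_def)
  qed
  \<comment> \<open>Used both for differences of \<open>F p\<close> and for its linearisation, so
    that one \<alpha> makes both contractions.\<close>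
  have scaled: "norm (a *\<^sub>R primitive u) \<le> 1/2 * N" if "a \<in> {-\<alpha><..<\<alpha>}" "norm u \<le> K * N" for a and u :: "real \<Rightarrow>\<^sub>C 'e" and N
  proof -
    have "norm (a *\<^sub>R primitive u) \<le> \<alpha> * (3 * (K * N))"
      using that norm_primitive_le[of u] \<alpha> unfolding norm_scaleR by (intro mult_mono) auto
    also have "\<dots> = (\<alpha> * (3 * K)) * N" by simp
    also have "\<dots> \<le> 1/2 * N"
      using that(2) norm_ge_zero[of u] K(1) by (intro mult_right_mono[OF \<alpha>K]) (smt (verit) zero_le_mult_iff)
    finally show ?thesis .
  qed
  have contr: "norm (F p y1 - F p y2) \<le> 1/2 * norm (y1 - y2)" if p: "p \<in> U" and y: "y1 \<in> Y" "y2 \<in> Y" for p y1 y2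
  proof -
    obtain a x where p_eq: "p = (a, x)" by fastforce
    have "norm (superposition g y1 - superposition g y2) \<le> K * norm (y1 - y2)"
    proof (rule norm_bound)
      fix s
      have "norm (g (y1 (clamp1 s)) - g (y2 (clamp1 s))) \<le> K * norm ((y1 - y2) (clamp1 s))"
        using K(2)[of "y1 (clamp1 s)" "y2 (clamp1 s)"] y by (simp add: Y_def)
      also have "\<dots> \<le> K * norm (y1 - y2)" using K(1) by (intro mult_left_mono norm_bounded) auto
      finally show "norm ((superposition g y1 - superposition g y2) s) \<le> K * norm (y1 - y2)"
        using y by (simp add: sup)
    qed
    moreover have "F p y1 - F p y2 = a *\<^sub>R primitive (superposition g y1 - superposition g y2)"
      by (simp add: F_def p_eq linear_diff[OF bounded_linear.linear[OF bounded_linear_primitive]] scaleR_diff_right)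
    ultimately show ?thesis using scaled[of a] p by (simp add: p_eq U_def)
  qed
  have "\<exists>!y. y \<in> Y \<and> F p y = y" if "p \<in> U" for p
  proof (rule Banach_fix[where c = "1/2", simplified])
    show "complete Y" using \<open>closed Y\<close> complete_eq_closed by blast
    have "const_bcontfun z0 \<in> Y" using R(1) by (simp add: Y_def B_def)
    then show "Y \<noteq> {}" by blast
    show "F p ` Y \<subseteq> Y" using Fmem that by (cases p) auto
    show "dist (F p y1) (F p y2) * 2 \<le> dist y1 y2" if "y1 \<in> Y" "y2 \<in> Y" for y1 y2
      using contr[OF \<open>p \<in> U\<close> that] by (simp add: dist_norm)
  qed
  then obtain z where z: "\<And>p. p \<in> U \<Longrightarrow> z p \<in> Y" "\<And>p. p \<in> U \<Longrightarrow> F p (z p) = z p"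
    "\<And>p y. p \<in> U \<Longrightarrow> y \<in> Y \<Longrightarrow> F p y = y \<Longrightarrow> y = z p" by metis
  have zS: "apply_bcontfun (z p) ` {-1..1} \<subseteq> S" if "p \<in> U" for p using Y(2)[OF z(1)[OF that]] .
  have Dbound: "norm (superposition' g (z p) w) \<le> K * norm w" if "p \<in> U" for p w
  proof (rule norm_bound)
    fix s
    have "norm (frechet_derivative g (at (z p (clamp1 s))) (w (clamp1 s))) \<le> K * norm (w (clamp1 s))"
      by (rule K(3)) (use z(1)[OF that] in \<open>simp add: Y_def\<close>)
    also have "\<dots> \<le> K * norm w" using K(1) by (intro mult_left_mono norm_bounded) auto
    finally show "norm (superposition' g (z p) w s) \<le> K * norm w"
      by (simp add: apply_superposition'[OF g zS[OF that]])
  qed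
  have cont: "continuous_on U z"
  proof (rule fixed_point_continuous[where F = F])
    show "continuous_on U (\<lambda>p. F p (z q))" for q
      unfolding F_def case_prod_unfold
      by (intro continuous_intros bounded_linear.continuous_on[OF bounded_linear_const_bcontfun])
    show "z p = F p (z p)" if "p \<in> U" for p using z(2)[OF that] by (rule sym)
    show "norm (F p (z p) - F p (z q)) \<le> 1/2 * norm (z p - z q)" if "p \<in> U" "q \<in> U" for p q
      by (rule contr[OF that(1) z(1)[OF that(1)] z(1)[OF that(2)]])
  qed
  have C: "C_k_on k U z" for k
  proof (induction k)
    case 0
    then show ?case using cont by simp
  next
    case (Suc k)
    define F' where "F' p = (\<lambda>(h, w). const_bcontfun (snd h) + (fst p *\<^sub>R primitive (superposition' g (z p) w)
        + fst h *\<^sub>R primitive (superposition g (z p))))" for p :: "real \<times> 'e" and h :: "(real \<times> 'e) \<times> (real \<Rightarrow>\<^sub>C 'e)"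
    have "\<exists>z'. (z has_derivative z') (at p) \<and> (\<forall>h. z' h = F' p (h, z' h))" if p: "p \<in> U" for p
    proof (rule fixed_point_has_derivative[where F = F, OF U p])
      show "isCont z p" using cont U p by (simp add: continuous_on_eq_continuous_at)
      have sg: "(superposition g has_derivative superposition' g (snd (p, z p))) (at (snd (p, z p)))"
        using superposition_has_derivative[OF g S zS[OF p]] by simp
      have "((\<lambda>x. const_bcontfun (snd (fst x)) + fst (fst x) *\<^sub>R primitive (superposition g (snd x)))
         has_derivative (\<lambda>x. const_bcontfun (snd (fst x)) +
            (fst (fst (p, z p)) *\<^sub>R primitive (superposition' g (snd (p, z p)) (snd x))
             + fst (fst x) *\<^sub>R primitive (superposition g (snd (p, z p)))))) (at (p, z p))"
        by (intro has_derivative_add has_derivative_scaleR bounded_linear.has_derivative[OF bounded_linear_primitive]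
            bounded_linear.has_derivative[OF bounded_linear_const_bcontfun]
            has_derivative_compose[OF bounded_linear_imp_has_derivative[OF bounded_linear_snd] sg]
            has_derivative_fst has_derivative_snd has_derivative_ident)
      then show "((\<lambda>(q, y). F q y) has_derivative F' p) (at (p, z p))"
        by (simp add: F_def F'_def case_prod_unfold)
      show "norm (F' p (0, w)) \<le> 1/2 * norm w" for w
        using scaled[OF _ Dbound[OF p], of "fst p" w] p by (auto simp: F'_def U_def)
      show "z q = F q (z q)" if "q \<in> U" for q using z(2)[OF that] by (rule sym)
    qed
    then obtain z' where z': "\<And>p. p \<in> U \<Longrightarrow> (z has_derivative z' p) (at p)"
      "\<And>p h. p \<in> U \<Longrightarrow> z' p h = F' p (h, z' p h)" by metis
    define \<beta> where "\<beta> i u w = primitive (component_scale i u w)" for i :: 'e and u w :: "real \<Rightarrow>\<^sub>C 'e"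
    have \<beta>: "bounded_bilinear (\<beta> i)" for i
    proof -
      have "\<beta> i = (\<lambda>u w. primitive (component_scale i u w))" by (simp add: \<beta>_def fun_eq_iff)
      then show ?thesis
        using bounded_bilinear_linear_compose[OF bounded_linear_primitive bounded_bilinear_component_scale] by simp
    qed
    have sum\<beta>: "(\<Sum>i\<in>Basis. \<beta> i (fst p *\<^sub>R superposition (\<lambda>x. frechet_derivative g (at x) i) (z p)) w)
        = fst p *\<^sub>R primitive (superposition' g (z p) w)" for p w
      by (simp add: bounded_bilinear.scaleR_left[OF bounded_bilinear_component_scale] superposition'_def \<beta>_def
          linear_scale[OF bounded_linear.linear[OF bounded_linear_primitive]]
          linear_sum[OF bounded_linear.linear[OF bounded_linear_primitive]] scaleR_right.sum)
    show ?case
    proof (rule C_k_on_SucI[OF U z'(1)])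
      \<comment> \<open>If z has degree k, so do the partial derivatives of g along z, and hence all
        data of the linear equation for \<open>z' p v\<close>. Its solution then has degree k, which
        raises z to degree k + 1 on the unchanged set U.\<close>
      fix v
      show "C_k_on k U (\<lambda>p. z' p v)"
      proof (rule C_k_on_linear_fixed_point[OF U, where \<beta> = \<beta> and I = Basis
            and A = "\<lambda>i p. fst p *\<^sub>R superposition (\<lambda>x. frechet_derivative g (at x) i) (z p)"
            and b = "\<lambda>p. const_bcontfun (snd v) + fst v *\<^sub>R primitive (superposition g (z p))"])
        show "C_k_on k U (\<lambda>p. fst p *\<^sub>R superposition (\<lambda>x. frechet_derivative g (at x) i) (z p))" for i
          by (intro C_k_on_bilinear[OF bounded_bilinear_scaleR] U C_k_on_linear bounded_linear_fst
              C_k_on_superposition[OF U S Suc.IH smooth_on_frechet_derivative[OF g] zS])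
        show "C_k_on k U (\<lambda>p. const_bcontfun (snd v) + fst v *\<^sub>R primitive (superposition g (z p)))"
          by (intro C_k_on_add U C_k_on_const C_k_on_bounded_linear[OF bounded_linear_scaleR_right]
              C_k_on_bounded_linear[OF bounded_linear_primitive] C_k_on_superposition[OF U S Suc.IH g zS])
        show "z' p v = (\<Sum>i\<in>Basis. \<beta> i (fst p *\<^sub>R superposition (\<lambda>x. frechet_derivative g (at x) i) (z p)) (z' p v)) +
          (const_bcontfun (snd v) + fst v *\<^sub>R primitive (superposition g (z p)))" if "p \<in> U" for p
          using z'(2)[OF that, of v] by (simp add: sum\<beta> F'_def add_ac)
        show "norm (\<Sum>i\<in>Basis. \<beta> i (fst p *\<^sub>R superposition (\<lambda>x. frechet_derivative g (at x) i) (z p)) w) \<le> 1/2 * norm w"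
          if "p \<in> U" for p w
          unfolding sum\<beta> using scaled[OF _ Dbound[OF that], of "fst p" w] that by (auto simp: U_def)
      qed (rule \<beta>)
    qed
  qed
  show ?thesis
  proof (rule exI[of _ \<alpha>], intro conjI \<alpha>, rule exI[of _ "R / 2"], intro conjI,
      use R(1) in simp, rule exI[of _ R], rule exI[of _ z], intro conjI allI impI)
    show "cball z0 R \<subseteq> S" by (rule R(2))
    show "C_k_on k ({- \<alpha><..<\<alpha>} \<times> ball z0 (R / 2)) z" for k using C by (simp add: U_def)
    fix a x assume "a \<in> {- \<alpha><..<\<alpha>}" "x \<in> ball z0 (R / 2)"
    then have p: "(a, x) \<in> U" by (simp add: U_def)
    show "z (a, x) s \<in> cball z0 R" for s using z(1)[OF p] by (simp add: Y_def B_def)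
    show "z (a, x) = const_bcontfun x + a *\<^sub>R primitive (superposition g (z (a, x)))"
      using z(2)[OF p] by (simp add: F_def)
    show "y = z (a, x)" if "(\<forall>s. apply_bcontfun y s \<in> cball z0 R) \<and> y = const_bcontfun x + a *\<^sub>R primitive (superposition g y)" for y
      using that by (intro z(3)[OF p]) (auto simp: F_def Y_def B_def)
  qed
qed

section \<open>From solution curves to a local flow\<close>

theorem local_flow_euclidean:
  fixes g :: "'e::euclidean_space \<Rightarrow> 'e"
  assumes g: "smooth_on S g" and S: "open S" and z0: "z0 \<in> S"
  obtains \<epsilon> V \<Phi> where "\<epsilon> > 0" "open V" "z0 \<in> V"
    "smooth_on ({-\<epsilon><..<\<epsilon>} \<times> V) (\<lambda>(s, x). \<Phi> s x)"
    "\<And>x. x \<in> V \<Longrightarrow> \<Phi> 0 x = x"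
    "\<And>s x. s \<in> {-\<epsilon><..<\<epsilon>} \<Longrightarrow> x \<in> V \<Longrightarrow> \<Phi> s x \<in> S"
    "\<And>s x. s \<in> {-\<epsilon><..<\<epsilon>} \<Longrightarrow> x \<in> V \<Longrightarrow> ((\<lambda>s. \<Phi> s x) has_vector_derivative g (\<Phi> s x)) (at s)"
proof -
  obtain \<alpha> r R and z :: "real \<times> 'e \<Rightarrow> (real \<Rightarrow>\<^sub>C 'e)" where \<alpha>: "\<alpha> > 0" and r: "r > 0" and R: "cball z0 R \<subseteq> S"
    and C: "\<And>k. C_k_on k ({-\<alpha><..<\<alpha>} \<times> ball z0 r) z"
    and mem: "\<And>a x s. a \<in> {-\<alpha><..<\<alpha>} \<Longrightarrow> x \<in> ball z0 r \<Longrightarrow> apply_bcontfun (z (a, x)) s \<in> cball z0 R"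
    and eq: "\<And>a x. a \<in> {-\<alpha><..<\<alpha>} \<Longrightarrow> x \<in> ball z0 r \<Longrightarrow>
       z (a, x) = const_bcontfun x + a *\<^sub>R primitive (superposition g (z (a, x)))"
    and uniq: "\<And>a x y. a \<in> {-\<alpha><..<\<alpha>} \<Longrightarrow> x \<in> ball z0 r \<Longrightarrow> (\<forall>s. apply_bcontfun y s \<in> cball z0 R) \<Longrightarrow>
            y = const_bcontfun x + a *\<^sub>R primitive (superposition g y) \<Longrightarrow> y = z (a, x)"
    using smooth_solution_curves[OF assms] by metis
  define V where "V = ball z0 r"
  \<comment> \<open>The value \<epsilon> must itself be an admissible speed, hence lie strictly
    below \<alpha>: the single curve with speed \<epsilon> describes the motion for all times up to
    \<epsilon> in absolute value.\<close>
  define \<epsilon> where "\<epsilon> = \<alpha> / 2"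
  have \<epsilon>: "\<epsilon> > 0" "\<epsilon> < \<alpha>" using \<alpha> by (auto simp: \<epsilon>_def)
  define \<Phi> where "\<Phi> s x = z (s, x) 1" for s x
  note cg = smooth_on_imp_continuous_on[OF g]
  have zS: "apply_bcontfun (z (a, x)) ` {-1..1} \<subseteq> S" if "a \<in> {-\<alpha><..<\<alpha>}" "x \<in> V" for a x
    using mem[OF that(1)] that(2) R by (auto simp: V_def)
  have zder: "z (a, x) 0 = x"
    "s \<in> {-1..1} \<Longrightarrow> (apply_bcontfun (z (a, x)) has_vector_derivative a *\<^sub>R g (z (a, x) s)) (at s within {-1..1})"
    if "a \<in> {-\<alpha><..<\<alpha>}" "x \<in> V" for a x s
    using has_vector_derivative_fixed_curve[OF cg zS[OF that] eq[OF that(1)]] that(2) by (auto simp: V_def)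
  \<comment> \<open>The curve with parameter \<open>a\<close> runs along the flow at speed \<open>a\<close>; hence smoothness in \<open>a\<close> is
    smoothness in time.\<close>
  have rescale: "\<Phi> s x = z (\<epsilon>, x) (s / \<epsilon>)" if s: "s \<in> {-\<epsilon>..\<epsilon>}" and x: "x \<in> V" for s x
  proof -
    define l where "l = s / \<epsilon>"
    have l: "l \<in> {-1..1}" "s = l * \<epsilon>" using s \<epsilon> by (auto simp: l_def field_simps)
    have lr: "l * r \<in> {-1..1}" if "r \<in> {-1..1}" for r
    proof -
      have "\<bar>l * r\<bar> \<le> 1 * 1" unfolding abs_mult using l that by (intro mult_mono) auto
      then show ?thesis by auto
    qed
    have e\<alpha>: "\<epsilon> \<in> {-\<alpha><..<\<alpha>}" "s \<in> {-\<alpha><..<\<alpha>}" using s \<epsilon> by auto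
    define y where "y = curve (\<lambda>r. z (\<epsilon>, x) (l * r))"
    have y: "apply_bcontfun y r = z (\<epsilon>, x) (l * clamp1 r)" for r
      unfolding y_def
    proof (rule apply_curve)
      show "continuous_on {- 1..1} (\<lambda>x'. z (\<epsilon>, x) (l * x'))"
        by (rule continuous_on_compose2[of UNIV "apply_bcontfun (z (\<epsilon>, x))"]) (auto intro!: continuous_intros)
    qed
    have ymem: "apply_bcontfun y r \<in> cball z0 R" for r using mem[OF e\<alpha>(1)] x by (simp add: y V_def)
    \<comment> \<open>Slowing the curve of speed \<epsilon> down by the factor l gives a solution
      with speed l \<epsilon> = s, and uniqueness of the fixed point identifies the two.\<close>
    have "y = z (s, x)"
    proof (rule uniq[OF e\<alpha>(2)])
      show "y = const_bcontfun x + s *\<^sub>R primitive (superposition g y)"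
      proof (rule eq_const_plus_primitive[OF cg])
        fix r :: real assume r: "r \<in> {-1..1}"
        have "((\<lambda>r. l * r) has_vector_derivative l) (at r within {-1..1})"
          by (auto intro!: derivative_eq_intros simp: has_vector_derivative_def)
        moreover have "(apply_bcontfun (z (\<epsilon>, x)) has_vector_derivative \<epsilon> *\<^sub>R g (z (\<epsilon>, x) (l * r))) (at (l * r) within (\<lambda>r. l * r) ` {-1..1})"
          by (rule has_vector_derivative_within_subset[OF zder(2)[OF e\<alpha>(1) x lr[OF r]]]) (use lr in auto)
        ultimately have "((apply_bcontfun (z (\<epsilon>, x)) \<circ> (\<lambda>r. l * r)) has_vector_derivative l *\<^sub>R (\<epsilon> *\<^sub>R g (z (\<epsilon>, x) (l * r)))) (at r within {-1..1})"
          by (rule vector_diff_chain_within)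
        then have "((\<lambda>r. z (\<epsilon>, x) (l * r)) has_vector_derivative s *\<^sub>R g (y r)) (at r within {-1..1})"
          by (simp add: o_def y clamp1_id[OF r] l(2))
        then show "(apply_bcontfun y has_vector_derivative s *\<^sub>R g (y r)) (at r within {-1..1})"
          by (rule has_vector_derivative_transform[OF r, rotated]) (simp add: y clamp1_id)
      next
        show "apply_bcontfun y ` {-1..1} \<subseteq> S" using ymem R by blast
      qed (use zder(1)[OF e\<alpha>(1) x] in \<open>auto simp: y clamp1_id\<close>)
    qed (use x ymem in \<open>auto simp: V_def\<close>)
    then show ?thesis using y[of 1] by (simp add: \<Phi>_def clamp1_id l_def)
  qed
  show ?thesis
  proof (rule that[of \<epsilon> V \<Phi>])
    show "\<epsilon> > 0" "open V" "z0 \<in> V" using \<epsilon> r by (auto simp: V_def)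
    have "smooth_on ({-\<alpha><..<\<alpha>} \<times> V) (\<lambda>p. z p 1)"
      unfolding smooth_on_def V_def
      by (intro allI C_k_on_bounded_linear[OF bounded_linear_apply_bcontfun_at] C open_Times) auto
    then have "smooth_on ({-\<epsilon><..<\<epsilon>} \<times> V) (\<lambda>p. z p 1)" by (rule smooth_on_subset) (use \<epsilon> in auto)
    then show "smooth_on ({-\<epsilon><..<\<epsilon>} \<times> V) (\<lambda>(s, x). \<Phi> s x)"
      by (simp add: \<Phi>_def case_prod_unfold)
    show "\<Phi> 0 x = x" if "x \<in> V" for x
      using rescale[of 0 x] zder(1)[of \<epsilon> x] that \<epsilon> by simp
    fix s x assume s: "s \<in> {-\<epsilon><..<\<epsilon>}" and x: "x \<in> V"
    show "\<Phi> s x \<in> S" using mem[of s x 1] s x \<epsilon> R by (auto simp: \<Phi>_def V_def)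
    have se: "s / \<epsilon> \<in> {-1<..<1}" using s \<epsilon> by (auto simp: field_simps)
    have "(apply_bcontfun (z (\<epsilon>, x)) has_vector_derivative \<epsilon> *\<^sub>R g (z (\<epsilon>, x) (s / \<epsilon>))) (at (s / \<epsilon>) within {-1<..<1})"
      by (rule has_vector_derivative_within_subset[OF zder(2)]) (use se x \<epsilon> in auto)
    then have "(apply_bcontfun (z (\<epsilon>, x)) has_vector_derivative \<epsilon> *\<^sub>R g (z (\<epsilon>, x) (s / \<epsilon>))) (at (s / \<epsilon>))"
      using at_within_open[OF se] by simp
    moreover have "((\<lambda>s. s / \<epsilon>) has_vector_derivative 1 / \<epsilon>) (at s)"
      using \<epsilon> by (auto intro!: derivative_eq_intros simp: has_vector_derivative_def)
    ultimately have "((apply_bcontfun (z (\<epsilon>, x)) \<circ> (\<lambda>s. s / \<epsilon>)) has_vector_derivative (1 / \<epsilon>) *\<^sub>R (\<epsilon> *\<^sub>R g (z (\<epsilon>, x) (s / \<epsilon>)))) (at s)"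
      by (rule vector_diff_chain_at[rotated])
    then have "((\<lambda>s. z (\<epsilon>, x) (s / \<epsilon>)) has_vector_derivative g (\<Phi> s x)) (at s)"
      using \<epsilon> s x by (simp add: o_def rescale)
    then show "((\<lambda>s. \<Phi> s x) has_vector_derivative g (\<Phi> s x)) (at s)"
      by (rule has_vector_derivative_transform_within_open[of _ _ _ "{-\<epsilon><..<\<epsilon>}"]) (use s x in \<open>auto simp: rescale\<close>)
  qed
qed

section \<open>Local uniqueness for differential equations\<close>

text \<open>In place of a Gronwall argument: where |u - v| attains its maximum N on a short interval
  around t, the mean value inequality gives N \<le> d B N \<le> N / 2.\<close>

lemma ode_unique_local:
  fixes f :: "real \<times> 'e::euclidean_space \<Rightarrow> 'e"
  assumes f: "smooth_on S f" and S: "open S" and T: "open T" "t \<in> T"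
    and u: "\<And>s. s \<in> T \<Longrightarrow> (s, u s) \<in> S \<and> (u has_vector_derivative f (s, u s)) (at s)"
    and v: "\<And>s. s \<in> T \<Longrightarrow> (s, v s) \<in> S \<and> (v has_vector_derivative f (s, v s)) (at s)"
    and eq: "u t = v t"
  obtains d where "d > 0" "\<And>s. \<bar>s - t\<bar> \<le> d \<Longrightarrow> u s = v s"
proof -
  obtain r where r: "r > 0" "cball (t, u t) r \<subseteq> S" using S u[OF T(2)] open_contains_cball by blast
  obtain B where B: "B > 0" "\<And>x y. x \<in> cball (t, u t) r \<Longrightarrow> y \<in> cball (t, u t) r \<Longrightarrow> norm (f x - f y) \<le> B * norm (x - y)"
    "\<And>x v. x \<in> cball (t, u t) r \<Longrightarrow> norm (frechet_derivative f (at x) v) \<le> B * norm v"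
    using smooth_on_lipschitz[OF f compact_cball convex_cball r(2)] by blast
  have cont: "isCont u s" "isCont v s" if "s \<in> T" for s
    using u[OF that] v[OF that] has_vector_derivative_continuous by blast+
  have "isCont (\<lambda>s. (s, u s)) t" "isCont (\<lambda>s. (s, v s)) t" using cont[OF T(2)] by (auto intro!: continuous_intros)
  then have "((\<lambda>s. (s, u s)) \<longlongrightarrow> (t, u t)) (nhds t)" "((\<lambda>s. (s, v s)) \<longlongrightarrow> (t, v t)) (nhds t)"
    unfolding isCont_def
    using tendsto_at_iff_tendsto_nhds[of "\<lambda>s. (s, u s)" t] tendsto_at_iff_tendsto_nhds[of "\<lambda>s. (s, v s)" t]
    by blast+
  then have "\<forall>\<^sub>F s in nhds t. dist (s, u s) (t, u t) < r" "\<forall>\<^sub>F s in nhds t. dist (s, v s) (t, u t) < r"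
    using r(1) eq unfolding tendsto_iff by auto
  then have "\<forall>\<^sub>F s in nhds t. dist (s, u s) (t, u t) < r \<and> dist (s, v s) (t, u t) < r \<and> s \<in> T"
    using eventually_nhds_in_open[OF T] by eventually_elim simp
  then obtain d0 where d0: "d0 > 0" "\<And>s. dist s t < d0 \<Longrightarrow> dist (s, u s) (t, u t) < r \<and> dist (s, v s) (t, u t) < r \<and> s \<in> T"
    unfolding eventually_nhds_metric by blast
  \<comment> \<open>The bound d0 / 2 keeps the closed interval where both curves stay in the
    Lipschitz ball; the bound 1 / (2 B) produces the factor 1/2.\<close>
  define d where "d = min (d0 / 2) (1 / (2 * B))"
  have d: "d > 0" "d < d0" "d * B \<le> 1/2"
  proof -
    show "d > 0" "d < d0" using d0(1) B(1) by (auto simp: d_def min_less_iff_disj)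
    have "d \<le> 1 / (2 * B)" by (simp add: d_def)
    then show "d * B \<le> 1/2" using B(1) by (simp add: field_simps)
  qed
  define J where "J = {t - d..t + d}"
  have J: "dist s t < d0" "s \<in> T" "\<bar>s - t\<bar> \<le> d" if "s \<in> J" for s
    using d0(2)[of s] that d(2) by (auto simp: J_def dist_real_def)
  have tJ: "t \<in> J" using d(1) by (simp add: J_def)
  have "continuous_on J (\<lambda>s. norm (u s - v s))"
    by (intro continuous_intros continuous_at_imp_continuous_on ballI cont J)
  then obtain m where m: "m \<in> J" "\<And>s. s \<in> J \<Longrightarrow> norm (u s - v s) \<le> norm (u m - v m)"
    using continuous_attains_sup[of J "\<lambda>s. norm (u s - v s)"] tJ by (auto simp: J_def)
  define N where "N = norm (u m - v m)"
  have "norm ((u m - v m) - (u t - v t)) \<le> (B * N) * norm (m - t)"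
  proof (rule differentiable_bound[of J])
    show "convex J" by (simp add: J_def)
    fix s assume s: "s \<in> J"
    show "((\<lambda>s. u s - v s) has_derivative (\<lambda>h. h *\<^sub>R (f (s, u s) - f (s, v s)))) (at s within J)"
      using has_vector_derivative_diff[OF conjunct2[OF u[OF J(2)[OF s]]] conjunct2[OF v[OF J(2)[OF s]]]]
      unfolding has_vector_derivative_def by (rule has_derivative_at_withinI)
    have "norm (f (s, u s) - f (s, v s)) \<le> B * norm ((s, u s) - (s, v s))"
      using d0(2)[OF J(1)[OF s]] by (intro B(2)) (auto simp: dist_commute intro: less_imp_le)
    also have "\<dots> \<le> B * N" using m(2)[OF s] B(1) by (simp add: N_def norm_Pair)
    finally have "norm (f (s, u s) - f (s, v s)) \<le> B * N" .
    then have "norm (h *\<^sub>R (f (s, u s) - f (s, v s))) \<le> B * N * norm h" for h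
      by (simp add: mult.commute[of "B * N"] mult_left_mono)
    then show "onorm (\<lambda>h. h *\<^sub>R (f (s, u s) - f (s, v s))) \<le> B * N"
      using B(1) by (intro onorm_bound) (auto simp: N_def)
  qed (use m tJ in auto)
  also have "\<dots> \<le> (B * N) * d" using J(3)[OF m(1)] B(1) by (intro mult_left_mono) (auto simp: N_def)
  also have "\<dots> = (d * B) * N" by simp
  also have "\<dots> \<le> 1/2 * N" by (rule mult_right_mono[OF d(3)]) (simp add: N_def)
  finally have "N \<le> 1/2 * N" using eq by (simp add: N_def)
  then have "N \<le> 0" by linarith
  then have "u s = v s" if "\<bar>s - t\<bar> \<le> d" for s
    using m(2)[of s] that by (auto simp: N_def J_def abs_le_iff)
  with d(1) that show ?thesis by blast
qed

section \<open>Charts and smooth maps into a manifold\<close>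

locale manifold_atlas =
  fixes A :: "('m::{t2_space,second_countable_topology}, 'e::euclidean_space) chart set"
  assumes smooth_manifold: "smooth_manifold A"
begin

abbreviation im :: "('m, 'e) chart \<Rightarrow> 'e set" where "im c \<equiv> snd c ` fst c"

lemma ex_chart: obtains c where "c \<in> A" "q \<in> fst c"
  using smooth_manifold unfolding smooth_manifold_def by blast

lemma open_fst: "c \<in> A \<Longrightarrow> open (fst c)" and open_im: "c \<in> A \<Longrightarrow> open (im c)"
  and homeomorphism_chart: "c \<in> A \<Longrightarrow> homeomorphism (fst c) (im c) (snd c) (chart_inv c)"
  and smooth_on_transition:
    "c \<in> A \<Longrightarrow> d \<in> A \<Longrightarrow> smooth_on (snd c ` (fst c \<inter> fst d)) (transition c d)"
  using smooth_manifold unfolding smooth_manifold_def by blast+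

lemma chart_inv_snd [simp]: "c \<in> A \<Longrightarrow> q \<in> fst c \<Longrightarrow> chart_inv c (snd c q) = q"
  using homeomorphism_chart by (auto simp: homeomorphism_def)

lemma snd_chart_inv [simp]: "c \<in> A \<Longrightarrow> x \<in> im c \<Longrightarrow> snd c (chart_inv c x) = x"
  by auto

lemma chart_inv_mem [simp]: "c \<in> A \<Longrightarrow> x \<in> im c \<Longrightarrow> chart_inv c x \<in> fst c"
  by auto

lemma isCont_snd: "c \<in> A \<Longrightarrow> q \<in> fst c \<Longrightarrow> isCont (snd c) q"
  using homeomorphism_chart[of c] open_fst[of c] by (auto simp: homeomorphism_def continuous_on_eq_continuous_at)

lemma isCont_chart_inv: "c \<in> A \<Longrightarrow> x \<in> im c \<Longrightarrow> isCont (chart_inv c) x"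
  using homeomorphism_chart[of c] open_im[of c] by (auto simp: homeomorphism_def continuous_on_eq_continuous_at)

lemma inj_on_chart: "c \<in> A \<Longrightarrow> inj_on (snd c) (fst c)"
  by (metis chart_inv_snd inj_onI)

lemma open_chart_image: "c \<in> A \<Longrightarrow> open V \<Longrightarrow> open (snd c ` (fst c \<inter> V))"
proof -
  assume c: "c \<in> A" and V: "open V"
  have "snd c ` (fst c \<inter> V) = im c \<inter> chart_inv c -` V" using c by auto
  moreover have "continuous_on (im c) (chart_inv c)" using homeomorphism_chart[OF c] by (simp add: homeomorphism_def)
  ultimately show ?thesis using continuous_open_preimage[OF _ open_im[OF c] V] by simp
qed

lemma open_overlap: "c \<in> A \<Longrightarrow> d \<in> A \<Longrightarrow> open (snd c ` (fst c \<inter> fst d))"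
  by (simp add: open_chart_image open_fst)

lemma transition_snd [simp]: "c \<in> A \<Longrightarrow> q \<in> fst c \<Longrightarrow> transition c d (snd c q) = snd d q"
  by (simp add: transition_def)

abbreviation jac :: "('m, 'e) chart \<Rightarrow> ('m, 'e) chart \<Rightarrow> 'm \<Rightarrow> 'e \<Rightarrow> 'e" where
  "jac c d q \<equiv> frechet_derivative (transition c d) (at (snd c q))"

lemma transition_has_derivative:
  "c \<in> A \<Longrightarrow> d \<in> A \<Longrightarrow> q \<in> fst c \<Longrightarrow> q \<in> fst d \<Longrightarrow> (transition c d has_derivative jac c d q) (at (snd c q))"
  by (rule smooth_on_has_derivative[OF smooth_on_transition]) auto

text \<open>The source of h is an arbitrary normed space, so that one rule serves curves, chart
  inverses and maps read in charts.\<close>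

lemma has_derivative_change_chart:
  assumes c: "c \<in> A" and d: "d \<in> A" and W: "open W" "w \<in> W"
    and h: "\<And>x. x \<in> W \<Longrightarrow> h x \<in> fst c" "h w \<in> fst d"
    and der: "((\<lambda>x. snd c (h x)) has_derivative D) (at w)"
  shows "((\<lambda>x. snd d (h x)) has_derivative (\<lambda>v. jac c d (h w) (D v))) (at w)"
proof (rule has_derivative_transform_within_open[OF _ W])
  show "((\<lambda>x. transition c d (snd c (h x))) has_derivative (\<lambda>v. jac c d (h w) (D v))) (at w)"
    by (rule has_derivative_compose[OF der transition_has_derivative]) (use assms in auto)
qed (use c h in auto)

lemma jac_compose:
  assumes "c \<in> A" "d \<in> A" "e \<in> A" "q \<in> fst c" "q \<in> fst d" "q \<in> fst e"
  shows "jac d e q (jac c d q v) = jac c e q v"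
proof -
  have "((\<lambda>x. snd d (chart_inv c x)) has_derivative jac c d q) (at (snd c q))"
    using transition_has_derivative[of c d q] assms by (simp add: transition_def o_def)
  then have "((\<lambda>x. snd e (chart_inv c x)) has_derivative (\<lambda>v. jac d e (chart_inv c (snd c q)) (jac c d q v))) (at (snd c q))"
    by (intro has_derivative_change_chart[OF assms(2,3) open_overlap[OF assms(1,2)]]) (use assms in auto)
  then have "((\<lambda>x. snd e (chart_inv c x)) has_derivative (\<lambda>v. jac d e q (jac c d q v))) (at (snd c q))"
    using assms by simp
  from fun_cong[OF frechet_derivative_at[OF this]] show ?thesis by (simp add: transition_def o_def)
qed

lemma jac_self:
  assumes "c \<in> A" "q \<in> fst c"
  shows "jac c c q v = v"
proof -
  have "(transition c c has_derivative (\<lambda>v. v)) (at (snd c q))"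
    by (rule has_derivative_transform_within_open[OF has_derivative_ident open_im[OF assms(1)]])
      (use assms in \<open>auto simp: transition_def\<close>)
  from frechet_derivative_at[OF this] show ?thesis by metis
qed

text \<open>Unlike \<open>smooth_map\<close>, this speaks of every chart of the target and includes
  continuity: preimages of chart domains are open, and any chart around an image point may be
  used.\<close>

definition smooth_into :: "'p::euclidean_space set \<Rightarrow> ('p \<Rightarrow> 'm) \<Rightarrow> bool" where
  "smooth_into W h \<longleftrightarrow> open W \<and> continuous_on W h \<and> (\<forall>d\<in>A. smooth_on (W \<inter> h -` fst d) (\<lambda>x. snd d (h x)))"

lemma smooth_into_open: "smooth_into W h \<Longrightarrow> d \<in> A \<Longrightarrow> open (W \<inter> h -` fst d)"
  unfolding smooth_into_def by (simp add: continuous_open_preimage open_fst)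

text \<open>One chart per point is enough: locally h is recovered from its coordinates by the chart
  inverse, which gives continuity, and transition maps carry smoothness to the other charts.\<close>

lemma smooth_intoI:
  assumes W: "open W"
    and loc: "\<And>w. w \<in> W \<Longrightarrow> \<exists>W' d. open W' \<and> w \<in> W' \<and> d \<in> A \<and> h ` W' \<subseteq> fst d \<and> smooth_on W' (\<lambda>x. snd d (h x))"
  shows "smooth_into W h"
proof -
  have cont: "isCont h w" if w: "w \<in> W" for w
  proof -
    obtain W' d where d: "open W'" "w \<in> W'" "d \<in> A" "h ` W' \<subseteq> fst d" "smooth_on W' (\<lambda>x. snd d (h x))"
      using loc[OF w] by blast
    have "continuous_on W' (\<lambda>x. chart_inv d (snd d (h x)))"
      by (rule continuous_on_compose2[OF _ smooth_on_imp_continuous_on[OF d(5)], of "im d"])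
        (use homeomorphism_chart[OF d(3)] d(4) in \<open>auto simp: homeomorphism_def\<close>)
    then have "continuous_on W' h"
      using d(3,4) by (subst continuous_on_cong[OF refl, of _ _ "\<lambda>x. chart_inv d (snd d (h x))"]) auto
    then show ?thesis using d(1,2) by (simp add: continuous_on_eq_continuous_at)
  qed
  then have c: "continuous_on W h" by (simp add: continuous_at_imp_continuous_on)
  moreover have "smooth_on (W \<inter> h -` fst d) (\<lambda>x. snd d (h x))" if d: "d \<in> A" for d
  proof (rule smooth_on_local)
    fix w assume w: "w \<in> W \<inter> h -` fst d"
    obtain W' e where e: "open W'" "w \<in> W'" "e \<in> A" "h ` W' \<subseteq> fst e" "smooth_on W' (\<lambda>x. snd e (h x))"
      using loc[of w] w by blast
    define T where "T = W' \<inter> (W \<inter> h -` fst d)"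
    have oT: "open T" unfolding T_def using continuous_open_preimage[OF c W open_fst[OF d]] e(1) by auto
    have "smooth_on T (\<lambda>x. transition e d (snd e (h x)))"
      by (rule smooth_on_compose[OF oT open_overlap[OF e(3) d] smooth_on_subset[OF e(5)] smooth_on_transition[OF e(3) d]])
        (use e(4) in \<open>auto simp: T_def\<close>)
    then have "smooth_on T (\<lambda>x. snd d (h x))"
      by (rule smooth_on_cong[OF oT, rotated]) (use e(3,4) in \<open>auto simp: T_def\<close>)
    then show "\<exists>T. open T \<and> w \<in> T \<and> smooth_on T (\<lambda>x. snd d (h x))"
      using oT w e(2) by (intro exI[of _ T]) (simp add: T_def)
  qed
  ultimately show ?thesis using W by (simp add: smooth_into_def)
qed

lemma smooth_into_compose:
  assumes h: "smooth_into W h" and g: "open T" "smooth_on T g" "g ` T \<subseteq> W"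
  shows "smooth_into T (\<lambda>x. h (g x))"
proof (rule smooth_intoI[OF g(1)])
  fix w assume w: "w \<in> T"
  obtain d where d: "d \<in> A" "h (g w) \<in> fst d" using ex_chart by blast
  define T' where "T' = T \<inter> g -` (W \<inter> h -` fst d)"
  have o: "open T'" unfolding T'_def
    by (rule continuous_open_preimage[OF smooth_on_imp_continuous_on[OF g(2)] g(1) smooth_into_open[OF h d(1)]])
  have "smooth_on T' (\<lambda>x. snd d (h (g x)))"
    by (rule smooth_on_compose[OF o smooth_into_open[OF h d(1)] smooth_on_subset[OF g(2)]])
      (use h d(1) in \<open>auto simp: T'_def smooth_into_def\<close>)
  moreover have "w \<in> T'" using w d g(3) by (auto simp: T'_def)
  ultimately show "\<exists>W' d. open W' \<and> w \<in> W' \<and> d \<in> A \<and> (\<lambda>x. h (g x)) ` W' \<subseteq> fst d \<and> smooth_on W' (\<lambda>x. snd d (h (g x)))"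
    using o d(1) by (intro exI[of _ T'] exI[of _ d]) (auto simp: T'_def)
qed

lemma smooth_into_chart_inv: "c \<in> A \<Longrightarrow> smooth_into (im c) (chart_inv c)"
proof (rule smooth_intoI[OF open_im])
  assume c: "c \<in> A"
  have "smooth_on (im c) (\<lambda>x. snd c (chart_inv c x))"
    by (rule smooth_on_cong[OF open_im[OF c] _ smooth_on_linear[OF bounded_linear_ident]]) (use c in auto)
  then show "\<exists>W' d. open W' \<and> w \<in> W' \<and> d \<in> A \<and> chart_inv c ` W' \<subseteq> fst d \<and> smooth_on W' (\<lambda>x. snd d (chart_inv c x))"
    if "w \<in> im c" for w
    using open_im[OF c] that c by (intro exI[of _ "im c"] exI[of _ c]) (auto simp del: image_eqI)
qed

section \<open>Integral curves and time-dependent flows on a manifold\<close>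

text \<open>The form in which differential equations use a vector field: jointly smooth components
  over the full image of each chart, free of the local chart choices in
  \<open>smooth_td_vector_field\<close>.\<close>

definition smooth_components :: "(real \<Rightarrow> 'm \<Rightarrow> ('m, 'e) chart \<Rightarrow> 'e) \<Rightarrow> bool" where
  "smooth_components X \<longleftrightarrow> (\<forall>t q. X t q \<in> tangent_space A q) \<and>
     (\<forall>c\<in>A. smooth_on (UNIV \<times> im c) (\<lambda>(t, x). X t (chart_inv c x) c))"

lemma tangent_space_jac:
  "v \<in> tangent_space A q \<Longrightarrow> c \<in> A \<Longrightarrow> d \<in> A \<Longrightarrow> q \<in> fst c \<Longrightarrow> q \<in> fst d \<Longrightarrow> v d = jac c d q (v c)"
  unfolding tangent_space_def charts_at_def by blast

text \<open>\<open>integral_curve\<close> constrains the velocity in every chart around the point,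
  while a constructed solution is known in one chart only; the tangent vector condition links the
  components.\<close>

lemma integral_curve_one_chart:
  assumes X: "\<And>t q. X t q \<in> tangent_space A q" and cont: "isCont \<gamma> t"
    and c: "c \<in> A" "\<gamma> t \<in> fst c" and der: "((\<lambda>s. snd c (\<gamma> s)) has_vector_derivative X t (\<gamma> t) c) (at t)"
    and d: "d \<in> A" "\<gamma> t \<in> fst d"
  shows "((snd d \<circ> \<gamma>) has_vector_derivative X t (\<gamma> t) d) (at t)"
proof -
  have "\<forall>\<^sub>F s in nhds t. \<gamma> s \<in> fst c"
    using topological_tendstoD[OF _ open_fst[OF c(1)] c(2), of \<gamma>] cont
    unfolding isCont_def tendsto_at_iff_tendsto_nhds by blast
  then obtain W where W: "open W" "t \<in> W" "\<And>s. s \<in> W \<Longrightarrow> \<gamma> s \<in> fst c" unfolding eventually_nhds by blast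
  have "((\<lambda>s. snd d (\<gamma> s)) has_derivative (\<lambda>v. jac c d (\<gamma> t) (v *\<^sub>R X t (\<gamma> t) c))) (at t)"
    using has_derivative_change_chart[where h = \<gamma>, OF c(1) d(1) W d(2)] der unfolding has_vector_derivative_def by blast
  moreover have "jac c d (\<gamma> t) (v *\<^sub>R X t (\<gamma> t) c) = v *\<^sub>R X t (\<gamma> t) d" for v
    using tangent_space_jac[OF X c(1) d(1) c(2) d(2), of t]
      linear_scale[OF has_derivative_linear[OF transition_has_derivative[OF c(1) d(1) c(2) d(2)]]] by simp
  ultimately show ?thesis by (simp add: has_vector_derivative_def o_def)
qed

section \<open>Global uniqueness, maximal solutions and flow values\<close>

text \<open>The times of agreement form an open set by local uniqueness in a chart, the times of
  disagreement by the Hausdorff property; a connected interval is all of one kind.\<close>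

lemma integral_curve_unique:
  assumes X: "smooth_components X" and I: "open I" "connected I"
    and \<gamma>: "integral_curve A X I \<gamma>" and \<eta>: "integral_curve A X I \<eta>"
    and t0: "t0 \<in> I" "\<gamma> t0 = \<eta> t0" and t: "t \<in> I"
  shows "\<gamma> t = \<eta> t"
proof -
  have cont: "(\<gamma> \<longlongrightarrow> \<gamma> s) (nhds s)" "(\<eta> \<longlongrightarrow> \<eta> s) (nhds s)" if "s \<in> I" for s
    using \<gamma> \<eta> that unfolding integral_curve_def isCont_def tendsto_at_iff_tendsto_nhds by auto
  define P where "P = {s \<in> I. \<gamma> s = \<eta> s}"
  define Q where "Q = {s \<in> I. \<gamma> s \<noteq> \<eta> s}"
  have "open Q"
  proof (subst open_subopen, intro ballI)
    fix s assume s: "s \<in> Q"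
    then obtain U V where UV: "open U" "open V" "\<gamma> s \<in> U" "\<eta> s \<in> V" "U \<inter> V = {}"
      using hausdorff[of "\<gamma> s" "\<eta> s"] by (auto simp: Q_def)
    have sI: "s \<in> I" using s by (simp add: Q_def)
    have "\<forall>\<^sub>F r in nhds s. \<gamma> r \<in> U \<and> \<eta> r \<in> V \<and> r \<in> I"
      using topological_tendstoD[OF cont(1)[OF sI] UV(1,3)] topological_tendstoD[OF cont(2)[OF sI] UV(2,4)]
        eventually_nhds_in_open[OF I(1) sI] by eventually_elim simp
    then obtain T where T: "open T" "s \<in> T" "\<And>r. r \<in> T \<Longrightarrow> \<gamma> r \<in> U \<and> \<eta> r \<in> V \<and> r \<in> I"
      unfolding eventually_nhds by blast
    then have "T \<subseteq> Q" using UV(5) by (force simp: Q_def)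
    then show "\<exists>T. open T \<and> s \<in> T \<and> T \<subseteq> Q" using T(1,2) by blast
  qed
  moreover have "open P"
  proof (subst open_subopen, intro ballI)
    fix s assume s: "s \<in> P"
    then have sI: "s \<in> I" and eq: "\<gamma> s = \<eta> s" by (auto simp: P_def)
    obtain c where c: "c \<in> A" "\<gamma> s \<in> fst c" using ex_chart by blast
    have "\<forall>\<^sub>F r in nhds s. \<gamma> r \<in> fst c \<and> \<eta> r \<in> fst c \<and> r \<in> I"
      using topological_tendstoD[OF cont(1)[OF sI] open_fst[OF c(1)] c(2)]
        topological_tendstoD[OF cont(2)[OF sI] open_fst[OF c(1)]] c(2) eq
        eventually_nhds_in_open[OF I(1) sI] by (auto intro: eventually_conj)
    then obtain T where T: "open T" "s \<in> T" "\<And>r. r \<in> T \<Longrightarrow> \<gamma> r \<in> fst c \<and> \<eta> r \<in> fst c \<and> r \<in> I"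
      unfolding eventually_nhds by blast
    have S: "smooth_on (UNIV \<times> im c) (\<lambda>(t, x). X t (chart_inv c x) c)" "open (UNIV \<times> im c)"
      using X c(1) open_im[OF c(1)] by (auto simp: smooth_components_def open_Times)
    obtain d where d: "d > 0" "\<And>r. \<bar>r - s\<bar> \<le> d \<Longrightarrow> (snd c \<circ> \<gamma>) r = (snd c \<circ> \<eta>) r"
    proof (rule ode_unique_local[OF S T(1,2), of "snd c \<circ> \<gamma>" "snd c \<circ> \<eta>"])
      fix r assume r: "r \<in> T"
      show "(r, (snd c \<circ> \<gamma>) r) \<in> UNIV \<times> im c \<and> ((snd c \<circ> \<gamma>) has_vector_derivative
         (case (r, (snd c \<circ> \<gamma>) r) of (t, x) \<Rightarrow> X t (chart_inv c x) c)) (at r)"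
        using \<gamma> T(3)[OF r] c(1) by (simp add: integral_curve_def charts_at_def del: split_paired_All)
      show "(r, (snd c \<circ> \<eta>) r) \<in> UNIV \<times> im c \<and> ((snd c \<circ> \<eta>) has_vector_derivative
         (case (r, (snd c \<circ> \<eta>) r) of (t, x) \<Rightarrow> X t (chart_inv c x) c)) (at r)"
        using \<eta> T(3)[OF r] c(1) by (simp add: integral_curve_def charts_at_def del: split_paired_All)
    qed (use eq in auto)
    have "T \<inter> ball s d \<subseteq> P"
    proof
      fix r assume r: "r \<in> T \<inter> ball s d"
      then have "snd c (\<gamma> r) = snd c (\<eta> r)" using d(2)[of r] by (simp add: dist_real_def abs_minus_commute)
      then have "\<gamma> r = \<eta> r" using T(3)[of r] r c(1) by (metis Int_iff chart_inv_snd)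
      then show "r \<in> P" using T(3)[of r] r by (simp add: P_def)
    qed
    then show "\<exists>T. open T \<and> s \<in> T \<and> T \<subseteq> P" using T(1,2) d(1) by (intro exI[of _ "T \<inter> ball s d"]) auto
  qed
  ultimately have "P \<inter> I = {} \<or> Q \<inter> I = {}"
    by (intro connectedD[OF I(2)]) (auto simp: P_def Q_def)
  then show ?thesis using t0 t by (auto simp: P_def Q_def)
qed

lemma integral_curve_cong:
  assumes "open I" "integral_curve A X I \<gamma>" "\<And>t. t \<in> I \<Longrightarrow> \<eta> t = \<gamma> t"
  shows "integral_curve A X I \<eta>"
  unfolding integral_curve_def
proof (intro ballI conjI)
  fix t assume t: "t \<in> I"
  have "\<forall>\<^sub>F s in nhds t. \<eta> s = \<gamma> s" unfolding eventually_nhds using assms(1,3) t by blast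
  then show "isCont \<eta> t" using assms(2) t isCont_cong[of \<eta> \<gamma> t] by (auto simp: integral_curve_def)
  fix d assume "d \<in> charts_at A (\<eta> t)"
  then have "((snd d \<circ> \<gamma>) has_vector_derivative X t (\<gamma> t) d) (at t)"
    using assms(2,3) t by (auto simp: integral_curve_def)
  then have "((snd d \<circ> \<eta>) has_vector_derivative X t (\<gamma> t) d) (at t)"
    by (rule has_vector_derivative_transform_within_open[OF _ assms(1) t]) (use assms(3) in auto)
  then show "((snd d \<circ> \<eta>) has_vector_derivative X t (\<eta> t) d) (at t)" using assms(3)[OF t] by simp
qed

lemma solution_unique:
  assumes X: "smooth_components X" and "solution A X t0 q I \<gamma>" "solution A X t0 q J \<eta>" "t \<in> I" "t \<in> J"
  shows "\<gamma> t = \<eta> t"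
proof (rule integral_curve_unique[OF X, of "I \<inter> J" \<gamma> \<eta> t0])
  show "connected (I \<inter> J)"
    using assms(2,3) by (simp add: solution_def is_interval_Int flip: is_interval_connected_1)
qed (use assms in \<open>auto simp: solution_def integral_curve_def\<close>)

text \<open>Uniqueness lets all solutions be glued on the union of their intervals; no solution can
  extend further, since its interval is already part of the union.\<close>

lemma ex_maximal_solution:
  assumes X: "smooth_components X" and sol: "solution A X t0 q I \<gamma>"
  obtains J \<eta> where "maximal_solution A X t0 q J \<eta>" "I \<subseteq> J" "\<And>t. t \<in> I \<Longrightarrow> \<eta> t = \<gamma> t"
proof -
  define J where "J = \<Union>{I. \<exists>\<gamma>. solution A X t0 q I \<gamma>}"
  define \<eta> where "\<eta> t = (SOME p. \<exists>I \<gamma>. solution A X t0 q I \<gamma> \<and> t \<in> I \<and> p = \<gamma> t)" for t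
  have \<eta>: "\<eta> t = \<gamma> t" if "solution A X t0 q I \<gamma>" "t \<in> I" for I \<gamma> t
  proof -
    have "\<exists>p I \<gamma>. solution A X t0 q I \<gamma> \<and> t \<in> I \<and> p = \<gamma> t" using that by blast
    from someI_ex[OF this] show ?thesis
      unfolding \<eta>_def[symmetric] using solution_unique[OF X _ that(1) _ that(2)] by auto
  qed
  have "solution A X t0 q J \<eta>"
    unfolding solution_def
  proof (intro conjI)
    show "open J" unfolding J_def by (rule open_Union) (auto simp: solution_def)
    have "connected J" unfolding J_def
      by (rule connected_Union) (auto simp: solution_def is_interval_connected_1)
    then show "is_interval J" by (simp add: is_interval_connected_1)
    show "t0 \<in> J" "\<eta> t0 = q" using sol \<eta>[OF sol] by (auto simp: J_def solution_def)
    show "integral_curve A X J \<eta>"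
      unfolding integral_curve_def
    proof
      fix t assume "t \<in> J"
      then obtain I \<gamma> where I: "solution A X t0 q I \<gamma>" "t \<in> I" by (auto simp: J_def)
      have "integral_curve A X I \<eta>"
        by (rule integral_curve_cong) (use I \<eta>[OF I(1)] in \<open>auto simp: solution_def\<close>)
      then show "isCont \<eta> t \<and> (\<forall>d\<in>charts_at A (\<eta> t). ((snd d \<circ> \<eta>) has_vector_derivative X t (\<eta> t) d) (at t))"
        using I(2) by (auto simp: integral_curve_def)
    qed
  qed
  then have "maximal_solution A X t0 q J \<eta>"
    unfolding maximal_solution_def by (auto simp: J_def)
  moreover have "I \<subseteq> J" using sol by (auto simp: J_def)
  ultimately show ?thesis using that \<eta>[OF sol] by blast
qed

text \<open>Reduces the definite description in \<open>td_flow\<close> to exhibiting any solution,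
  maximal or not.\<close>

lemma td_flow_eq:
  assumes X: "smooth_components X" and sol: "solution A X t0 q I \<gamma>" and t: "t \<in> I"
  shows "td_flow A X t t0 q = \<gamma> t"
proof -
  obtain J \<eta> where J: "maximal_solution A X t0 q J \<eta>" "I \<subseteq> J" "\<And>t. t \<in> I \<Longrightarrow> \<eta> t = \<gamma> t"
    using ex_maximal_solution[OF X sol] by blast
  show ?thesis unfolding td_flow_def
  proof (rule the_equality)
    show "\<exists>I \<gamma>'. maximal_solution A X t0 q I \<gamma>' \<and> t \<in> I \<and> \<gamma> t = \<gamma>' t"
      using J t by (metis subsetD)
    show "p = \<gamma> t" if "\<exists>I \<gamma>. maximal_solution A X t0 q I \<gamma> \<and> t \<in> I \<and> p = \<gamma> t" for p
      using that solution_unique[OF X _ sol _ t] unfolding maximal_solution_def by blast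
  qed
qed

text \<open>Time is added as a coordinate, which makes the equation autonomous with field (1, f).
  The spatial part of its flow for duration \<tau> - t from (t, x) is \<phi>, so smoothness in the
  initial time comes together with smoothness in the initial point.\<close>

lemma local_flow_in_chart:
  assumes X: "smooth_components X" and c: "c \<in> A" "q \<in> fst c"
  obtains \<epsilon> V \<phi> where "\<epsilon> > 0" "open V" "snd c q \<in> V" "V \<subseteq> im c"
    "smooth_on ({t0-\<epsilon><..<t0+\<epsilon>} \<times> {t0-\<epsilon><..<t0+\<epsilon>} \<times> V) (\<lambda>(\<tau>, t, x). \<phi> \<tau> t x)"
    "\<And>t x. t \<in> {t0-\<epsilon><..<t0+\<epsilon>} \<Longrightarrow> x \<in> V \<Longrightarrow> \<phi> t t x = x"
    "\<And>\<tau> t x. \<tau> \<in> {t0-\<epsilon><..<t0+\<epsilon>} \<Longrightarrow> t \<in> {t0-\<epsilon><..<t0+\<epsilon>} \<Longrightarrow> x \<in> V \<Longrightarrow>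
       \<phi> \<tau> t x \<in> im c \<and> td_flow A X \<tau> t (chart_inv c x) = chart_inv c (\<phi> \<tau> t x) \<and>
       ((\<lambda>\<tau>. \<phi> \<tau> t x) has_vector_derivative X \<tau> (chart_inv c (\<phi> \<tau> t x)) c) (at \<tau>)"
proof -
  define f where "f = (\<lambda>(t, x). X t (chart_inv c x) c)"
  define S where "S = (UNIV :: real set) \<times> im c"
  have S: "open S" "(t0, snd c q) \<in> S" using open_im[OF c(1)] c(2) by (auto simp: S_def open_Times)
  have "smooth_on S f" using X c(1) by (auto simp: S_def f_def smooth_components_def)
  then have g: "smooth_on S (\<lambda>z. (1 :: real, f z))" by (intro smooth_on_Pair S smooth_on_const)
  obtain \<epsilon> V \<Phi> where \<epsilon>: "\<epsilon> > 0" and V: "open V" "(t0, snd c q) \<in> V"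
    and \<Phi>: "smooth_on ({-\<epsilon><..<\<epsilon>} \<times> V) (\<lambda>(s, x). \<Phi> s x)"
    "\<And>x. x \<in> V \<Longrightarrow> \<Phi> 0 x = x"
    "\<And>s x. s \<in> {-\<epsilon><..<\<epsilon>} \<Longrightarrow> x \<in> V \<Longrightarrow> \<Phi> s x \<in> S"
    "\<And>s x. s \<in> {-\<epsilon><..<\<epsilon>} \<Longrightarrow> x \<in> V \<Longrightarrow> ((\<lambda>s. \<Phi> s x) has_vector_derivative (1, f (\<Phi> s x))) (at s)"
    using local_flow_euclidean[OF g S] by metis
  \<comment> \<open>The time coordinate runs at unit speed; this is what identifies the autonomous
    flow with the time-dependent one.\<close>
  have fst\<Phi>: "fst (\<Phi> s z) = fst z + s" if s: "s \<in> {-\<epsilon><..<\<epsilon>}" and z: "z \<in> V" for s z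
  proof -
    have "((\<lambda>s. fst (\<Phi> s z) - s) has_vector_derivative 0) (at s within {-\<epsilon><..<\<epsilon>})" if "s \<in> {-\<epsilon><..<\<epsilon>}" for s
    proof -
      have "((\<lambda>s. fst (\<Phi> s z)) has_vector_derivative 1) (at s)"
        using bounded_linear.has_vector_derivative[OF bounded_linear_fst \<Phi>(4)[OF that z]] by simp
      from has_vector_derivative_diff[OF this has_vector_derivative_id]
      show ?thesis using has_vector_derivative_at_within by force
    qed
    then obtain k where "\<And>s. s \<in> {-\<epsilon><..<\<epsilon>} \<Longrightarrow> fst (\<Phi> s z) - s = k"
      using has_vector_derivative_zero_constant[of "{-\<epsilon><..<\<epsilon>}" "\<lambda>s. fst (\<Phi> s z) - s"] by auto
    from this[OF s] this[of 0] show ?thesis using \<epsilon> \<Phi>(2)[OF z] by simp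
  qed
  obtain V1 V2 where V12: "open V1" "t0 \<in> V1" "open V2" "snd c q \<in> V2" "V1 \<times> V2 \<subseteq> V"
    using open_prod_elim[OF V] by (metis mem_Sigma_iff)
  obtain r where r: "r > 0" "ball t0 r \<subseteq> V1" using V12(1,2) openE by blast
  \<comment> \<open>Two times in I differ by less than 2 e \<le> \<epsilon>, the admissible
    duration; the bound r keeps I inside the time factor of V.\<close>
  define e where "e = min (\<epsilon> / 2) r"
  define I where "I = {t0-e<..<t0+e}"
  define V' where "V' = V2 \<inter> im c"
  have e: "e > 0" using \<epsilon> r by (simp add: e_def)
  have V'V: "(t, x) \<in> V" if "t \<in> I" "x \<in> V'" for t x
    using that r(2) V12(5) by (force simp: I_def V'_def e_def dist_real_def)
  have diff: "\<tau> - t \<in> {-\<epsilon><..<\<epsilon>}" if "\<tau> \<in> I" "t \<in> I" for \<tau> t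
    using that by (auto simp: I_def e_def min_def split: if_splits)
  define \<phi> where "\<phi> \<tau> t x = snd (\<Phi> (\<tau> - t) (t, x))" for \<tau> t x
  have \<phi>mem: "\<phi> \<tau> t x \<in> im c" if "\<tau> \<in> I" "t \<in> I" "x \<in> V'" for \<tau> t x
    using \<Phi>(3)[OF diff[OF that(1,2)] V'V[OF that(2,3)]] by (simp add: S_def \<phi>_def mem_Times_iff)
  have \<phi>0: "\<phi> t t x = x" if "t \<in> I" "x \<in> V'" for t x
    using \<Phi>(2)[OF V'V[OF that]] by (simp add: \<phi>_def)
  have \<phi>der: "((\<lambda>\<tau>. \<phi> \<tau> t x) has_vector_derivative X \<tau> (chart_inv c (\<phi> \<tau> t x)) c) (at \<tau>)"
    if "\<tau> \<in> I" "t \<in> I" "x \<in> V'" for \<tau> t x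
  proof -
    have "((\<lambda>s. snd (\<Phi> s (t, x))) has_vector_derivative f (\<Phi> (\<tau> - t) (t, x))) (at (\<tau> - t))"
      using bounded_linear.has_vector_derivative[OF bounded_linear_snd \<Phi>(4)[OF diff[OF that(1,2)] V'V[OF that(2,3)]]] by simp
    moreover have "((\<lambda>\<tau>. \<tau> - t) has_vector_derivative 1) (at \<tau>)"
      by (auto intro!: derivative_eq_intros)
    ultimately have "((\<lambda>\<tau>. snd (\<Phi> (\<tau> - t) (t, x))) has_vector_derivative f (\<Phi> (\<tau> - t) (t, x))) (at \<tau>)"
      using vector_diff_chain_at[of "\<lambda>\<tau>. \<tau> - t" 1 \<tau> "\<lambda>s. snd (\<Phi> s (t, x))"] by (simp add: o_def)
    moreover have "f (\<Phi> (\<tau> - t) (t, x)) = X \<tau> (chart_inv c (\<phi> \<tau> t x)) c"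
      using fst\<Phi>[OF diff[OF that(1,2)] V'V[OF that(2,3)]] by (simp add: f_def \<phi>_def case_prod_unfold)
    ultimately show ?thesis by (simp add: \<phi>_def)
  qed
  have sol: "solution A X t (chart_inv c x) I (\<lambda>\<tau>. chart_inv c (\<phi> \<tau> t x))" if t: "t \<in> I" and x: "x \<in> V'" for t x
    unfolding solution_def integral_curve_def
  proof (intro conjI ballI)
    fix \<tau> assume \<tau>: "\<tau> \<in> I"
    note m = \<phi>mem[OF \<tau> t x]
    show cont: "isCont (\<lambda>\<tau>. chart_inv c (\<phi> \<tau> t x)) \<tau>"
      by (rule isCont_o2[OF has_vector_derivative_continuous[OF \<phi>der[OF \<tau> t x]] isCont_chart_inv[OF c(1) m]])
    fix d assume d: "d \<in> charts_at A (chart_inv c (\<phi> \<tau> t x))"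
    show "((snd d \<circ> (\<lambda>\<tau>. chart_inv c (\<phi> \<tau> t x))) has_vector_derivative X \<tau> (chart_inv c (\<phi> \<tau> t x)) d) (at \<tau>)"
    proof (rule integral_curve_one_chart[OF _ cont c(1)])
      show "((\<lambda>s. snd c (chart_inv c (\<phi> s t x))) has_vector_derivative X \<tau> (chart_inv c (\<phi> \<tau> t x)) c) (at \<tau>)"
        by (rule has_vector_derivative_transform_within_open[OF \<phi>der[OF \<tau> t x], of I])
          (use \<tau> c(1) \<phi>mem[OF _ t x] in \<open>auto simp: I_def simp del: image_eqI\<close>)
    qed (use X d m c(1) in \<open>auto simp: smooth_components_def charts_at_def simp del: image_eqI\<close>)
  qed (use t \<phi>0[OF t x] in \<open>auto simp: I_def is_interval_oo\<close>)
  show ?thesis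
  proof (rule that[of e V' \<phi>])
    show "e > 0" "open V'" "snd c q \<in> V'" "V' \<subseteq> im c"
      using e V12 open_im[OF c(1)] c(2) by (auto simp: V'_def)
    have o: "open (I \<times> I \<times> V')" using \<open>open V'\<close> by (simp add: I_def open_Times)
    have "smooth_on (I \<times> I \<times> V') (\<lambda>p. snd ((\<lambda>(s, x). \<Phi> s x) (fst p - fst (snd p), snd p)))"
    proof (rule smooth_on_bounded_linear[OF bounded_linear_snd o])
      have "smooth_on (I \<times> I \<times> V') (\<lambda>p. (fst p - fst (snd p), snd p))"
        by (intro smooth_on_linear bounded_linear_Pair bounded_linear_sub bounded_linear_fst
            bounded_linear_compose[OF bounded_linear_fst bounded_linear_snd] bounded_linear_snd)
      from smooth_on_compose[OF o _ this \<Phi>(1)]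
      show "smooth_on (I \<times> I \<times> V') (\<lambda>p. (\<lambda>(s, x). \<Phi> s x) (fst p - fst (snd p), snd p))"
        using diff V'V V(1) by (force simp: open_Times)
    qed
    then show "smooth_on ({t0 - e<..<t0 + e} \<times> {t0 - e<..<t0 + e} \<times> V') (\<lambda>(\<tau>, t, x). \<phi> \<tau> t x)"
      by (simp add: I_def \<phi>_def case_prod_unfold)
    show "\<phi> t t x = x" if "t \<in> {t0 - e<..<t0 + e}" "x \<in> V'" for t x using \<phi>0 that by (simp add: I_def)
    fix \<tau> t x assume "\<tau> \<in> {t0 - e<..<t0 + e}" "t \<in> {t0 - e<..<t0 + e}" "x \<in> V'"
    then have *: "\<tau> \<in> I" "t \<in> I" "x \<in> V'" by (auto simp: I_def)
    show "\<phi> \<tau> t x \<in> im c \<and> td_flow A X \<tau> t (chart_inv c x) = chart_inv c (\<phi> \<tau> t x) \<and>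
       ((\<lambda>\<tau>. \<phi> \<tau> t x) has_vector_derivative X \<tau> (chart_inv c (\<phi> \<tau> t x)) c) (at \<tau>)"
      using \<phi>mem[OF *] td_flow_eq[OF X sol[OF *(2,3)] *(1)] \<phi>der[OF *] by blast
  qed
qed

lemma smooth_into_cong:
  assumes "\<And>x. x \<in> W \<Longrightarrow> h x = k x" "smooth_into W h"
  shows "smooth_into W k"
proof -
  have W: "open W" using assms(2) by (simp add: smooth_into_def)
  have eq: "W \<inter> h -` S = W \<inter> k -` S" for S using assms(1) by auto
  have "continuous_on W k" using assms continuous_on_cong[of W W h k] by (simp add: smooth_into_def)
  moreover have "smooth_on (W \<inter> k -` fst d) (\<lambda>x. snd d (k x))" if "d \<in> A" for d
    using assms smooth_on_cong[OF smooth_into_open[OF assms(2) that], of "\<lambda>x. snd d (h x)" "\<lambda>x. snd d (k x)"] that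
    by (auto simp: smooth_into_def eq)
  ultimately show ?thesis using W by (simp add: smooth_into_def)
qed

lemma smooth_into_local:
  assumes W: "open W" and loc: "\<And>w. w \<in> W \<Longrightarrow> \<exists>T. w \<in> T \<and> smooth_into T h"
  shows "smooth_into W h"
proof (rule smooth_intoI[OF W])
  fix w assume w: "w \<in> W"
  obtain T where T: "w \<in> T" "smooth_into T h" using loc[OF w] by blast
  obtain d where d: "d \<in> A" "h w \<in> fst d" using ex_chart by blast
  show "\<exists>W' d. open W' \<and> w \<in> W' \<and> d \<in> A \<and> h ` W' \<subseteq> fst d \<and> smooth_on W' (\<lambda>x. snd d (h x))"
    using smooth_into_open[OF T(2) d(1)] T d
    by (intro exI[of _ "T \<inter> h -` fst d"] exI[of _ d]) (auto simp: smooth_into_def)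
qed

lemma smooth_on_fst_snd_transition:
  assumes "c \<in> A" "d \<in> A"
  shows "smooth_on (UNIV \<times> snd c ` (fst c \<inter> fst d)) (\<lambda>p :: real \<times> 'e. (fst p, transition c d (snd p)))"
proof -
  have o: "open ((UNIV :: real set) \<times> snd c ` (fst c \<inter> fst d))" using open_overlap[OF assms] by (simp add: open_Times)
  show ?thesis
    by (intro smooth_on_Pair[OF o] smooth_on_linear[OF bounded_linear_fst]
        smooth_on_compose[OF o open_overlap[OF assms] smooth_on_linear[OF bounded_linear_snd] smooth_on_transition[OF assms]])
      auto
qed

text \<open>For the composition law, a trajectory started at time t also solves the problem
  restarted at any of its points.\<close>

lemma complete_flow:
  assumes X: "smooth_components X" and complete: "complete_td_vector_field A X"
  shows "solution A X t q UNIV (\<lambda>\<tau>. td_flow A X \<tau> t q)"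
    and "td_flow A X t t q = q"
    and "td_flow A X \<tau> s (td_flow A X s t q) = td_flow A X \<tau> t q"
proof -
  have sol: "solution A X t q UNIV (\<lambda>\<tau>. td_flow A X \<tau> t q)" for t q
  proof -
    obtain \<gamma> where \<gamma>: "solution A X t q UNIV \<gamma>"
      using complete unfolding complete_td_vector_field_def maximal_solution_def by blast
    then have "(\<lambda>\<tau>. td_flow A X \<tau> t q) = \<gamma>" using td_flow_eq[OF X] by blast
    with \<gamma> show ?thesis by simp
  qed
  then show "solution A X t q UNIV (\<lambda>\<tau>. td_flow A X \<tau> t q)" .
  show "td_flow A X t t q = q" using sol[of t q] by (simp add: solution_def)
  have "solution A X s (td_flow A X s t q) UNIV (\<lambda>\<tau>. td_flow A X \<tau> t q)"
    using sol[of t q] by (simp add: solution_def)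
  from td_flow_eq[OF X this UNIV_I] show "td_flow A X \<tau> s (td_flow A X s t q) = td_flow A X \<tau> t q" .
qed

text \<open>The final time is fixed and the initial time varies, as in the family defining \<rho>;
  the inverse maps are covered by other choices of \<tau>0.\<close>

lemma smooth_into_td_flow:
  assumes X: "smooth_components X" and complete: "complete_td_vector_field A X" and c0: "c0 \<in> A"
  shows "smooth_into (UNIV \<times> im c0) (\<lambda>p. td_flow A X \<tau>0 (fst p) (chart_inv c0 (snd p)))"
proof -
  note flow = complete_flow[OF X complete]
  \<comment> \<open>\<open>P\<close> means smoothness in the initial point alone, \<open>Q\<close>
    joint smoothness in initial time and point. \<open>P\<close> at one time \<tau> gives
    \<open>Q\<close> at nearby t', because the flow from t' to \<tau>0 passes through time \<tau>
    and only the short piece from t' to \<tau> carries the variable t'.\<close>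
  define P where "P q \<tau> \<longleftrightarrow> (\<exists>c\<in>A. \<exists>W. snd c q \<in> W \<and> q \<in> fst c \<and> W \<subseteq> im c \<and>
     smooth_into W (\<lambda>x. td_flow A X \<tau>0 \<tau> (chart_inv c x)))" for q \<tau>
  define Q where "Q q \<tau> \<longleftrightarrow> (\<exists>c\<in>A. \<exists>W. (\<tau>, snd c q) \<in> W \<and> q \<in> fst c \<and> W \<subseteq> UNIV \<times> im c \<and>
     smooth_into W (\<lambda>p. td_flow A X \<tau>0 (fst p) (chart_inv c (snd p))))" for q \<tau>
  have QP: "P q \<tau>" if Q: "Q q \<tau>" for q \<tau>
  proof -
    obtain c W where c: "c \<in> A" "(\<tau>, snd c q) \<in> W" "q \<in> fst c" "W \<subseteq> UNIV \<times> im c"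
      "smooth_into W (\<lambda>p. td_flow A X \<tau>0 (fst p) (chart_inv c (snd p)))"
      using Q unfolding Q_def by blast
    define T where "T = Pair \<tau> -` W"
    have o: "open T" unfolding T_def
      by (rule open_vimage) (use c(5) in \<open>auto simp: smooth_into_def intro!: continuous_intros\<close>)
    have "smooth_on T (\<lambda>x. (\<tau>, x))"
      by (intro smooth_on_Pair o smooth_on_const smooth_on_linear[OF bounded_linear_ident])
    from smooth_into_compose[OF c(5) o this] have "smooth_into T (\<lambda>x. td_flow A X \<tau>0 \<tau> (chart_inv c x))"
      by (auto simp: T_def)
    moreover have "T \<subseteq> im c" "snd c q \<in> T" using c(2,4) by (auto simp: T_def)
    ultimately show ?thesis using c(1,3) unfolding P_def by blast
  qed
  \<comment> \<open>Near a point of a trajectory the flow stays in one chart, so smoothness of the map to time \<open>\<tau>0\<close>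
    propagates along the trajectory in both directions.\<close>
  have "Q q t" for q t
  proof -
    define \<gamma> where "\<gamma> \<tau> = td_flow A X \<tau> t q" for \<tau>
    have loc: "\<exists>\<delta>>0. \<forall>\<tau> t'. \<bar>\<tau> - t1\<bar> < \<delta> \<longrightarrow> \<bar>t' - t1\<bar> < \<delta> \<longrightarrow> P (\<gamma> \<tau>) \<tau> \<longrightarrow> Q (\<gamma> t') t'" for t1
    proof -
      obtain c where c: "c \<in> A" "\<gamma> t1 \<in> fst c" using ex_chart by blast
      obtain e V \<phi> where e: "e > 0" and V: "open V" "snd c (\<gamma> t1) \<in> V" "V \<subseteq> im c"
        and \<phi>: "smooth_on ({t1-e<..<t1+e} \<times> {t1-e<..<t1+e} \<times> V) (\<lambda>(\<tau>, t, x). \<phi> \<tau> t x)"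
        "\<And>t x. t \<in> {t1-e<..<t1+e} \<Longrightarrow> x \<in> V \<Longrightarrow> \<phi> t t x = x"
        "\<And>\<tau> t x. \<tau> \<in> {t1-e<..<t1+e} \<Longrightarrow> t \<in> {t1-e<..<t1+e} \<Longrightarrow> x \<in> V \<Longrightarrow>
           \<phi> \<tau> t x \<in> im c \<and> td_flow A X \<tau> t (chart_inv c x) = chart_inv c (\<phi> \<tau> t x) \<and>
           ((\<lambda>\<tau>. \<phi> \<tau> t x) has_vector_derivative X \<tau> (chart_inv c (\<phi> \<tau> t x)) c) (at \<tau>)"
        by (rule local_flow_in_chart[OF X c, of t1]) blast
      define I where "I = {t1-e<..<t1+e}"
      have "isCont \<gamma> t1"
        using flow(1)[of t q] by (simp add: \<gamma>_def[abs_def] solution_def integral_curve_def)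
      then have tend: "(\<gamma> \<longlongrightarrow> \<gamma> t1) (nhds t1)" "((\<lambda>s. snd c (\<gamma> s)) \<longlongrightarrow> snd c (\<gamma> t1)) (nhds t1)"
        using isCont_o2[of t1 \<gamma> "snd c", OF _ isCont_snd[OF c]]
        unfolding isCont_def tendsto_at_iff_tendsto_nhds[of \<gamma>] tendsto_at_iff_tendsto_nhds[of "\<lambda>s. snd c (\<gamma> s)"] by auto
      have "\<forall>\<^sub>F s in nhds t1. \<gamma> s \<in> fst c \<and> snd c (\<gamma> s) \<in> V \<and> s \<in> I"
        using topological_tendstoD[OF tend(1) open_fst[OF c(1)] c(2)] topological_tendstoD[OF tend(2) V(1,2)]
          eventually_nhds_in_open[of I t1] e by (auto simp: I_def intro: eventually_conj)
      then obtain \<delta> where \<delta>: "\<delta> > 0" "\<And>s. \<bar>s - t1\<bar> < \<delta> \<Longrightarrow> \<gamma> s \<in> fst c \<and> snd c (\<gamma> s) \<in> V \<and> s \<in> I"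
        unfolding eventually_nhds_metric dist_real_def by blast
      have "Q (\<gamma> t') t'" if \<tau>: "\<bar>\<tau> - t1\<bar> < \<delta>" and t': "\<bar>t' - t1\<bar> < \<delta>" and P: "P (\<gamma> \<tau>) \<tau>" for \<tau> t'
      proof -
        note \<tau>' = \<delta>(2)[OF \<tau>] and t'' = \<delta>(2)[OF t']
        obtain d W where d: "d \<in> A" "snd d (\<gamma> \<tau>) \<in> W" "\<gamma> \<tau> \<in> fst d" "W \<subseteq> im d"
          "smooth_into W (\<lambda>x. td_flow A X \<tau>0 \<tau> (chart_inv d x))"
          using P unfolding P_def by blast
        define h where "h p = chart_inv c (\<phi> \<tau> (fst p) (snd p))" for p
        have o: "open (I \<times> V)" using V(1) by (simp add: I_def open_Times)
        have flow\<tau>: "td_flow A X \<tau> s (chart_inv c x) = h (s, x)" "\<phi> \<tau> s x \<in> im c" if "s \<in> I" "x \<in> V" for s x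
          using \<phi>(3)[of \<tau> s x] \<tau>' that by (auto simp: I_def h_def)
        have "smooth_on (I \<times> V) (\<lambda>p. (\<tau>, p))"
          by (intro smooth_on_Pair o smooth_on_const smooth_on_linear[OF bounded_linear_ident])
        moreover have "(\<lambda>p. (\<tau>, p)) ` (I \<times> V) \<subseteq> {t1-e<..<t1+e} \<times> {t1-e<..<t1+e} \<times> V"
          using \<tau>' by (auto simp: I_def)
        ultimately have "smooth_on (I \<times> V) (\<lambda>p. \<phi> \<tau> (fst p) (snd p))"
          using smooth_on_compose[OF o _ _ \<phi>(1), of "\<lambda>p. (\<tau>, p)"] V(1) by (simp add: open_Times case_prod_unfold)
        from smooth_into_compose[OF smooth_into_chart_inv[OF c(1)] o this]
        have h: "smooth_into (I \<times> V) h" using flow\<tau>(2) by (force simp: h_def[abs_def])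
        define T where "T = (I \<times> V) \<inter> h -` fst d"
        have T: "open T" "smooth_on T (\<lambda>p. snd d (h p))"
          using smooth_into_open[OF h d(1)] h d(1) by (auto simp: T_def smooth_into_def)
        define T2 where "T2 = T \<inter> (\<lambda>p. snd d (h p)) -` W"
        have T2: "open T2" unfolding T2_def
          by (rule continuous_open_preimage[OF smooth_on_imp_continuous_on[OF T(2)] T(1)])
            (use d(5) in \<open>simp add: smooth_into_def\<close>)
        have hp: "h (t', snd c (\<gamma> t')) = \<gamma> \<tau>"
          using flow\<tau>(1)[of t' "snd c (\<gamma> t')"] t'' c(1) by (simp add: \<gamma>_def flow(3))
        have "smooth_into T2 (\<lambda>p. td_flow A X \<tau>0 \<tau> (chart_inv d (snd d (h p))))"
          by (rule smooth_into_compose[OF d(5) T2 smooth_on_subset[OF T(2)]]) (auto simp: T2_def)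
        then have "smooth_into T2 (\<lambda>p. td_flow A X \<tau>0 (fst p) (chart_inv c (snd p)))"
        proof (rule smooth_into_cong[rotated])
          fix p assume p: "p \<in> T2"
          then have "chart_inv d (snd d (h p)) = td_flow A X \<tau> (fst p) (chart_inv c (snd p))"
            using flow\<tau>(1)[of "fst p" "snd p"] d(1) by (auto simp: T2_def T_def)
          then show "td_flow A X \<tau>0 \<tau> (chart_inv d (snd d (h p))) = td_flow A X \<tau>0 (fst p) (chart_inv c (snd p))"
            by (simp add: flow(3))
        qed
        moreover have "(t', snd c (\<gamma> t')) \<in> T2"
          using t'' hp d(2,3) by (simp add: T2_def T_def)
        moreover have "T2 \<subseteq> UNIV \<times> im c" using V(3) by (auto simp: T2_def T_def)
        ultimately show ?thesis unfolding Q_def using c(1) t'' by blast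
      qed
      with \<delta>(1) show ?thesis by blast
    qed
    \<comment> \<open>By \<open>loc\<close>, good and bad times cannot mix near any t1, so S and its
      complement are open; S contains \<tau>0, where the flow map is the identity.\<close>
    define S where "S = {\<tau>. P (\<gamma> \<tau>) \<tau>}"
    have "open S" "open (- S)"
    proof -
      show "open S"
        unfolding open_dist
      proof
        fix t1 assume "t1 \<in> S"
        with loc[of t1] QP show "\<exists>e>0. \<forall>y. dist y t1 < e \<longrightarrow> y \<in> S" unfolding S_def dist_real_def
          by (metis abs_zero diff_self mem_Collect_eq)
      qed
      show "open (- S)"
        unfolding open_dist
      proof
        fix t1 assume "t1 \<in> - S"
        with loc[of t1] QP show "\<exists>e>0. \<forall>y. dist y t1 < e \<longrightarrow> y \<in> - S" unfolding S_def dist_real_def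
          by (metis (no_types, lifting) ComplD ComplI abs_zero diff_self mem_Collect_eq)
      qed
    qed
    then have "S = {} \<or> S = UNIV" using connected_UNIV[where 'a = real] clopen[of S] by (simp add: closed_def)
    moreover have "\<tau>0 \<in> S"
    proof -
      obtain c where c: "c \<in> A" "\<gamma> \<tau>0 \<in> fst c" using ex_chart by blast
      have "smooth_into (im c) (\<lambda>x. td_flow A X \<tau>0 \<tau>0 (chart_inv c x))"
        using smooth_into_chart_inv[OF c(1)] by (simp add: flow(2))
      then have "P (\<gamma> \<tau>0) \<tau>0" unfolding P_def using c by blast
      then show ?thesis by (simp add: S_def)
    qed
    ultimately have "P (\<gamma> t) t" unfolding S_def by blast
    then show ?thesis using loc[of t] flow(2)[of t q] by (metis \<gamma>_def abs_zero diff_self)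
  qed
  note Q = this
  show ?thesis
  proof (rule smooth_into_local)
    show "open ((UNIV :: real set) \<times> im c0)" using open_im[OF c0] by (simp add: open_Times)
    fix w :: "real \<times> 'e" assume w: "w \<in> UNIV \<times> im c0"
    define q where "q = chart_inv c0 (snd w)"
    have q: "q \<in> fst c0" "snd c0 q = snd w" using w c0 by (auto simp: q_def)
    obtain c W where c: "c \<in> A" "(fst w, snd c q) \<in> W" "q \<in> fst c" "W \<subseteq> UNIV \<times> im c"
      "smooth_into W (\<lambda>p. td_flow A X \<tau>0 (fst p) (chart_inv c (snd p)))"
      using Q[of q "fst w"] unfolding Q_def by blast
    define T where "T = (UNIV \<times> snd c0 ` (fst c0 \<inter> fst c)) \<inter> (\<lambda>p. (fst p, transition c0 c (snd p))) -` W"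
    note sm = smooth_on_fst_snd_transition[OF c0 c(1)]
    have o: "open T" unfolding T_def
      by (rule continuous_open_preimage[OF smooth_on_imp_continuous_on[OF sm]])
        (use open_overlap[OF c0 c(1)] c(5) in \<open>auto simp: open_Times smooth_into_def\<close>)
    have "smooth_into T (\<lambda>p. td_flow A X \<tau>0 (fst (fst p, transition c0 c (snd p))) (chart_inv c (snd (fst p, transition c0 c (snd p)))))"
      by (rule smooth_into_compose[OF c(5) o smooth_on_subset[OF sm]]) (auto simp: T_def)
    then have "smooth_into T (\<lambda>p. td_flow A X \<tau>0 (fst p) (chart_inv c0 (snd p)))"
      by (rule smooth_into_cong[rotated]) (use c0 c(1) in \<open>auto simp: T_def\<close>)
    moreover have "w \<in> T"
    proof -
      have "snd w \<in> snd c0 ` (fst c0 \<inter> fst c)" using q c(3) by (metis IntI image_eqI)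
      moreover have "transition c0 c (snd w) = snd c q" using transition_snd[OF c0 q(1)] q(2) by simp
      ultimately show ?thesis using c(2) by (cases w) (simp add: T_def)
    qed
    ultimately show "\<exists>T. w \<in> T \<and> smooth_into T (\<lambda>p. td_flow A X \<tau>0 (fst p) (chart_inv c0 (snd p)))" by blast
  qed
qed

section \<open>Smoothness in terms of a fixed chart\<close>

lemma chart_inv_product:
  assumes "inj_on (snd a) (fst a)" "inj_on (snd b) (fst b)" "x \<in> snd a ` fst a" "y \<in> snd b ` fst b"
  shows "chart_inv (fst a \<times> fst b, map_prod (snd a) (snd b)) (x, y) = (chart_inv a x, chart_inv b y)"
  unfolding chart_inv_def fst_conv snd_conv
  by (rule inv_into_f_eq) (use assms in \<open>auto intro!: map_prod_inj_on simp: inv_into_into f_inv_into_f\<close>)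

lemma chart_inv_id: "chart_inv (UNIV, \<lambda>x. x) x = x"
  unfolding chart_inv_def by (rule inv_into_f_eq) auto

text \<open>The definition provides some chart c for the source and a bundle chart over some d. To
  reach the prescribed chart e, the base coordinates are changed by the transition from e to c and
  the fibre components by the Jacobian from d to e.\<close>

lemma smooth_td_vector_field_components:
  assumes X: "smooth_td_vector_field A X"
  shows "smooth_components X"
  unfolding smooth_components_def
proof (intro conjI ballI)
  show tan: "\<forall>t q. X t q \<in> tangent_space A q" using X by (simp add: smooth_td_vector_field_def)
  fix e assume e: "e \<in> A"
  show "smooth_on (UNIV \<times> im e) (\<lambda>(t, x). X t (chart_inv e x) e)"
  proof (rule smooth_on_local)
    fix w :: "real \<times> 'e" assume w: "w \<in> UNIV \<times> im e"
    define t0 where "t0 = fst w"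
    define q0 where "q0 = chart_inv e (snd w)"
    have q0: "q0 \<in> fst e" "snd e q0 = snd w" using w e by (auto simp: q0_def)
    obtain c where c: "c \<in> A" "q0 \<in> fst c" using ex_chart by blast
    let ?F = "\<lambda>(t, q). (q, X t q)"
    have cover: "(t0, q0) \<in> (\<Union>c\<in>prod_atlas real_atlas A. fst c)"
    proof (rule UN_I)
      show "(UNIV \<times> fst c, map_prod (\<lambda>x. x) (snd c)) \<in> prod_atlas real_atlas A"
        unfolding prod_atlas_def real_atlas_def using c(1) by force
    qed (use c in simp)
    from X have "smooth_map (prod_atlas real_atlas A) (tangent_bundle_atlas A) ?F"
      by (simp add: smooth_td_vector_field_def)
    then obtain c' d' W where c': "c' \<in> charts_at (prod_atlas real_atlas A) (t0, q0)"
      and d': "d' \<in> tangent_bundle_atlas A" and W: "open W" "snd c' (t0, q0) \<in> W" "W \<subseteq> snd c' ` fst c'"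
      "?F ` chart_inv c' ` W \<subseteq> fst d'" "smooth_on W (snd d' \<circ> ?F \<circ> chart_inv c')"
      using cover unfolding smooth_map_def by meson
    obtain c where c: "c \<in> A" "c' = (UNIV \<times> fst c, map_prod (\<lambda>x. x) (snd c))" "q0 \<in> fst c"
      using c' by (auto simp: charts_at_def prod_atlas_def real_atlas_def)
    obtain d where d: "d \<in> A" "d' = ({(q, v). q \<in> fst d \<and> v \<in> tangent_space A q}, \<lambda>(q, v). (snd d q, v d))"
      using d' by (auto simp: tangent_bundle_atlas_def)
    have inv: "chart_inv c' (t, x) = (t, chart_inv c x)" if "x \<in> im c" for t x
      using chart_inv_product[of "(UNIV, \<lambda>x. x)" c t x] inj_on_chart[OF c(1)] that by (simp add: c(2) chart_inv_id)
    have Wc: "x \<in> im c" if "(t, x) \<in> W" for t x using W(3) that by (auto simp: c(2))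
    have Wd: "chart_inv c x \<in> fst d" if "(t, x) \<in> W" for t x
    proof -
      have "?F (chart_inv c' (t, x)) \<in> fst d'" using W(4) that by blast
      then show ?thesis using inv[OF Wc[OF that]] by (simp add: d(2))
    qed
    have sW: "smooth_on W (\<lambda>p. (snd d (chart_inv c (snd p)), X (fst p) (chart_inv c (snd p)) d))"
      by (rule smooth_on_cong[OF W(1) _ W(5)]) (use inv Wc in \<open>force simp: d(2)\<close>)
    define g where "g p = (fst p, transition e c (snd p))" for p :: "real \<times> 'e"
    define T where "T = (UNIV \<times> snd e ` (fst e \<inter> fst c)) \<inter> g -` W"
    have g: "smooth_on (UNIV \<times> snd e ` (fst e \<inter> fst c)) g"
      using smooth_on_fst_snd_transition[OF e c(1)] by (simp add: g_def[abs_def])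
    have o: "open T" unfolding T_def
      by (rule continuous_open_preimage[OF smooth_on_imp_continuous_on[OF g] _ W(1)])
        (use open_overlap[OF e c(1)] in \<open>simp add: open_Times\<close>)
    have "smooth_on T g" by (rule smooth_on_subset[OF g]) (auto simp: T_def)
    from smooth_on_compose[OF o W(1) this sW]
    have "smooth_on T (\<lambda>p. (snd d (chart_inv c (snd (g p))), X (fst (g p)) (chart_inv c (snd (g p))) d))"
      by (auto simp: T_def)
    then have sT: "smooth_on T (\<lambda>p. (snd d (chart_inv e (snd p)), X (fst p) (chart_inv e (snd p)) d))"
      by (rule smooth_on_cong[OF o, rotated]) (use e c(1) in \<open>auto simp: T_def g_def\<close>)
    have memT: "chart_inv e (snd p) \<in> fst e" "chart_inv e (snd p) \<in> fst d" if "p \<in> T" for p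
      using that e c(1) Wd[of "fst p" "transition e c (snd p)"] by (auto simp: T_def g_def)
    have "smooth_on T (\<lambda>p. jac d e (chart_inv e (snd p)) (X (fst p) (chart_inv e (snd p)) d))"
    proof (rule smooth_on_frechet_derivative_apply[OF open_overlap[OF d(1) e] o smooth_on_transition[OF d(1) e]])
      show "smooth_on T (\<lambda>p. snd d (chart_inv e (snd p)))"
        using smooth_on_bounded_linear[OF bounded_linear_fst o sT] by simp
      show "smooth_on T (\<lambda>p. X (fst p) (chart_inv e (snd p)) d)"
        using smooth_on_bounded_linear[OF bounded_linear_snd o sT] by simp
      show "(\<lambda>p. snd d (chart_inv e (snd p))) ` T \<subseteq> snd d ` (fst d \<inter> fst e)" using memT by blast
    qed
    then have "smooth_on T (\<lambda>(t, x). X t (chart_inv e x) e)"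
    proof (rule smooth_on_cong[OF o, rotated])
      fix p assume p: "p \<in> T"
      show "jac d e (chart_inv e (snd p)) (X (fst p) (chart_inv e (snd p)) d) = (case p of (t, x) \<Rightarrow> X t (chart_inv e x) e)"
        using tangent_space_jac[OF _ d(1) e memT(2)[OF p] memT(1)[OF p]] tan by (simp add: case_prod_unfold)
    qed
    moreover have "w \<in> T"
    proof -
      have "snd w \<in> snd e ` (fst e \<inter> fst c)" using q0 c(3) by (metis IntI image_eqI)
      moreover have "g w = snd c' (t0, q0)" using transition_snd[OF e q0(1), of c] q0(2) by (simp add: g_def c(2) t0_def)
      ultimately show ?thesis using W(2) by (cases w) (simp add: T_def)
    qed
    ultimately show "\<exists>T. open T \<and> w \<in> T \<and> smooth_on T (\<lambda>(t, x). X t (chart_inv e x) e)" using o by blast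
  qed
qed

text \<open>The source chart can be prescribed by composing with a transition map. The target chart
  remains the supplied one and is dealt with in each application.\<close>

lemma smooth_map_in_chart:
  assumes F: "smooth_map A B F" and e: "e \<in> A" "x0 \<in> im e"
  obtains d T where "d \<in> B" "open T" "x0 \<in> T" "T \<subseteq> im e" "F ` chart_inv e ` T \<subseteq> fst d"
    "smooth_on T (snd d \<circ> F \<circ> chart_inv e)"
proof -
  define q where "q = chart_inv e x0"
  have q: "q \<in> fst e" "snd e q = x0" using e by (auto simp: q_def)
  have "q \<in> (\<Union>c\<in>A. fst c)" using e(1) q(1) by blast
  then obtain c d W where "c \<in> charts_at A q" and d: "d \<in> B" and W: "open W" "snd c q \<in> W" "W \<subseteq> snd c ` fst c"
      "F ` chart_inv c ` W \<subseteq> fst d" "smooth_on W (snd d \<circ> F \<circ> chart_inv c)"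
    using F unfolding smooth_map_def by meson
  then have c: "c \<in> A" "q \<in> fst c" by (auto simp: charts_at_def)
  define T where "T = snd e ` (fst e \<inter> fst c) \<inter> transition e c -` W"
  note sm = smooth_on_transition[OF e(1) c(1)]
  have o: "open T" unfolding T_def
    by (rule continuous_open_preimage[OF smooth_on_imp_continuous_on[OF sm] open_overlap[OF e(1) c(1)] W(1)])
  have eq: "chart_inv c (transition e c x) = chart_inv e x" if "x \<in> T" for x
    using that e(1) c(1) by (auto simp: T_def)
  have "smooth_on T (\<lambda>x. (snd d \<circ> F \<circ> chart_inv c) (transition e c x))"
    by (rule smooth_on_compose[OF o W(1) smooth_on_subset[OF sm] W(5)]) (auto simp: T_def)
  then have "smooth_on T (snd d \<circ> F \<circ> chart_inv e)"
    by (rule smooth_on_cong[OF o, rotated]) (simp add: eq)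
  moreover have "F ` chart_inv e ` T \<subseteq> fst d"
  proof -
    have "F (chart_inv e x) \<in> fst d" if "x \<in> T" for x using W(4) that eq[OF that] by (force simp: T_def)
    then show ?thesis by blast
  qed
  moreover have "x0 \<in> T"
  proof -
    have "x0 \<in> snd e ` (fst e \<inter> fst c)" using q c(2) by (metis IntI image_eqI)
    then show ?thesis using transition_snd[OF e(1) q(1), of c] q(2) W(2) by (simp add: T_def)
  qed
  ultimately show ?thesis using that[OF d o] by (auto simp: T_def)
qed

lemma smooth_fun_in_chart:
  assumes f: "smooth_fun A f" and e: "e \<in> A"
  shows "smooth_on (im e) (\<lambda>x. f (chart_inv e x))"
proof (rule smooth_on_local)
  fix x assume x: "x \<in> im e"
  obtain d T where "d \<in> real_atlas" "open T" "x \<in> T" "smooth_on T (snd d \<circ> f \<circ> chart_inv e)"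
    using smooth_map_in_chart[OF f e x] by metis
  then show "\<exists>T. open T \<and> x \<in> T \<and> smooth_on T (\<lambda>x. f (chart_inv e x))"
    by (intro exI[of _ T]) (simp add: real_atlas_def o_def)
qed

lemma smooth_fun_prod_atlasI:
  assumes "\<And>c. c \<in> A \<Longrightarrow> smooth_on (im c \<times> UNIV) (\<lambda>(x, t). f (chart_inv c x, t))"
  shows "smooth_fun (prod_atlas A real_atlas) f"
  unfolding smooth_map_def
proof
  fix p :: "'m \<times> real" assume "p \<in> (\<Union>c\<in>prod_atlas A real_atlas. fst c)"
  obtain q t where p: "p = (q, t)" by fastforce
  obtain c where c: "c \<in> A" "q \<in> fst c" using ex_chart by blast
  define c' where "c' = (fst c \<times> (UNIV :: real set), map_prod (snd c) (\<lambda>x :: real. x))"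
  have c': "c' \<in> charts_at (prod_atlas A real_atlas) p"
    using c by (force simp: charts_at_def prod_atlas_def real_atlas_def c'_def p)
  have inv: "chart_inv c' (x, t) = (chart_inv c x, t)" if "x \<in> im c" for x t
    using chart_inv_product[of c "(UNIV, \<lambda>x. x)" x t] inj_on_chart[OF c(1)] that by (simp add: c'_def chart_inv_id)
  have o: "open (im c \<times> (UNIV :: real set))" using open_im[OF c(1)] by (simp add: open_Times)
  have "smooth_on (im c \<times> UNIV) (snd (UNIV, \<lambda>x. x) \<circ> f \<circ> chart_inv c')"
    by (rule smooth_on_cong[OF o _ assms[OF c(1)]]) (use inv in force)
  moreover have "im c \<times> UNIV \<subseteq> snd c' ` fst c'" by (force simp: c'_def)
  moreover have "snd c' p \<in> im c \<times> UNIV" using c by (simp add: c'_def p)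
  ultimately show "\<exists>c\<in>charts_at (prod_atlas A real_atlas) p. \<exists>d\<in>real_atlas. \<exists>W. open W \<and> snd c p \<in> W \<and>
      W \<subseteq> snd c ` fst c \<and> f ` chart_inv c ` W \<subseteq> fst d \<and> smooth_on W (snd d \<circ> f \<circ> chart_inv c)"
    using c' o by (intro bexI[OF _ c'] bexI[of _ "(UNIV, \<lambda>x. x)"] exI[of _ "im c \<times> UNIV"]) (auto simp: real_atlas_def)
qed

end

section \<open>Variation of the volume distortion\<close>

text \<open>The mean value inequality along u is applied to the difference of f at points shifted by
  h v, corrected by a linear term; the derivative of that function is o(h) by differentiability at z
  of the derivative of f along u.\<close>

lemma second_difference_bound:
  fixes f :: "'a::euclidean_space \<Rightarrow> 'b::real_normed_vector"
  assumes f: "smooth_on S f" and S: "open S" "z \<in> S" and e: "e > 0"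
  obtains d where "d > 0" "\<And>h. 0 < h \<Longrightarrow> h < d \<Longrightarrow>
    norm (f (z + h *\<^sub>R u + h *\<^sub>R v) - f (z + h *\<^sub>R u) - f (z + h *\<^sub>R v) + f z
      - (h * h) *\<^sub>R frechet_derivative (\<lambda>y. frechet_derivative f (at y) u) (at z) v) \<le> e * h * h"
proof -
  define G where "G y = frechet_derivative f (at y) u" for y
  define L where "L = frechet_derivative G (at z)"
  have "smooth_on S G" using smooth_on_frechet_derivative[OF f, of u] by (simp add: G_def[abs_def])
  then have G: "(G has_derivative L) (at z)" unfolding L_def using S(2) by (rule smooth_on_has_derivative)
  interpret L: bounded_linear L using has_derivative_bounded_linear[OF G] .
  \<comment> \<open>All displacements in the parallelogram have norm at most h c; the summand 1
    makes c positive. The tolerance e / (2 c) then leaves e h / 2 for each of the two derivative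
    values compared.\<close>
  define c where "c = norm u + norm v + 1"
  have c: "c > 0" by (simp add: c_def add_nonneg_pos)
  obtain \<delta> where \<delta>: "\<delta> > 0" "\<And>y. norm (y - z) < \<delta> \<Longrightarrow> norm (G y - G z - L (y - z)) \<le> e / (2 * c) * norm (y - z)"
    using G e c unfolding has_derivative_at_alt by (metis divide_pos_pos mult_pos_pos zero_less_numeral)
  obtain r where r: "r > 0" "ball z r \<subseteq> S" using S openE by blast
  define d where "d = min \<delta> r / c"
  have "norm (f (z + h *\<^sub>R u + h *\<^sub>R v) - f (z + h *\<^sub>R u) - f (z + h *\<^sub>R v) + f z - (h * h) *\<^sub>R L v) \<le> e * h * h"
    if h: "0 < h" "h < d" for h
  proof -
    have hc: "h * c < min \<delta> r" using h(2) c by (simp add: d_def field_simps)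
    have small: "norm (t *\<^sub>R u + a *\<^sub>R v) \<le> h * c" if "t \<in> {0..h}" "a \<in> {0..h}" for t a
    proof -
      have "norm (t *\<^sub>R u + a *\<^sub>R v) \<le> \<bar>t\<bar> * norm u + \<bar>a\<bar> * norm v" by (rule norm_triangle_le) simp
      also have "\<dots> \<le> h * norm u + h * norm v" using that by (intro add_mono mult_right_mono) auto
      also have "\<dots> \<le> h * c" using h(1) by (simp add: c_def algebra_simps)
      finally show ?thesis .
    qed
    have mem: "z + t *\<^sub>R u + a *\<^sub>R v \<in> S" if "t \<in> {0..h}" "a \<in> {0..h}" for t a
    proof -
      have "dist z (z + w) = norm w" for w by (simp add: dist_norm)
      from this[of "t *\<^sub>R u + a *\<^sub>R v"] have "dist z (z + t *\<^sub>R u + a *\<^sub>R v) < r"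
        using small[OF that] hc by (simp add: add.assoc)
      then show ?thesis using r(2) by auto
    qed
    have est: "norm (G (z + t *\<^sub>R u + a *\<^sub>R v) - G z - L (t *\<^sub>R u + a *\<^sub>R v)) \<le> e / 2 * h"
      if "t \<in> {0..h}" "a \<in> {0..h}" for t a
    proof -
      have "norm (G (z + t *\<^sub>R u + a *\<^sub>R v) - G z - L (t *\<^sub>R u + a *\<^sub>R v)) \<le> e / (2 * c) * norm (t *\<^sub>R u + a *\<^sub>R v)"
        using \<delta>(2)[of "z + t *\<^sub>R u + a *\<^sub>R v"] small[OF that] hc by (simp add: add.assoc)
      also have "\<dots> \<le> e / (2 * c) * (h * c)" using small[OF that] e c by (intro mult_left_mono) auto
      also have "\<dots> = e / 2 * h" using c by simp
      finally show ?thesis .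
    qed
    have der: "((\<lambda>t. f (z + t *\<^sub>R u + a *\<^sub>R v)) has_derivative (\<lambda>s. s *\<^sub>R G (z + t *\<^sub>R u + a *\<^sub>R v))) (at t within {0..h})"
      if "t \<in> {0..h}" "a \<in> {0..h}" for t a
    proof -
      note D = smooth_on_has_derivative[OF f mem[OF that]]
      have "((\<lambda>t. z + t *\<^sub>R u + a *\<^sub>R v) has_derivative (\<lambda>s. s *\<^sub>R u)) (at t within {0..h})"
        by (auto intro!: derivative_eq_intros)
      from has_derivative_compose[OF this D] show ?thesis
        by (simp add: G_def linear_scale[OF has_derivative_linear[OF D]])
    qed
    define k where "k t = f (z + t *\<^sub>R u + h *\<^sub>R v) - f (z + t *\<^sub>R u + 0 *\<^sub>R v) - t *\<^sub>R (h *\<^sub>R L v)" for t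
    have "norm (k h - k 0) \<le> (e * h) * norm (h - 0)"
    proof (rule differentiable_bound[of "{0..h}" k "\<lambda>t s. s *\<^sub>R G (z + t *\<^sub>R u + h *\<^sub>R v) - s *\<^sub>R G (z + t *\<^sub>R u + 0 *\<^sub>R v) - s *\<^sub>R (h *\<^sub>R L v)"])
      fix t assume t: "t \<in> {0..h}"
      show "(k has_derivative (\<lambda>s. s *\<^sub>R G (z + t *\<^sub>R u + h *\<^sub>R v) - s *\<^sub>R G (z + t *\<^sub>R u + 0 *\<^sub>R v) - s *\<^sub>R (h *\<^sub>R L v))) (at t within {0..h})"
        unfolding k_def[abs_def] by (intro has_derivative_diff der t) (use h in \<open>auto intro!: derivative_eq_intros\<close>)
      have "G (z + t *\<^sub>R u + h *\<^sub>R v) - G (z + t *\<^sub>R u + 0 *\<^sub>R v) - h *\<^sub>R L v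
         = (G (z + t *\<^sub>R u + h *\<^sub>R v) - G z - L (t *\<^sub>R u + h *\<^sub>R v)) - (G (z + t *\<^sub>R u + 0 *\<^sub>R v) - G z - L (t *\<^sub>R u + 0 *\<^sub>R v))"
        by (simp add: L.add L.scaleR)
      also have "norm \<dots> \<le> e / 2 * h + e / 2 * h"
        by (rule order_trans[OF norm_triangle_ineq4]) (intro add_mono est t; use h in simp)
      finally have *: "norm (G (z + t *\<^sub>R u + h *\<^sub>R v) - G (z + t *\<^sub>R u + 0 *\<^sub>R v) - h *\<^sub>R L v) \<le> e * h" by simp
      show "onorm (\<lambda>s. s *\<^sub>R G (z + t *\<^sub>R u + h *\<^sub>R v) - s *\<^sub>R G (z + t *\<^sub>R u + 0 *\<^sub>R v) - s *\<^sub>R (h *\<^sub>R L v)) \<le> e * h"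
      proof (rule onorm_bound)
        show "0 \<le> e * h" using e h by simp
        fix s :: real
        have "norm (s *\<^sub>R (G (z + t *\<^sub>R u + h *\<^sub>R v) - G (z + t *\<^sub>R u + 0 *\<^sub>R v) - h *\<^sub>R L v)) \<le> \<bar>s\<bar> * (e * h)"
          unfolding norm_scaleR by (intro mult_left_mono *) simp
        then show "norm (s *\<^sub>R G (z + t *\<^sub>R u + h *\<^sub>R v) - s *\<^sub>R G (z + t *\<^sub>R u + 0 *\<^sub>R v) - s *\<^sub>R (h *\<^sub>R L v)) \<le> e * h * norm s"
          by (simp add: scaleR_diff_right mult.commute)
      qed
    qed (use h in auto)
    moreover have "k h - k 0 = f (z + h *\<^sub>R u + h *\<^sub>R v) - f (z + h *\<^sub>R u) - f (z + h *\<^sub>R v) + f z - (h * h) *\<^sub>R L v"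
      by (simp add: k_def algebra_simps)
    ultimately show ?thesis using h by simp
  qed
  moreover have "d > 0" using \<delta>(1) r(1) c by (simp add: d_def)
  ultimately show ?thesis using that unfolding L_def G_def by blast
qed

text \<open>The second difference is symmetric in u and v, and after division by the square of h it
  approximates both iterated derivatives.\<close>

lemma mixed_partial_derivatives:
  fixes f :: "'a::euclidean_space \<Rightarrow> 'b::real_normed_vector"
  assumes f: "smooth_on S f" and S: "open S" "z \<in> S"
  shows "frechet_derivative (\<lambda>y. frechet_derivative f (at y) u) (at z) v
       = frechet_derivative (\<lambda>y. frechet_derivative f (at y) v) (at z) u" (is "?a = ?b")
proof (rule ccontr)
  assume ne: "?a \<noteq> ?b"
  \<comment> \<open>A quarter suffices: the two approximations leave an error of 2 e against a gap
    of 4 e, both times the square of h.\<close>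
  define e where "e = norm (?a - ?b) / 4"
  have e: "e > 0" using ne by (simp add: e_def)
  obtain d1 where d1: "d1 > 0" "\<And>h. 0 < h \<Longrightarrow> h < d1 \<Longrightarrow>
    norm (f (z + h *\<^sub>R u + h *\<^sub>R v) - f (z + h *\<^sub>R u) - f (z + h *\<^sub>R v) + f z - (h * h) *\<^sub>R ?a) \<le> e * h * h"
    using second_difference_bound[OF f S e, of u v] by blast
  obtain d2 where d2: "d2 > 0" "\<And>h. 0 < h \<Longrightarrow> h < d2 \<Longrightarrow>
    norm (f (z + h *\<^sub>R v + h *\<^sub>R u) - f (z + h *\<^sub>R v) - f (z + h *\<^sub>R u) + f z - (h * h) *\<^sub>R ?b) \<le> e * h * h"
    using second_difference_bound[OF f S e, of v u] by blast
  define h where "h = min d1 d2 / 2"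
  have h: "0 < h" "h < d1" "h < d2" using d1(1) d2(1) by (auto simp: h_def min_def)
  define D where "D = f (z + h *\<^sub>R u + h *\<^sub>R v) - f (z + h *\<^sub>R u) - f (z + h *\<^sub>R v) + f z"
  have "norm (D - (h * h) *\<^sub>R ?a) \<le> e * h * h" using d1(2)[OF h(1,2)] by (simp add: D_def)
  moreover have "norm (D - (h * h) *\<^sub>R ?b) \<le> e * h * h"
    using d2(2)[OF h(1,3)] by (simp add: D_def algebra_simps)
  moreover have "norm ((h * h) *\<^sub>R (?a - ?b)) \<le> norm (D - (h * h) *\<^sub>R ?b) + norm (D - (h * h) *\<^sub>R ?a)"
    using norm_triangle_ineq4[of "D - (h * h) *\<^sub>R ?b" "D - (h * h) *\<^sub>R ?a"] by (simp add: scaleR_diff_right)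
  ultimately have "norm ((h * h) *\<^sub>R (?a - ?b)) \<le> e * h * h + e * h * h" by linarith
  moreover have "norm ((h * h) *\<^sub>R (?a - ?b)) = (h * h) * (4 * e)" unfolding norm_scaleR e_def by simp
  ultimately have "(h * h) * (4 * e) \<le> (h * h) * (2 * e)" by (simp add: algebra_simps)
  then show False using h(1) e by simp
qed

text \<open>Jacobi's formula at the identity. In the Leibniz expansion a permutation other than the
  identity moves at least two indices, so a vanishing off-diagonal factor remains after one factor
  has been differentiated.\<close>

lemma has_real_derivative_det:
  fixes M :: "real \<Rightarrow> real ^ 'n ^ 'n"
  assumes der: "\<And>i j. ((\<lambda>s. M s $ i $ j) has_real_derivative M' i j) (at s0)" and id: "M s0 = mat 1"
  shows "((\<lambda>s. det (M s)) has_real_derivative (\<Sum>i\<in>UNIV. M' i i)) (at s0)"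
proof -
  have prod: "((\<lambda>s. \<Prod>i\<in>UNIV. M s $ i $ p i) has_real_derivative
     (\<Sum>i\<in>UNIV. M' i (p i) * (\<Prod>j\<in>UNIV - {i}. M s0 $ j $ p j))) (at s0)" for p :: "'n \<Rightarrow> 'n"
  proof -
    have "((\<lambda>s. \<Prod>i\<in>UNIV. M s $ i $ p i) has_derivative
       (\<lambda>h. \<Sum>i\<in>UNIV. M' i (p i) * h * (\<Prod>j\<in>UNIV - {i}. M s0 $ j $ p j))) (at s0)"
      by (rule has_derivative_prod) (rule der[unfolded has_field_derivative_def])
    moreover have "(\<lambda>h. \<Sum>i\<in>UNIV. M' i (p i) * h * (\<Prod>j\<in>UNIV - {i}. M s0 $ j $ p j)) =
       (*) (\<Sum>i\<in>UNIV. M' i (p i) * (\<Prod>j\<in>UNIV - {i}. M s0 $ j $ p j))"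
      by (auto simp: fun_eq_iff sum_distrib_right intro!: sum.cong)
    ultimately show ?thesis by (simp add: has_field_derivative_def)
  qed
  have "((\<lambda>s. det (M s)) has_real_derivative (\<Sum>p | p permutes (UNIV :: 'n set).
      of_int (sign p) * (\<Sum>i\<in>UNIV. M' i (p i) * (\<Prod>j\<in>UNIV - {i}. M s0 $ j $ p j)))) (at s0)"
    unfolding det_def by (intro DERIV_sum DERIV_cmult prod)
  also have "(\<Sum>p | p permutes (UNIV :: 'n set).
      of_int (sign p) * (\<Sum>i\<in>UNIV. M' i (p i) * (\<Prod>j\<in>UNIV - {i}. M s0 $ j $ p j))) =
      (\<Sum>p\<in>{id}. of_int (sign p) * (\<Sum>i\<in>UNIV. M' i (p i) * (\<Prod>j\<in>UNIV - {i}. M s0 $ j $ p j)))"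
  proof (rule sum.mono_neutral_right)
    show "finite {p. p permutes (UNIV :: 'n set)}" by (rule finite_permutations) simp
    show "{id} \<subseteq> {p. p permutes (UNIV :: 'n set)}" by (simp add: permutes_id)
    show "\<forall>p\<in>{p. p permutes (UNIV :: 'n set)} - {id}.
       of_int (sign p) * (\<Sum>i\<in>UNIV. M' i (p i) * (\<Prod>j\<in>UNIV - {i}. M s0 $ j $ p j)) = 0"
    proof
      fix p :: "'n \<Rightarrow> 'n" assume p: "p \<in> {p. p permutes UNIV} - {id}"
      then have inj: "inj p" using permutes_inj by blast
      have "(\<Prod>j\<in>UNIV - {i}. M s0 $ j $ p j) = 0" for i
      proof -
        obtain k where k: "p k \<noteq> k" using p by (auto simp: fun_eq_iff)
        \<comment> \<open>By injectivity p moves \<open>p k\<close> as well as k, and at least one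
          of the two differs from i.\<close>
        have "\<exists>j. j \<noteq> i \<and> p j \<noteq> j"
          using k inj by (metis injD)
        then obtain j where "j \<noteq> i" "p j \<noteq> j" by blast
        then show ?thesis by (intro prod_zero) (auto simp: id mat_def intro!: bexI[of _ j])
      qed
      then show "of_int (sign p) * (\<Sum>i\<in>UNIV. M' i (p i) * (\<Prod>j\<in>UNIV - {i}. M s0 $ j $ p j)) = 0"
        by (simp only: mult_zero_right sum.neutral_const)
    qed
  qed
  also have "\<dots> = (\<Sum>i\<in>UNIV. M' i i)" by (simp add: id mat_def)
  finally show ?thesis .
qed

lemma smooth_on_slice:
  fixes \<psi> :: "real \<Rightarrow> 'a::euclidean_space \<Rightarrow> 'b::real_normed_vector"
  assumes \<psi>: "smooth_on (T \<times> V) (\<lambda>(s, x). \<psi> s x)" and T: "s \<in> T" "x \<in> V"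
  shows "(\<psi> s has_derivative (\<lambda>v. frechet_derivative (\<lambda>(s, x). \<psi> s x) (at (s, x)) (0, v))) (at x)"
    and "((\<lambda>s. \<psi> s x) has_vector_derivative frechet_derivative (\<lambda>(s, x). \<psi> s x) (at (s, x)) (1, 0)) (at s)"
proof -
  have D: "((\<lambda>(s, x). \<psi> s x) has_derivative frechet_derivative (\<lambda>(s, x). \<psi> s x) (at (s, x))) (at (s, x))"
    using smooth_on_has_derivative[OF \<psi>] T by blast
  have "((\<lambda>x. (s, x)) has_derivative (\<lambda>v. (0, v))) (at x)" by (auto intro!: derivative_eq_intros)
  from has_derivative_compose[OF this D]
  show "(\<psi> s has_derivative (\<lambda>v. frechet_derivative (\<lambda>(s, x). \<psi> s x) (at (s, x)) (0, v))) (at x)" by simp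
  have "((\<lambda>s. (s, x)) has_derivative (\<lambda>r. (r, 0))) (at s)" by (auto intro!: derivative_eq_intros)
  from has_derivative_compose[OF this D]
  have "((\<lambda>s. \<psi> s x) has_derivative (\<lambda>r. frechet_derivative (\<lambda>(s, x). \<psi> s x) (at (s, x)) (r, 0))) (at s)" by simp
  then show "((\<lambda>s. \<psi> s x) has_vector_derivative frechet_derivative (\<lambda>(s, x). \<psi> s x) (at (s, x)) (1, 0)) (at s)"
    unfolding has_vector_derivative_def
  proof (rule has_derivative_eq_rhs, intro ext)
    fix r
    show "frechet_derivative (\<lambda>(s, x). \<psi> s x) (at (s, x)) (r, 0) =
      r *\<^sub>R frechet_derivative (\<lambda>(s, x). \<psi> s x) (at (s, x)) (1, 0)"
      using linear_scale[OF has_derivative_linear[OF D], of r "(1, 0)"] by (simp only: scaleR_Pair scaleR_zero_right real_scaleR_def mult_1_right)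
  qed
qed

text \<open>Liouville's formula; it rests on exchanging the time and space derivatives of \<open>\<psi>\<close>.\<close>

lemma has_real_derivative_pullback_volume:
  fixes \<psi> :: "real \<Rightarrow> real ^ 'n \<Rightarrow> real ^ 'n" and \<sigma> :: "real ^ 'n \<Rightarrow> real"
  assumes \<psi>: "smooth_on (T \<times> V) (\<lambda>(s, x). \<psi> s x)" and T: "open T" "s0 \<in> T" and V: "open V" "x1 \<in> V"
    and id: "\<And>x. x \<in> V \<Longrightarrow> \<psi> s0 x = x"
    and \<xi>: "\<And>x. x \<in> V \<Longrightarrow> ((\<lambda>s. \<psi> s x) has_vector_derivative \<xi> x) (at s0)"
    and \<sigma>: "(\<sigma> has_derivative D\<sigma>) (at x1)"
  shows "((\<lambda>s. \<sigma> (\<psi> s x1) * \<bar>det (matrix (frechet_derivative (\<psi> s) (at x1)))\<bar>) has_real_derivative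
     D\<sigma> (\<xi> x1) + \<sigma> x1 * (\<Sum>i\<in>UNIV. frechet_derivative \<xi> (at x1) (axis i 1) $ i)) (at s0)"
proof -
  define \<Psi> where "\<Psi> = (\<lambda>(s, x). \<psi> s x)"
  define D where "D = (\<lambda>z. frechet_derivative \<Psi> (at z))"
  have \<Psi>: "smooth_on (T \<times> V) \<Psi>" using \<psi> by (simp add: \<Psi>_def)
  have TV: "open (T \<times> V)" "(s0, x1) \<in> T \<times> V" using T V by (auto simp: open_Times)
  have Ds: "(\<psi> s has_derivative (\<lambda>v. D (s, x) (0, v))) (at x)"
    "((\<lambda>s. \<psi> s x) has_vector_derivative D (s, x) (1, 0)) (at s)" if "s \<in> T" "x \<in> V" for s x
    using smooth_on_slice[OF \<psi> that] by (simp_all add: D_def \<Psi>_def)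
  have smD: "smooth_on (T \<times> V) (\<lambda>z. D z w)" for w
    unfolding D_def by (rule smooth_on_frechet_derivative[OF \<Psi>])
  \<comment> \<open>Differentiability of \<xi> is not assumed; it follows because \<xi> is the time
    derivative of the smooth map \<Psi> along the slice at s0.\<close>
  have \<xi>D: "\<xi> x = D (s0, x) (1, 0)" if "x \<in> V" for x
    using vector_derivative_unique_at[OF \<xi>[OF that] Ds(2)[OF T(2) that]] .
  have "((\<lambda>x. D (s0, x) (1, 0)) has_derivative (\<lambda>v. frechet_derivative (\<lambda>z. D z (1, 0)) (at (s0, x1)) (0, v))) (at x1)"
    using smooth_on_slice(1)[of T V "\<lambda>s x. D (s, x) (1, 0)" s0 x1] smD T V by (simp add: case_prod_unfold)
  then have "(\<xi> has_derivative (\<lambda>v. frechet_derivative (\<lambda>z. D z (1, 0)) (at (s0, x1)) (0, v))) (at x1)"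
    by (rule has_derivative_transform_within_open[OF _ V]) (simp add: \<xi>D)
  then have D\<xi>: "frechet_derivative \<xi> (at x1) v = frechet_derivative (\<lambda>z. D z (1, 0)) (at (s0, x1)) (0, v)" for v
    using frechet_derivative_at by metis
  define M where "M s = matrix (\<lambda>v. D (s, x1) (0, v))" for s
  have M: "matrix (frechet_derivative (\<psi> s) (at x1)) = M s" if "s \<in> T" for s
    using frechet_derivative_at[OF Ds(1)[OF that V(2)]] by (simp add: M_def)
  have Mid: "M s0 = mat 1"
  proof -
    have "(\<psi> s0 has_derivative (\<lambda>v. v)) (at x1)"
      by (rule has_derivative_transform_within_open[OF has_derivative_ident V]) (simp add: id)
    then have "(\<lambda>v. D (s0, x1) (0, v)) = (\<lambda>v. v)" using has_derivative_unique Ds(1)[OF T(2) V(2)] by blast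
    then show ?thesis by (simp add: M_def matrix_id_mat_1[unfolded id_def])
  qed
  then have det1: "det (M s0) = 1" by simp
  have "((\<lambda>s. det (M s)) has_real_derivative (\<Sum>i\<in>UNIV. frechet_derivative \<xi> (at x1) (axis i 1) $ i)) (at s0)"
  proof (rule has_real_derivative_det[where M' = "\<lambda>i j. frechet_derivative \<xi> (at x1) (axis j 1) $ i"])
    fix i j
    have "((\<lambda>s. D (s, x1) (0, axis j 1)) has_vector_derivative
        frechet_derivative (\<lambda>z. D z (0, axis j 1)) (at (s0, x1)) (1, 0)) (at s0)"
      using smooth_on_slice(2)[of T V "\<lambda>s x. D (s, x) (0, axis j 1)" s0 x1] smD T V by (simp add: case_prod_unfold)
    also have "frechet_derivative (\<lambda>z. D z (0, axis j 1)) (at (s0, x1)) (1, 0) = frechet_derivative \<xi> (at x1) (axis j 1)"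
      unfolding D\<xi> unfolding D_def by (rule mixed_partial_derivatives[OF \<Psi> TV])
    finally have "((\<lambda>s. D (s, x1) (0, axis j 1) $ i) has_vector_derivative frechet_derivative \<xi> (at x1) (axis j 1) $ i) (at s0)"
      by (rule bounded_linear.has_vector_derivative[OF bounded_linear_vec_nth])
    then show "((\<lambda>s. M s $ i $ j) has_real_derivative frechet_derivative \<xi> (at x1) (axis j 1) $ i) (at s0)"
      by (simp add: M_def matrix_def has_real_derivative_iff_has_vector_derivative)
  qed (rule Mid)
  note det = this
  \<comment> \<open>At s0 the determinant is 1, and near 1 the absolute value is the
    identity.\<close>
  have "((abs :: real \<Rightarrow> real) has_real_derivative 1) (at 1)"
    by (rule has_field_derivative_transform_within_open[OF DERIV_ident, of "{0<..}"]) auto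
  from DERIV_chain2[of abs 1 "\<lambda>s. det (M s)" s0, OF _ det] this det1
  have absdet: "((\<lambda>s. \<bar>det (M s)\<bar>) has_real_derivative (\<Sum>i\<in>UNIV. frechet_derivative \<xi> (at x1) (axis i 1) $ i)) (at s0)"
    by simp
  have "((\<lambda>s. \<sigma> (\<psi> s x1)) has_derivative (\<lambda>h. D\<sigma> (h *\<^sub>R \<xi> x1))) (at s0)"
    using has_derivative_compose[of "\<lambda>s. \<psi> s x1" "\<lambda>h. h *\<^sub>R \<xi> x1" s0 UNIV \<sigma> D\<sigma>] \<sigma> \<xi>[OF V(2)] id[OF V(2)]
    by (simp add: has_vector_derivative_def)
  then have "((\<lambda>s. \<sigma> (\<psi> s x1)) has_real_derivative D\<sigma> (\<xi> x1)) (at s0)"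
    using linear_scale[OF has_derivative_linear[OF \<sigma>]] by (simp add: has_field_derivative_def mult_commute_abs)
  from DERIV_mult[OF this absdet]
  have "((\<lambda>s. \<sigma> (\<psi> s x1) * \<bar>det (M s)\<bar>) has_real_derivative
     D\<sigma> (\<xi> x1) + \<sigma> x1 * (\<Sum>i\<in>UNIV. frechet_derivative \<xi> (at x1) (axis i 1) $ i)) (at s0)"
    using det1 id[OF V(2)] by (simp add: algebra_simps)
  then show ?thesis
    by (rule has_field_derivative_transform_within_open[OF _ T]) (simp add: M)
qed

section \<open>Densities in charts\<close>

lemma det_matrix_nonzero_of_left_inverse:
  fixes f g :: "real ^ 'n \<Rightarrow> real ^ 'n"
  assumes "linear f" "linear g" "\<And>v. g (f v) = v"
  shows "det (matrix f) \<noteq> 0"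
proof -
  have "matrix (g \<circ> f) = matrix g ** matrix f" by (rule matrix_compose[OF assms(1,2)])
  moreover have "g \<circ> f = id" using assms(3) by (simp add: fun_eq_iff)
  ultimately have "det (matrix g) * det (matrix f) = 1"
    by (metis det_I det_mul matrix_id_mat_1 matrix_id)
  then show ?thesis by auto
qed

lemma sum_apply_fun: "(\<Sum>i\<in>I. f i) c = (\<Sum>i\<in>I. f i c)" for f :: "'i \<Rightarrow> 'c \<Rightarrow> 'v::real_vector"
  by (induction I rule: infinite_finite_induct) (auto simp: plus_fun_def zero_fun_def)

locale density_manifold = manifold_atlas A
  for A :: "('m::{t2_space,second_countable_topology}, real ^ 'n::finite) chart set"
begin

abbreviation frame :: "'m \<Rightarrow> ('m, real ^ 'n) chart \<Rightarrow> 'n \<Rightarrow> ('m, 'n) tangent" where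
  "frame q c \<equiv> \<lambda>i. tangent_of A q c (axis i 1)"

lemma linear_jac: "c \<in> A \<Longrightarrow> d \<in> A \<Longrightarrow> q \<in> fst c \<Longrightarrow> q \<in> fst d \<Longrightarrow> linear (jac c d q)"
  by (rule has_derivative_linear[OF transition_has_derivative])

lemma tangent_of_mem: "c \<in> A \<Longrightarrow> q \<in> fst c \<Longrightarrow> tangent_of A q c w \<in> tangent_space A q"
  unfolding tangent_space_def tangent_of_def charts_at_def by (auto simp: jac_compose simp del: split_paired_All)

lemma tangent_of_apply: "d \<in> A \<Longrightarrow> q \<in> fst d \<Longrightarrow> tangent_of A q c w d = jac c d q w"
  by (simp add: tangent_of_def charts_at_def)

lemma tangent_of_self: "c \<in> A \<Longrightarrow> q \<in> fst c \<Longrightarrow> tangent_of A q c w c = w"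
  by (simp add: tangent_of_apply jac_self)

lemma tangent_of_components:
  assumes "c \<in> A" "q \<in> fst c" "v \<in> tangent_space A q"
  shows "tangent_of A q c (v c) = v"
proof
  fix d
  show "tangent_of A q c (v c) d = v d"
  proof (cases "d \<in> charts_at A q")
    case True
    then show ?thesis
      using tangent_space_jac[OF assms(3,1) _ assms(2), of d] by (simp add: tangent_of_def charts_at_def)
  next
    case False
    moreover have "v d = 0" using assms(3) False unfolding tangent_space_def by blast
    ultimately show ?thesis by (simp add: tangent_of_def)
  qed
qed

lemma tangent_of_change:
  "c \<in> A \<Longrightarrow> q \<in> fst c \<Longrightarrow> d \<in> A \<Longrightarrow> q \<in> fst d \<Longrightarrow> tangent_of A q c w = tangent_of A q d (jac c d q w)"
  using tangent_of_components[of d q "tangent_of A q c w"] by (simp add: tangent_of_mem tangent_of_apply)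

lemma linear_tangent_of:
  assumes "c \<in> A" "q \<in> fst c"
  shows "linear (tangent_of A q c)"
proof (rule linearI)
  show "tangent_of A q c (x + y) = tangent_of A q c x + tangent_of A q c y" for x y
    using linear_add[OF linear_jac[OF assms(1) _ assms(2)]]
    by (auto simp: tangent_of_def fun_eq_iff plus_fun_def charts_at_def)
  show "tangent_of A q c (r *\<^sub>R x) = r *\<^sub>R tangent_of A q c x" for r x
    using linear_scale[OF linear_jac[OF assms(1) _ assms(2)]]
    by (auto simp: tangent_of_def fun_eq_iff scaleR_fun_def charts_at_def)
qed

lemma basis_tuple_frame:
  assumes "c \<in> A" "q \<in> fst c"
  shows "basis_tuple (tangent_space A q) (frame q c)" "independent_tuple (frame q c)"
proof -
  have inj: "inj (tangent_of A q c)" by (rule injI) (metis assms tangent_of_self)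
  have "range (\<lambda>i::'n. axis i (1::real)) = Basis" by (auto simp: Basis_vec_def)
  then have rng: "range (frame q c) = tangent_of A q c ` Basis" by (metis image_image)
  have "inj (frame q c)" using inj by (auto intro!: injI dest!: injD simp: axis_eq_axis)
  moreover have "independent (range (frame q c))"
    unfolding rng
    by (rule linear_independent_injective_image[OF linear_tangent_of[OF assms] independent_Basis])
      (rule inj_on_subset[OF inj], simp)
  ultimately show 1: "independent_tuple (frame q c)" by (simp add: independent_tuple_def)
  have "span (range (frame q c)) = range (tangent_of A q c)"
    unfolding rng span_linear_image[OF linear_tangent_of[OF assms]] by simp
  also have "\<dots> = tangent_space A q"
  proof
    show "range (tangent_of A q c) \<subseteq> tangent_space A q" using tangent_of_mem[OF assms] by blast
    show "tangent_space A q \<subseteq> range (tangent_of A q c)" using tangent_of_components[OF assms] by (metis rangeI subsetI)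
  qed
  finally show "basis_tuple (tangent_space A q) (frame q c)" using 1 by (simp add: basis_tuple_def)
qed

text \<open>\<open>endo_det\<close> uses an unspecified basis b. If the columns of B are the chart
  components of b, then B conjugates the matrix with respect to b into that of L, and the
  determinants agree because B is invertible.\<close>

lemma endo_det_in_chart:
  assumes c: "c \<in> A" "q \<in> fst c" and L: "linear L"
  shows "endo_det TYPE('n) (tangent_space A q) (\<lambda>v. tangent_of A q c (L (v c))) = det (matrix L)"
proof -
  define b where "b = (SOME b :: 'n \<Rightarrow> ('m, 'n) tangent. basis_tuple (tangent_space A q) b)"
  have "basis_tuple (tangent_space A q) b"
    unfolding b_def by (rule someI[of _ "frame q c"]) (rule basis_tuple_frame[OF c])
  then have b: "inj b" "independent (range b)" "span (range b) = tangent_space A q"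
    by (auto simp: basis_tuple_def independent_tuple_def)
  have bT: "b j \<in> tangent_space A q" for j using b(3) span_base[of "b j" "range b"] by auto
  define B :: "real ^ 'n ^ 'n" where "B = (\<chi> i j. b j c $ i)"
  have expand: "w = (\<Sum>i\<in>UNIV. representation (range b) (tangent_of A q c w) (b i) *\<^sub>R b i c)" for w
  proof -
    have "tangent_of A q c w = (\<Sum>v\<in>range b. representation (range b) (tangent_of A q c w) v *\<^sub>R v)"
      using sum_representation_eq[OF b(2) _ _ order_refl, of "tangent_of A q c w"] tangent_of_mem[OF c] b(3) by simp
    also have "\<dots> = (\<Sum>i\<in>UNIV. representation (range b) (tangent_of A q c w) (b i) *\<^sub>R b i)"
      by (simp add: sum.reindex[OF b(1)])
    finally have "tangent_of A q c w c = (\<Sum>i\<in>UNIV. representation (range b) (tangent_of A q c w) (b i) *\<^sub>R b i) c"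
      by simp
    then show ?thesis by (simp add: tangent_of_self[OF c] sum_apply_fun scaleR_fun_def)
  qed
  let ?T = "\<lambda>v. tangent_of A q c (L (v c))"
  have "matrix L ** B = B ** matrix_wrt b ?T"
  proof (rule vec_eq_iff[THEN iffD2], rule allI, rule vec_eq_iff[THEN iffD2], rule allI)
    fix i j
    have "(matrix L ** B) $ i $ j = (matrix L *v (b j c)) $ i"
      by (simp add: matrix_matrix_mult_def matrix_vector_mult_def B_def)
    also have "\<dots> = L (b j c) $ i" by (simp add: fun_cong[OF matrix_vector_mul(2)[OF L]])
    also have "\<dots> = (\<Sum>k\<in>UNIV. representation (range b) (?T (b j)) (b k) *\<^sub>R b k c) $ i" using expand[of "L (b j c)"] by simp
    also have "\<dots> = (B ** matrix_wrt b ?T) $ i $ j"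
      by (simp add: matrix_matrix_mult_def B_def matrix_wrt_def mult.commute)
    finally show "(matrix L ** B) $ i $ j = (B ** matrix_wrt b ?T) $ i $ j" .
  qed
  then have "det (matrix L) * det B = det B * det (matrix_wrt b ?T)" by (metis det_mul)
  moreover have "det B \<noteq> 0"
  proof -
    have "surj ((*v) B)"
    proof (rule surjI)
      fix w
      show "B *v (\<chi> i. representation (range b) (tangent_of A q c w) (b i)) = w"
        by (subst (2) expand[of w]) (simp add: vec_eq_iff matrix_vector_mult_def B_def mult.commute)
    qed
    then have "\<exists>B'. B ** B' = mat 1" by (simp add: matrix_right_invertible_surjective)
    then show ?thesis by (metis det_I det_mul mult_zero_left zero_neq_one)
  qed
  ultimately have "det (matrix_wrt b ?T) = det (matrix L)" by (simp add: mult.commute)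
  then show ?thesis by (simp add: endo_det_def b_def)
qed

text \<open>The defining property of a density is applied to the endomorphism that sends the
  coordinate frame to the given tuple; the tuple may be dependent.\<close>

lemma density_tangent_of:
  assumes c: "c \<in> A" "q \<in> fst c" and \<delta>: "\<delta> \<in> densities (tangent_space A q)"
  shows "\<delta> (\<lambda>i. tangent_of A q c (w i)) = \<bar>det (\<chi> i j. w j $ i)\<bar> * \<delta> (frame q c)"
proof -
  define L where "L x = (\<chi> i j. w j $ i) *v x" for x :: "real ^ 'n"
  have L: "linear L" by (simp add: L_def[abs_def])
  have Lax: "L (axis j 1) = w j" for j
    by (simp add: L_def vec_eq_iff matrix_vector_mult_def axis_def if_distrib cong: if_cong)
  define T where "T v = tangent_of A q c (L (v c))" for v
  note lin = linear_tangent_of[OF c]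
  have "linear_endo (tangent_space A q) T"
    unfolding linear_endo_def
  proof (intro conjI ballI allI)
    show "T x \<in> tangent_space A q" for x by (simp add: T_def tangent_of_mem[OF c])
    show "T (x + y) = T x + T y" for x y
      by (simp only: T_def plus_fun_apply linear_add[OF L] linear_add[OF lin])
    show "T (r *\<^sub>R x) = r *\<^sub>R T x" for r x
    proof -
      have "(r *\<^sub>R x) c = r *\<^sub>R x c" by (simp add: scaleR_fun_def)
      then show ?thesis by (simp only: T_def linear_scale[OF L] linear_scale[OF lin])
    qed
  qed
  moreover have "range (frame q c) \<subseteq> tangent_space A q" using tangent_of_mem[OF c] by blast
  ultimately have "\<delta> (\<lambda>i. T (frame q c i)) = \<bar>endo_det TYPE('n) (tangent_space A q) T\<bar> * \<delta> (frame q c)"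
    using \<delta> unfolding densities_def by blast
  moreover have "T (frame q c i) = tangent_of A q c (w i)" for i by (simp add: T_def tangent_of_self[OF c] Lax)
  moreover have "endo_det TYPE('n) (tangent_space A q) T = det (matrix L)"
    unfolding T_def[abs_def] by (rule endo_det_in_chart[OF c L])
  moreover have "matrix L = (\<chi> i j. w j $ i)" by (simp add: matrix_def Lax)
  ultimately show ?thesis by simp
qed

lemma density_in_chart:
  assumes c: "c \<in> A" "q \<in> fst c" and \<delta>: "\<delta> \<in> densities (tangent_space A q)" and v: "range v \<subseteq> tangent_space A q"
  shows "\<delta> v = \<bar>det (\<chi> i j. v j c $ i)\<bar> * \<delta> (frame q c)"
proof -
  have "v = (\<lambda>i. tangent_of A q c (v i c))" using tangent_of_components[OF c] v by (simp add: fun_eq_iff image_subset_iff)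
  then show ?thesis using density_tangent_of[OF c \<delta>, of "\<lambda>i. v i c"] by simp
qed

section \<open>Differentials, pullbacks and smooth densities in charts\<close>

text \<open>\<open>differential\<close> works in an unspecified chart c0 at p, so the Jacobian from
  c0 to c enters and cancels against the change of the components of v. Continuity keeps F inside
  the domain of d near p.\<close>

lemma differential_in_charts:
  assumes c: "c \<in> A" "p \<in> fst c" and d: "d \<in> A" "F p \<in> fst d" and cont: "isCont F p"
    and der: "((\<lambda>x. snd d (F (chart_inv c x))) has_derivative D) (at (snd c p))"
    and v: "v \<in> tangent_space A p"
  shows "differential A A F p v = tangent_of A (F p) d (D (v c))"
proof -
  define c0 where "c0 = (SOME c. c \<in> charts_at A p)"
  have "c0 \<in> charts_at A p" unfolding c0_def by (rule someI[of _ c]) (use c in \<open>simp add: charts_at_def\<close>)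
  then have c0: "c0 \<in> A" "p \<in> fst c0" by (auto simp: charts_at_def)
  define h where "h x = F (chart_inv c0 x)" for x
  have hp: "h (snd c0 p) = F p" using c0 by (simp add: h_def)
  have conth: "isCont h (snd c0 p)"
    unfolding h_def[abs_def] by (rule isCont_o2[OF isCont_chart_inv]) (use c0 cont in auto)
  have "\<forall>\<^sub>F x in nhds (snd c0 p). h x \<in> fst d"
    using topological_tendstoD[OF _ open_fst[OF d(1)], of h "h (snd c0 p)" "nhds (snd c0 p)"] conth d(2) hp
    unfolding isCont_def tendsto_at_iff_tendsto_nhds[of h] by simp
  then obtain W where W: "open W" "snd c0 p \<in> W" "\<And>x. x \<in> W \<Longrightarrow> h x \<in> fst d" unfolding eventually_nhds by blast
  have "((\<lambda>x. snd d (F (chart_inv c (transition c0 c x)))) has_derivative (\<lambda>w. D (jac c0 c p w))) (at (snd c0 p))"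
    by (rule has_derivative_compose[OF transition_has_derivative[OF c0(1) c(1) c0(2) c(2)]])
      (use der c0 in simp)
  then have "((\<lambda>x. snd d (h x)) has_derivative (\<lambda>w. D (jac c0 c p w))) (at (snd c0 p))"
    by (rule has_derivative_transform_within_open[OF _ open_overlap[OF c0(1) c(1)]])
      (use c0 c in \<open>auto simp: h_def\<close>)
  then have "((\<lambda>x. snd e (h x)) has_derivative (\<lambda>w. jac d e (F p) (D (jac c0 c p w)))) (at (snd c0 p))"
    if "e \<in> A" "F p \<in> fst e" for e
    using has_derivative_change_chart[where h = h, OF d(1) that(1) W] hp that(2) by simp
  from frechet_derivative_at[OF this]
  have "frechet_derivative (\<lambda>x. snd e (h x)) (at (snd c0 p)) (v c0) = jac d e (F p) (D (v c))"
    if "e \<in> A" "F p \<in> fst e" for e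
    using tangent_space_jac[OF v c0(1) c(1) c0(2) c(2)] that by metis
  then show ?thesis
    unfolding differential_def Let_def c0_def[symmetric] tangent_of_def
    by (auto simp: fun_eq_iff charts_at_def o_def h_def)
qed

text \<open>Densities at a point form a line, so the pullback is a multiple of \<mu> p, and the
  factor is a ratio of frame coefficients. The identity includes tuples outside the tangent space,
  where both sides are 0.\<close>

lemma pullback_in_charts:
  assumes c: "c \<in> A" "p \<in> fst c" and d: "d \<in> A" "F p \<in> fst d" and cont: "isCont F p"
    and der: "((\<lambda>x. snd d (F (chart_inv c x))) has_derivative D) (at (snd c p))"
    and \<mu>: "\<And>q. \<mu> q \<in> densities (tangent_space A q)" and pos: "\<mu> p (frame p c) \<noteq> 0"
  shows "pullback A F (scale_density f \<mu>) p v
     = f (F p) * \<mu> (F p) (frame (F p) d) * \<bar>det (matrix D)\<bar> / \<mu> p (frame p c) * \<mu> p v"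
proof (cases "range v \<subseteq> tangent_space A p")
  case True
  have lin: "linear D" using has_derivative_linear[OF der] .
  have "pullback A F (scale_density f \<mu>) p v = f (F p) * \<mu> (F p) (\<lambda>i. differential A A F p (v i))"
    using True by (simp add: pullback_def scale_density_def)
  also have "(\<lambda>i. differential A A F p (v i)) = (\<lambda>i. tangent_of A (F p) d (D (v i c)))"
    using differential_in_charts[OF c d cont der] True by (simp add: fun_eq_iff image_subset_iff)
  also have "\<mu> (F p) \<dots> = \<bar>det (\<chi> i j. D (v j c) $ i)\<bar> * \<mu> (F p) (frame (F p) d)"
    by (rule density_tangent_of[OF d \<mu>])
  also have "(\<chi> i j. D (v j c) $ i) = matrix D ** (\<chi> i j. v j c $ i)"
  proof -
    have "D (v j c) = matrix D *v (v j c)" for j by (simp add: fun_cong[OF matrix_vector_mul(2)[OF lin]])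
    then show ?thesis by (simp add: vec_eq_iff matrix_matrix_mult_def matrix_vector_mult_def)
  qed
  finally show ?thesis
    using density_in_chart[OF c \<mu> True] pos by (simp add: det_mul abs_mult)
next
  case False
  then have "\<mu> p v = 0" using \<mu>[of p] unfolding densities_def by blast
  then show ?thesis using False by (simp add: pullback_def)
qed

text \<open>A bundle chart gives the coefficient in some frame d; passing to the frame of e
  multiplies by the absolute Jacobian determinant, which is smooth because transition Jacobians are
  invertible.\<close>

lemma smooth_density_in_chart:
  assumes \<mu>: "smooth_density A \<mu>" and e: "e \<in> A"
  shows "smooth_on (im e) (\<lambda>x. \<mu> (chart_inv e x) (frame (chart_inv e x) e))"
proof (rule smooth_on_local)
  fix x0 assume x0: "x0 \<in> im e"
  from \<mu> have dens: "\<And>q. \<mu> q \<in> densities (tangent_space A q)"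
    and sm: "smooth_map A (density_bundle_atlas A) (\<lambda>q. (q, \<mu> q))" by (auto simp: smooth_density_def)
  obtain d' T where d': "d' \<in> density_bundle_atlas A" and T: "open T" "x0 \<in> T" "T \<subseteq> im e"
    "(\<lambda>q. (q, \<mu> q)) ` chart_inv e ` T \<subseteq> fst d'" "smooth_on T (snd d' \<circ> (\<lambda>q. (q, \<mu> q)) \<circ> chart_inv e)"
    by (rule smooth_map_in_chart[OF sm e x0], rule that; assumption)
  obtain d where d: "d \<in> A" "d' = ({(q, \<delta>). q \<in> fst d \<and> \<delta> \<in> densities (tangent_space A q)},
       \<lambda>(q, \<delta>). (snd d q, \<delta> (frame q d)))"
    using d' by (auto simp: density_bundle_atlas_def)
  have mem: "chart_inv e x \<in> fst e" "chart_inv e x \<in> fst d" if "x \<in> T" for x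
    using T(3,4) that e d(2) by auto
  have Tsub: "T \<subseteq> snd e ` (fst e \<inter> fst d)" 
  proof
    fix x assume x: "x \<in> T"
    have "snd e (chart_inv e x) = x" using T(3) x e by auto
    then show "x \<in> snd e ` (fst e \<inter> fst d)" using mem[OF x] by (metis IntI imageI)
  qed
  have "smooth_on T (\<lambda>x. snd ((snd d' \<circ> (\<lambda>q. (q, \<mu> q)) \<circ> chart_inv e) x))"
    by (rule smooth_on_bounded_linear[OF bounded_linear_snd T(1,5)])
  then have md: "smooth_on T (\<lambda>x. \<mu> (chart_inv e x) (frame (chart_inv e x) d))" by (simp add: d(2) o_def)
  define J where "J x = matrix (frechet_derivative (transition e d) (at x))" for x
  have Jx: "J x = matrix (jac e d (chart_inv e x))" if "x \<in> T" for x
    using T(3) that e by (auto simp: J_def)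
  have "smooth_on T (\<lambda>x. \<bar>det (J x)\<bar> * \<mu> (chart_inv e x) (frame (chart_inv e x) d))"
  proof (intro smooth_on_mult T(1) md smooth_on_abs smooth_on_det)
    show "smooth_on T (\<lambda>x. J x $ i $ j)" for i j
      unfolding J_def matrix_def
      by (simp, intro smooth_on_bounded_linear[OF bounded_linear_vec_nth] T(1) smooth_on_frechet_derivative
          smooth_on_subset[OF smooth_on_transition[OF e d(1)] Tsub])
    fix x assume x: "x \<in> T"
    show "det (J x) \<noteq> 0"
      unfolding Jx[OF x]
      by (rule det_matrix_nonzero_of_left_inverse[of _ "jac d e (chart_inv e x)"])
        (use mem[OF x] e d(1) in \<open>simp_all add: linear_jac jac_compose jac_self\<close>)
  qed
  then have "smooth_on T (\<lambda>x. \<mu> (chart_inv e x) (frame (chart_inv e x) e))"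
  proof (rule smooth_on_cong[OF T(1), rotated])
    fix x assume x: "x \<in> T"
    define q where "q = chart_inv e x"
    have q: "q \<in> fst e" "q \<in> fst d" using mem[OF x] by (auto simp: q_def)
    have "frame q e = (\<lambda>i. tangent_of A q d (jac e d q (axis i 1)))"
      using tangent_of_change[OF e q(1) d(1) q(2)] by auto
    then have "\<mu> q (frame q e) = \<mu> q (\<lambda>i. tangent_of A q d (jac e d q (axis i 1)))" by (rule arg_cong)
    also have "\<dots> = \<bar>det (\<chi> i j. jac e d q (axis j 1) $ i)\<bar> * \<mu> q (frame q d)"
      by (rule density_tangent_of[OF d(1) q(2) dens])
    finally have "\<mu> q (frame q e) = \<bar>det (\<chi> i j. jac e d q (axis j 1) $ i)\<bar> * \<mu> q (frame q d)" .
    then show "\<bar>det (J x)\<bar> * \<mu> (chart_inv e x) (frame (chart_inv e x) d) = \<mu> (chart_inv e x) (frame (chart_inv e x) e)"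
      unfolding Jx[OF x] q_def by (simp add: matrix_def)
  qed
  then show "\<exists>T. open T \<and> x0 \<in> T \<and> smooth_on T (\<lambda>x. \<mu> (chart_inv e x) (frame (chart_inv e x) e))"
    using T(1,2) by blast
qed

end

section \<open>Directional derivative and divergence in a chart\<close>

context manifold_atlas
begin

lemma directional_in_chart:
  assumes c: "c \<in> A" "q \<in> fst c" and Y: "Y q \<in> tangent_space A q"
    and der: "((\<lambda>x. f (chart_inv c x)) has_derivative D) (at (snd c q))"
  shows "directional A Y f q = D (Y q c)"
proof -
  define c0 where "c0 = (SOME c. c \<in> charts_at A q)"
  have "c0 \<in> charts_at A q" unfolding c0_def by (rule someI[of _ c]) (use c in \<open>simp add: charts_at_def\<close>)
  then have c0: "c0 \<in> A" "q \<in> fst c0" by (auto simp: charts_at_def)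
  have "((\<lambda>x. f (chart_inv c (transition c0 c x))) has_derivative (\<lambda>w. D (jac c0 c q w))) (at (snd c0 q))"
    by (rule has_derivative_compose[OF transition_has_derivative[OF c0(1) c(1) c0(2) c(2)]])
      (use der c0 in simp)
  then have "((\<lambda>x. f (chart_inv c0 x)) has_derivative (\<lambda>w. D (jac c0 c q w))) (at (snd c0 q))"
    by (rule has_derivative_transform_within_open[OF _ open_overlap[OF c0(1) c(1)]])
      (use c0 c in auto)
  from frechet_derivative_at[OF this]
  have "frechet_derivative (\<lambda>x. f (chart_inv c0 x)) (at (snd c0 q)) (Y q c0) = D (Y q c)"
    using tangent_space_jac[OF Y c0(1) c(1) c0(2) c(2)] by metis
  then show ?thesis by (simp add: directional_def Let_def c0_def[symmetric] o_def)
qed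

lemma smooth_components_frozen:
  assumes X: "smooth_components X"
  shows "smooth_components (\<lambda>_. X t)"
  unfolding smooth_components_def
proof (intro conjI allI ballI)
  show "X t q \<in> tangent_space A q" for q using X by (simp add: smooth_components_def)
  fix c assume c: "c \<in> A"
  have o: "open ((UNIV :: real set) \<times> im c)" using open_im[OF c] by (simp add: open_Times)
  have "smooth_on (UNIV \<times> im c) (\<lambda>p :: real \<times> 'e. (t, snd p))"
    by (intro smooth_on_Pair o smooth_on_const smooth_on_linear[OF bounded_linear_snd])
  moreover have "smooth_on (UNIV \<times> im c) (\<lambda>(t, x). X t (chart_inv c x) c)"
    using X c by (simp add: smooth_components_def)
  moreover have "(\<lambda>p :: real \<times> 'e. (t, snd p)) ` (UNIV \<times> im c) \<subseteq> UNIV \<times> im c" by auto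
  ultimately have "smooth_on (UNIV \<times> im c) (\<lambda>p :: real \<times> 'e. (\<lambda>(t, x). X t (chart_inv c x) c) (t, snd p))"
    by (rule smooth_on_compose[OF o o])
  then show "smooth_on (UNIV \<times> im c) (\<lambda>(t' :: real, x). X t (chart_inv c x) c)" by (simp add: case_prod_unfold)
qed

end

context density_manifold
begin

abbreviation dens :: "('m, 'n) density \<Rightarrow> ('m, real ^ 'n) chart \<Rightarrow> real ^ 'n \<Rightarrow> real" where
  "dens \<mu> c x \<equiv> \<mu> (chart_inv c x) (frame (chart_inv c x) c)"

lemma positive_density_frame:
  assumes "positive_density A \<mu>" "c \<in> A" "q \<in> fst c"
  shows "\<mu> q (frame q c) > 0"
proof -
  have "range (frame q c) \<subseteq> tangent_space A q" using tangent_of_mem[OF assms(2,3)] by auto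
  with basis_tuple_frame(2)[OF assms(2,3)] assms(1) show ?thesis unfolding positive_density_def by simp
qed

text \<open>One frame at each point determines the factor. This is the uniqueness behind both the
  definite description of the divergence and that of \<rho>.\<close>

lemma scale_density_cancel:
  assumes pos: "positive_density A \<mu>" and eq: "scale_density f \<mu> = scale_density g \<mu>"
  shows "f = g"
proof
  fix q
  obtain c where c: "c \<in> A" "q \<in> fst c" using ex_chart by blast
  have "f q * \<mu> q (frame q c) = g q * \<mu> q (frame q c)"
    using fun_cong[OF fun_cong[OF eq, of q], of "frame q c"] by (simp add: scale_density_def)
  then show "f q = g q" using positive_density_frame[OF pos c] by simp
qed

text \<open>With m the coefficient of \<mu>, the right-hand side is the Euclidean divergence of m
  \<xi>. That \<open>divergence\<close> describes anything at all is part of the proof: Liouville's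
  formula exhibits a factor, and positivity makes it unique.\<close>

lemma divergence_in_chart:
  assumes \<mu>: "smooth_density A \<mu>" and pos: "positive_density A \<mu>"
    and Y: "smooth_components (\<lambda>_. Y)" and c0: "c0 \<in> A" "q0 \<in> fst c0"
  defines "\<xi> \<equiv> \<lambda>c x. Y (chart_inv c x) c"
  shows "divergence A \<mu> Y q0 * \<mu> q0 (frame q0 c0) =
    frechet_derivative (dens \<mu> c0) (at (snd c0 q0)) (Y q0 c0)
    + \<mu> q0 (frame q0 c0) * (\<Sum>i\<in>UNIV. frechet_derivative (\<xi> c0) (at (snd c0 q0)) (axis i 1) $ i)"
proof -
  have den: "\<And>q. \<mu> q \<in> densities (tangent_space A q)" using \<mu> by (simp add: smooth_density_def)
  define k where "k c q = (frechet_derivative (dens \<mu> c) (at (snd c q)) (Y q c)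
    + \<mu> q (frame q c) * (\<Sum>i\<in>UNIV. frechet_derivative (\<xi> c) (at (snd c q)) (axis i 1) $ i)) / \<mu> q (frame q c)" for c q
  have lie: "lie_derivative A Y \<mu> q v = k c q * \<mu> q v" if c: "c \<in> A" "q \<in> fst c" for c q v
  proof -
    obtain e V \<phi> where e: "e > 0" and V: "open V" "snd c q \<in> V" "V \<subseteq> im c"
      and \<phi>: "smooth_on ({0-e<..<0+e} \<times> {0-e<..<0+e} \<times> V) (\<lambda>(\<tau>, t, x). \<phi> \<tau> t x)"
      "\<And>t x. t \<in> {0-e<..<0+e} \<Longrightarrow> x \<in> V \<Longrightarrow> \<phi> t t x = x"
      "\<And>\<tau> t x. \<tau> \<in> {0-e<..<0+e} \<Longrightarrow> t \<in> {0-e<..<0+e} \<Longrightarrow> x \<in> V \<Longrightarrow>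
         \<phi> \<tau> t x \<in> im c \<and> td_flow A (\<lambda>_. Y) \<tau> t (chart_inv c x) = chart_inv c (\<phi> \<tau> t x) \<and>
         ((\<lambda>\<tau>. \<phi> \<tau> t x) has_vector_derivative Y (chart_inv c (\<phi> \<tau> t x)) c) (at \<tau>)"
      by (rule local_flow_in_chart[OF Y c, of 0]) blast
    define I where "I = {-e<..<e}"
    define x1 where "x1 = snd c q"
    define \<psi> where "\<psi> s x = \<phi> s 0 x" for s x
    have I: "open I" "0 \<in> I" using e by (auto simp: I_def)
    have IV: "open (I \<times> V)" using I V by (simp add: open_Times)
    have x1: "x1 \<in> V" "x1 \<in> im c" "chart_inv c x1 = q" using V c by (auto simp: x1_def)
    have "smooth_on (I \<times> V) (\<lambda>p. (fst p, 0 :: real, snd p))"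
      by (intro smooth_on_Pair IV smooth_on_const smooth_on_linear bounded_linear_fst bounded_linear_snd)
    moreover have "(\<lambda>p. (fst p, 0, snd p)) ` (I \<times> V) \<subseteq> {0-e<..<0+e} \<times> {0-e<..<0+e} \<times> V"
      using e by (auto simp: I_def)
    ultimately have "smooth_on (I \<times> V) (\<lambda>p. \<phi> (fst p) 0 (snd p))"
      using smooth_on_compose[OF IV _ _ \<phi>(1), of "\<lambda>p. (fst p, 0, snd p)"] V(1)
      by (simp add: open_Times case_prod_unfold)
    then have \<psi>: "smooth_on (I \<times> V) (\<lambda>(s, x). \<psi> s x)" by (simp add: \<psi>_def case_prod_unfold)
    have flow: "\<psi> s x \<in> im c" "local_flow A Y s (chart_inv c x) = chart_inv c (\<psi> s x)" if "s \<in> I" "x \<in> V" for s x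
      using \<phi>(3)[of s 0 x] that e by (auto simp: I_def \<psi>_def local_flow_def)
    have \<psi>0: "\<psi> 0 x = x" if "x \<in> V" for x using \<phi>(2)[of 0 x] that e by (simp add: \<psi>_def)
    have vel: "((\<lambda>s. \<psi> s x) has_vector_derivative \<xi> c x) (at 0)" if "x \<in> V" for x
      using \<phi>(3)[of 0 0 x] \<phi>(2)[of 0 x] that e by (simp add: \<psi>_def \<xi>_def)
    have dm: "(dens \<mu> c has_derivative frechet_derivative (dens \<mu> c) (at x1)) (at x1)"
      by (rule smooth_on_has_derivative[OF smooth_density_in_chart[OF \<mu> c(1)] x1(2)])
    note K = has_real_derivative_pullback_volume[OF \<psi> I V(1) x1(1) \<psi>0 vel dm]
    have pb: "pullback A (local_flow A Y s) \<mu> q v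
       = dens \<mu> c (\<psi> s x1) * \<bar>det (matrix (frechet_derivative (\<psi> s) (at x1)))\<bar> / \<mu> q (frame q c) * \<mu> q v" if s: "s \<in> I" for s
    proof -
      define F where "F = local_flow A Y s"
      have Fq: "F q = chart_inv c (\<psi> s x1)" using flow(2)[OF s x1(1)] x1(3) by (simp add: F_def)
      note der = smooth_on_slice(1)[OF \<psi> s x1(1)]
      have D: "(\<psi> s has_derivative frechet_derivative (\<psi> s) (at x1)) (at x1)"
        using der frechet_derivative_at[OF der] by simp
      \<comment> \<open>\<open>local_flow\<close> is known only through its chart expression near q,
        so continuity is transferred from that expression.\<close>
      have cont: "isCont F q"
      proof -
        have "isCont (\<lambda>p. chart_inv c (\<psi> s (snd c p))) q"
          by (intro isCont_o2[OF isCont_snd[OF c] isCont_o2[OF _ isCont_chart_inv[OF c(1)]]])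
            (use has_derivative_continuous[OF D] flow(1)[OF s x1(1)] in \<open>auto simp: x1_def\<close>)
        moreover have "\<forall>\<^sub>F p in nhds q. chart_inv c (\<psi> s (snd c p)) = F p"
        proof -
          have "\<forall>\<^sub>F p in nhds q. snd c p \<in> V"
            using topological_tendstoD[OF _ V(1,2), of "snd c" "nhds q"] isCont_snd[OF c]
            unfolding isCont_def tendsto_at_iff_tendsto_nhds by blast
          moreover have "\<forall>\<^sub>F p in nhds q. p \<in> fst c" using eventually_nhds_in_open[OF open_fst[OF c(1)] c(2)] .
          ultimately show ?thesis
          proof eventually_elim
            case (elim p)
            then show ?case using flow(2)[OF s elim(1)] c(1) by (simp add: F_def)
          qed
        qed
        ultimately show ?thesis using isCont_cong[of "\<lambda>p. chart_inv c (\<psi> s (snd c p))" F q] by blast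
      qed
      have "((\<lambda>x. snd c (F (chart_inv c x))) has_derivative frechet_derivative (\<psi> s) (at x1)) (at (snd c q))"
        unfolding x1_def[symmetric]
        by (rule has_derivative_transform_within_open[OF D V(1) x1(1)])
          (use flow[OF s] c(1) in \<open>simp add: F_def del: image_eqI\<close>)
      moreover have "F q \<in> fst c" using flow(1)[OF s x1(1)] c(1) by (simp add: Fq)
      ultimately have "pullback A F (scale_density (\<lambda>_. 1) \<mu>) q v
         = 1 * \<mu> (F q) (frame (F q) c) * \<bar>det (matrix (frechet_derivative (\<psi> s) (at x1)))\<bar> / \<mu> q (frame q c) * \<mu> q v"
        using positive_density_frame[OF pos c] by (intro pullback_in_charts[OF c c(1) _ cont _ den]) auto
      then show ?thesis unfolding F_def[symmetric] by (simp add: scale_density_def Fq)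
    qed
    have "((\<lambda>s. dens \<mu> c (\<psi> s x1) * \<bar>det (matrix (frechet_derivative (\<psi> s) (at x1)))\<bar> / \<mu> q (frame q c) * \<mu> q v)
       has_real_derivative k c q * \<mu> q v) (at 0)"
      using DERIV_cmult_right[OF DERIV_cdivide[OF K, of "\<mu> q (frame q c)"], of "\<mu> q v"]
      unfolding k_def x1(3) \<xi>_def x1_def[symmetric] by simp
    then have "((\<lambda>s. pullback A (local_flow A Y s) \<mu> q v) has_real_derivative k c q * \<mu> q v) (at 0)"
      by (rule has_field_derivative_transform_within_open[OF _ I]) (simp add: pb)
    then show ?thesis unfolding lie_derivative_def by (rule DERIV_imp_deriv)
  qed
  \<comment> \<open>A global factor arises by selecting a chart at every point; as
    \<open>lie\<close> holds in every chart, the selection does not affect the value obtained in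
    c0.\<close>
  define f where "f q = k (SOME c. c \<in> A \<and> q \<in> fst c) q" for q
  have "lie_derivative A Y \<mu> = scale_density f \<mu>"
  proof (intro ext)
    fix q v
    have "\<exists>c. c \<in> A \<and> q \<in> fst c" using ex_chart by blast
    from someI_ex[OF this] show "lie_derivative A Y \<mu> q v = scale_density f \<mu> q v"
      using lie by (simp add: scale_density_def f_def)
  qed
  then have "divergence A \<mu> Y = f"
    unfolding divergence_def by (intro the_equality) (auto intro: scale_density_cancel[OF pos])
  then have "divergence A \<mu> Y q0 * \<mu> q0 (frame q0 c0) = k c0 q0 * \<mu> q0 (frame q0 c0)"
    using fun_cong[OF fun_cong[OF \<open>lie_derivative A Y \<mu> = scale_density f \<mu>\<close>, of q0], of "frame q0 c0"] lie[OF c0]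
    by (auto simp: scale_density_def)
  then show ?thesis using positive_density_frame[OF pos c0] by (simp add: k_def)
qed

section \<open>Transport of a density by the flow\<close>

definition flow_coords :: "(real \<Rightarrow> 'm \<Rightarrow> ('m, 'n) tangent) \<Rightarrow> real \<Rightarrow> ('m, real ^ 'n) chart \<Rightarrow>
    ('m, real ^ 'n) chart \<Rightarrow> real \<times> (real ^ 'n) \<Rightarrow> real ^ 'n" where
  "flow_coords X \<tau> c d p = snd d (td_flow A X \<tau> (fst p) (chart_inv c (snd p)))"

definition flow_dom :: "(real \<Rightarrow> 'm \<Rightarrow> ('m, 'n) tangent) \<Rightarrow> real \<Rightarrow> ('m, real ^ 'n) chart \<Rightarrow>
    ('m, real ^ 'n) chart \<Rightarrow> (real \<times> (real ^ 'n)) set" where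
  "flow_dom X \<tau> c d = (UNIV \<times> im c) \<inter> (\<lambda>p. td_flow A X \<tau> (fst p) (chart_inv c (snd p))) -` fst d"

text \<open>The third claim is the delicate one: an absolute value is smooth only away from 0, and
  the Jacobian is invertible because the flow back to the initial time is a left inverse.\<close>

lemma flow_in_charts:
  fixes \<tau> :: real
  assumes X: "smooth_components X" and complete: "complete_td_vector_field A X" and c: "c \<in> A" and d: "d \<in> A"
  shows "open (flow_dom X \<tau> c d)" "smooth_on (flow_dom X \<tau> c d) (flow_coords X \<tau> c d)"
    "smooth_on (flow_dom X \<tau> c d) (\<lambda>p. \<bar>det (matrix (\<lambda>v. frechet_derivative (flow_coords X \<tau> c d) (at p) (0, v)))\<bar>)"
    "p \<in> flow_dom X \<tau> c d \<Longrightarrow> ((\<lambda>x. flow_coords X \<tau> c d (fst p, x)) has_derivative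
       (\<lambda>v. frechet_derivative (flow_coords X \<tau> c d) (at p) (0, v))) (at (snd p))"
    "p \<in> flow_dom X \<tau> c d \<Longrightarrow> isCont (td_flow A X \<tau> (fst p)) (chart_inv c (snd p))"
proof -
  define F where "F p = td_flow A X \<tau> (fst p) (chart_inv c (snd p))" for p
  define H where "H = flow_coords X \<tau> c d"
  define S where "S = flow_dom X \<tau> c d"
  have H_def': "H = (\<lambda>p. snd d (F p))" by (simp add: H_def F_def flow_coords_def fun_eq_iff)
  have S_def': "S = (UNIV \<times> im c) \<inter> F -` fst d" by (simp add: S_def F_def[abs_def] flow_dom_def)
  note folds = H_def[symmetric] S_def[symmetric]
  have sm: "smooth_into (UNIV \<times> im c) (\<lambda>p. td_flow A X \<tau> (fst p) (chart_inv c (snd p)))"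
    if "c \<in> A" for c \<tau> using smooth_into_td_flow[OF X complete that] .
  have S: "open S" unfolding S_def' F_def[abs_def] by (rule smooth_into_open[OF sm[OF c] d])
  have H: "smooth_on S H"
    using sm[OF c] d by (simp add: smooth_into_def S_def' H_def' F_def[abs_def])
  have slice: "((\<lambda>x. H (fst p, x)) has_derivative (\<lambda>v. frechet_derivative H (at p) (0, v))) (at (snd p))"
    if p: "p \<in> S" for p
  proof -
    have "((\<lambda>x. (fst p, x)) has_derivative (\<lambda>v. (0, v))) (at (snd p))" by (auto intro!: derivative_eq_intros)
    from has_derivative_compose[OF this, of H] show ?thesis using smooth_on_has_derivative[OF H p] by simp
  qed
  show "open (flow_dom X \<tau> c d)" "smooth_on (flow_dom X \<tau> c d) (flow_coords X \<tau> c d)"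
    unfolding folds by (rule S, rule H)
  show "p \<in> flow_dom X \<tau> c d \<Longrightarrow> ((\<lambda>x. flow_coords X \<tau> c d (fst p, x)) has_derivative
       (\<lambda>v. frechet_derivative (flow_coords X \<tau> c d) (at p) (0, v))) (at (snd p))"
    unfolding folds by (rule slice)
  show "isCont (td_flow A X \<tau> (fst p)) (chart_inv c (snd p))" if "p \<in> flow_dom X \<tau> c d"
  proof -
    have p: "p \<in> S" using that by (simp add: S_def)
    define q where "q = chart_inv c (snd p)"
    have q: "q \<in> fst c" "snd c q = snd p" using p c by (auto simp: q_def S_def')
    have "isCont (\<lambda>p. td_flow A X \<tau> (fst p) (chart_inv c (snd p))) (fst p, snd c q)"
    proof -
      have "continuous_on (UNIV \<times> im c) (\<lambda>p. td_flow A X \<tau> (fst p) (chart_inv c (snd p)))" "open ((UNIV :: real set) \<times> im c)"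
        using sm[OF c] by (auto simp: smooth_into_def)
      moreover have "(fst p, snd c q) \<in> UNIV \<times> im c" using q(1) by simp
      ultimately show ?thesis using continuous_on_eq_continuous_at by blast
    qed
    moreover have "isCont (\<lambda>q'. (fst p, snd c q')) q" by (intro continuous_intros isCont_snd[OF c q(1)])
    ultimately have "isCont (\<lambda>q'. td_flow A X \<tau> (fst p) (chart_inv c (snd c q'))) q"
      using isCont_o2[of q "\<lambda>q'. (fst p, snd c q')"] by force
    moreover have "\<forall>\<^sub>F q' in nhds q. td_flow A X \<tau> (fst p) (chart_inv c (snd c q')) = td_flow A X \<tau> (fst p) q'"
      using eventually_nhds_in_open[OF open_fst[OF c] q(1)] by eventually_elim (simp add: c)
    ultimately show ?thesis
      unfolding q_def[symmetric]
      using isCont_cong[of "\<lambda>q'. td_flow A X \<tau> (fst p) (chart_inv c (snd c q'))" "td_flow A X \<tau> (fst p)" q] by blast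
  qed
  show "smooth_on (flow_dom X \<tau> c d) (\<lambda>p. \<bar>det (matrix (\<lambda>v. frechet_derivative (flow_coords X \<tau> c d) (at p) (0, v)))\<bar>)"
    unfolding folds
  proof (rule smooth_on_abs[OF S smooth_on_det[OF S]])
    show "smooth_on S (\<lambda>p. matrix (\<lambda>v. frechet_derivative H (at p) (0, v)) $ i $ j)" for i j
      unfolding matrix_def
      by (simp, intro smooth_on_bounded_linear[OF bounded_linear_vec_nth S] smooth_on_frechet_derivative H)
    fix p assume p: "p \<in> S"
    define t where "t = fst p"
    define q where "q = chart_inv c (snd p)"
    have q: "q \<in> fst c" "snd c q = snd p" using p c by (auto simp: q_def S_def')
    define q' where "q' = td_flow A X \<tau> t q"
    have q': "q' \<in> fst d" using p by (simp add: q'_def S_def' F_def t_def q_def)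
    have ret: "td_flow A X t \<tau> q' = q" by (simp add: q'_def complete_flow[OF X complete])
    \<comment> \<open>The flow from \<tau> back to t in coordinates, differentiable at the image
      point by the same smoothness result with the two times exchanged.\<close>
    define G where "G x = snd c (td_flow A X t \<tau> (chart_inv d x))" for x
    define S' where "S' = (UNIV \<times> im d) \<inter> (\<lambda>p. td_flow A X t (fst p) (chart_inv d (snd p))) -` fst c"
    have S': "open S'" unfolding S'_def by (rule smooth_into_open[OF sm[OF d] c])
    have smG: "smooth_on S' (\<lambda>p. snd c (td_flow A X t (fst p) (chart_inv d (snd p))))"
      using sm[OF d] c by (auto simp: smooth_into_def S'_def)
    have pS': "(\<tau>, snd d q') \<in> S'" using q' d q(1) by (simp add: S'_def ret)
    have "((\<lambda>x. (\<tau>, x)) has_derivative (\<lambda>v. (0, v))) (at (snd d q'))" by (auto intro!: derivative_eq_intros)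
    from has_derivative_compose[OF this smooth_on_has_derivative[OF smG pS']]
    obtain D' where D': "(G has_derivative D') (at (snd d q'))" by (auto simp: G_def[abs_def])
    have Hp: "H (t, snd p) = snd d q'" by (simp add: H_def' F_def q'_def q_def)
    note Dp = slice[OF p]
    have "((\<lambda>x. G (H (t, x))) has_derivative (\<lambda>v. D' (frechet_derivative H (at p) (0, v)))) (at (snd p))"
      by (rule has_derivative_compose[OF Dp[folded t_def]]) (simp add: Hp D')
    moreover have "((\<lambda>x. G (H (t, x))) has_derivative (\<lambda>v. v)) (at (snd p))"
    proof (rule has_derivative_transform_within_open[OF has_derivative_ident])
      show "open (Pair t -` S)" by (rule open_vimage[OF S]) (intro continuous_intros)
      show "snd p \<in> Pair t -` S" using p by (simp add: t_def)
      show "x = G (H (t, x))" if "x \<in> Pair t -` S" for x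
        using that c d by (auto simp: G_def H_def' F_def S_def' complete_flow[OF X complete])
    qed
    ultimately have "(\<lambda>v. D' (frechet_derivative H (at p) (0, v))) = (\<lambda>v. v)" by (rule has_derivative_unique)
    then show "det (matrix (\<lambda>v. frechet_derivative H (at p) (0, v))) \<noteq> 0"
      using has_derivative_linear[OF Dp] has_derivative_linear[OF D']
      by (intro det_matrix_nonzero_of_left_inverse[of _ D']) (auto simp: fun_eq_iff)
  qed
qed

theorem transported_density:
  assumes \<mu>: "smooth_density A \<mu>" and pos: "positive_density A \<mu>"
    and X: "smooth_components X" and complete: "complete_td_vector_field A X" and \<rho>0: "smooth_fun A \<rho>0"
  shows "\<exists>!\<rho> :: 'm \<times> real \<Rightarrow> real.
      \<forall>t. scale_density (\<lambda>q. \<rho> (q, t)) \<mu> = pullback A (td_flow A X 0 t) (scale_density \<rho>0 \<mu>)"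
    and "(\<And>t. scale_density (\<lambda>q. \<rho> (q, t)) \<mu> = pullback A (td_flow A X 0 t) (scale_density \<rho>0 \<mu>)) \<Longrightarrow>
      smooth_fun (prod_atlas A real_atlas) \<rho>"
    and "(\<And>t. scale_density (\<lambda>q. \<rho> (q, t)) \<mu> = pullback A (td_flow A X 0 t) (scale_density \<rho>0 \<mu>)) \<Longrightarrow>
      directional A (X t) (\<lambda>p. \<rho> (p, t)) q + \<rho> (q, t) * divergence A \<mu> (X t) q = - deriv (\<lambda>s. \<rho> (q, s)) t"
proof -
  have den: "\<And>q. \<mu> q \<in> densities (tangent_space A q)" using \<mu> by (simp add: smooth_density_def)
  note flow = complete_flow[OF X complete]
  define F where "F c p = td_flow A X 0 (fst p) (chart_inv c (snd p))" for c and p :: "real \<times> (real ^ 'n)"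
  define H where "H = flow_coords X 0"
  define S where "S = flow_dom X 0"
  have H_def': "H c d p = snd d (F c p)" for c d p by (simp add: H_def F_def flow_coords_def)
  have S_def': "S c d = (UNIV \<times> im c) \<inter> F c -` fst d" for c d by (simp add: S_def F_def[abs_def] flow_dom_def)
  define k where "k c d p = \<rho>0 (F c p) * \<mu> (F c p) (frame (F c p) d) *
     \<bar>det (matrix (\<lambda>v. frechet_derivative (H c d) (at p) (0, v)))\<bar> / dens \<mu> c (snd p)" for c d p
  have fic: "open (S c d)" "smooth_on (S c d) (H c d)"
    "smooth_on (S c d) (\<lambda>p. \<bar>det (matrix (\<lambda>v. frechet_derivative (H c d) (at p) (0, v)))\<bar>)"
    "p \<in> S c d \<Longrightarrow> ((\<lambda>x. H c d (fst p, x)) has_derivative (\<lambda>v. frechet_derivative (H c d) (at p) (0, v))) (at (snd p))"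
    "p \<in> S c d \<Longrightarrow> isCont (td_flow A X 0 (fst p)) (chart_inv c (snd p))"
    if "c \<in> A" "d \<in> A" for c d p
    unfolding H_def S_def by (rule flow_in_charts[OF X complete that]; assumption)+
  have pull: "pullback A (td_flow A X 0 t) (scale_density \<rho>0 \<mu>) q v = k c d (t, snd c q) * \<mu> q v"
    if c: "c \<in> A" "q \<in> fst c" and d: "d \<in> A" "td_flow A X 0 t q \<in> fst d" for c d q t v
  proof -
    have p: "(t, snd c q) \<in> S c d" using c d by (simp add: S_def' F_def)
    have "pullback A (td_flow A X 0 t) (scale_density \<rho>0 \<mu>) q v = \<rho>0 (td_flow A X 0 t q) *
        \<mu> (td_flow A X 0 t q) (frame (td_flow A X 0 t q) d) *
        \<bar>det (matrix (\<lambda>v. frechet_derivative (H c d) (at (t, snd c q)) (0, v)))\<bar> / \<mu> q (frame q c) * \<mu> q v"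
      by (rule pullback_in_charts[where F = "td_flow A X 0 t", OF c d _ _ den])
        (use fic(4,5)[OF c(1) d(1) p] positive_density_frame[OF pos c] c in \<open>auto simp: H_def' F_def\<close>)
    then show ?thesis using c by (simp add: k_def F_def)
  qed
  have ex: "\<exists>K. \<forall>v. pullback A (td_flow A X 0 t) (scale_density \<rho>0 \<mu>) q v = K * \<mu> q v" for q t
  proof -
    obtain c where c: "c \<in> A" "q \<in> fst c" using ex_chart by blast
    obtain d where d: "d \<in> A" "td_flow A X 0 t q \<in> fst d" using ex_chart by blast
    show ?thesis using pull[OF c d] by blast
  qed
  \<comment> \<open>The charts c and d vary with q and t, so the factor is selected through an
    equation that mentions no chart.\<close>
  define K where "K q t = (SOME K. \<forall>v. pullback A (td_flow A X 0 t) (scale_density \<rho>0 \<mu>) q v = K * \<mu> q v)" for q t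
  have K: "pullback A (td_flow A X 0 t) (scale_density \<rho>0 \<mu>) q v = K q t * \<mu> q v" for q t v
    using someI_ex[OF ex[of t q]] unfolding K_def by (rule spec)
  show "\<exists>!\<rho> :: 'm \<times> real \<Rightarrow> real.
      \<forall>t. scale_density (\<lambda>q. \<rho> (q, t)) \<mu> = pullback A (td_flow A X 0 t) (scale_density \<rho>0 \<mu>)"
  proof (rule ex1I)
    show "\<forall>t. scale_density (\<lambda>q. (\<lambda>(q, t). K q t) (q, t)) \<mu> = pullback A (td_flow A X 0 t) (scale_density \<rho>0 \<mu>)"
      by (simp add: fun_eq_iff K) (simp add: scale_density_def)
    fix \<rho> :: "'m \<times> real \<Rightarrow> real"
    assume *: "\<forall>t. scale_density (\<lambda>q. \<rho> (q, t)) \<mu> = pullback A (td_flow A X 0 t) (scale_density \<rho>0 \<mu>)"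
    have "scale_density (\<lambda>q. \<rho> (q, t)) \<mu> = scale_density (\<lambda>q. K q t) \<mu>" for t
      unfolding spec[OF *, of t] by (simp add: fun_eq_iff K) (simp add: scale_density_def)
    then have "(\<lambda>q. \<rho> (q, t)) = (\<lambda>q. K q t)" for t by (rule scale_density_cancel[OF pos])
    then show "\<rho> = (\<lambda>(q, t). K q t)" by (auto simp: fun_eq_iff)
  qed
  fix \<rho> :: "'m \<times> real \<Rightarrow> real"
  assume \<rho>: "\<And>t. scale_density (\<lambda>q. \<rho> (q, t)) \<mu> = pullback A (td_flow A X 0 t) (scale_density \<rho>0 \<mu>)"
  have \<rho>k: "\<rho> (q, t) = k c d (t, snd c q)"
    if c: "c \<in> A" "q \<in> fst c" and d: "d \<in> A" "td_flow A X 0 t q \<in> fst d" for c d q t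
    using fun_cong[OF fun_cong[OF \<rho>, of t q], of "frame q c"] pull[OF c d, of "frame q c"] positive_density_frame[OF pos c]
    by (simp add: scale_density_def)
  have sm: "smooth_on (UNIV \<times> im c) (\<lambda>p. \<rho> (chart_inv c (snd p), fst p))" if c: "c \<in> A" for c
  proof (rule smooth_on_local)
    fix p :: "real \<times> (real ^ 'n)" assume p: "p \<in> UNIV \<times> im c"
    obtain d where d: "d \<in> A" "F c p \<in> fst d" using ex_chart by blast
    note fic = fic[OF c d(1)]
    have pS: "p \<in> S c d" using p d by (simp add: S_def')
    have HS: "H c d ` S c d \<subseteq> im d" by (auto simp: H_def' S_def')
    have invH: "chart_inv d (H c d p) = F c p" if "p \<in> S c d" for p using that d(1) by (simp add: H_def' S_def')
    have "smooth_on (S c d) (\<lambda>p. \<rho>0 (chart_inv d (H c d p)) * dens \<mu> d (H c d p) *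
       \<bar>det (matrix (\<lambda>v. frechet_derivative (H c d) (at p) (0, v)))\<bar> / dens \<mu> c (snd p))"
    proof (intro smooth_on_divide smooth_on_mult fic(1,3))
      show "smooth_on (S c d) (\<lambda>p. \<rho>0 (chart_inv d (H c d p)))"
        by (rule smooth_on_compose[OF fic(1) open_im[OF d(1)] fic(2) smooth_fun_in_chart[OF \<rho>0 d(1)] HS])
      show "smooth_on (S c d) (\<lambda>p. dens \<mu> d (H c d p))"
        by (rule smooth_on_compose[OF fic(1) open_im[OF d(1)] fic(2) smooth_density_in_chart[OF \<mu> d(1)] HS])
      show "smooth_on (S c d) (\<lambda>p. dens \<mu> c (snd p))"
        by (rule smooth_on_compose[OF fic(1) open_im[OF c] smooth_on_linear[OF bounded_linear_snd] smooth_density_in_chart[OF \<mu> c]])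
          (auto simp: S_def')
      show "dens \<mu> c (snd p) \<noteq> 0" if "p \<in> S c d" for p
        using positive_density_frame[OF pos c, of "chart_inv c (snd p)"] that c by (simp add: S_def' mem_Times_iff)
    qed
    then have "smooth_on (S c d) (\<lambda>p. \<rho> (chart_inv c (snd p), fst p))"
    proof (rule smooth_on_cong[OF fic(1), rotated])
      fix p assume p: "p \<in> S c d"
      have m: "snd p \<in> im c" "F c p \<in> fst d" using p by (auto simp: S_def')
      have "\<rho> (chart_inv c (snd p), fst p) = k c d (fst p, snd c (chart_inv c (snd p)))"
        by (rule \<rho>k[OF c _ d(1)]) (use m c in \<open>simp_all add: F_def\<close>)
      also have "\<dots> = k c d p" using snd_chart_inv[OF c m(1)] by simp
      finally show "\<rho>0 (chart_inv d (H c d p)) * dens \<mu> d (H c d p) *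
         \<bar>det (matrix (\<lambda>v. frechet_derivative (H c d) (at p) (0, v)))\<bar> / dens \<mu> c (snd p) = \<rho> (chart_inv c (snd p), fst p)"
        by (simp add: k_def invH[OF p])
    qed
    then show "\<exists>T. open T \<and> p \<in> T \<and> smooth_on T (\<lambda>p. \<rho> (chart_inv c (snd p), fst p))" using fic(1) pS by blast
  qed
  show "smooth_fun (prod_atlas A real_atlas) \<rho>"
  proof (rule smooth_fun_prod_atlasI)
    fix c assume c: "c \<in> A"
    have o: "open (im c \<times> (UNIV :: real set))" "open ((UNIV :: real set) \<times> im c)" using open_im[OF c] by (auto simp: open_Times)
    have "smooth_on (im c \<times> UNIV) (\<lambda>p :: (real ^ 'n) \<times> real. (snd p, fst p))"
      by (intro smooth_on_Pair o smooth_on_linear bounded_linear_fst bounded_linear_snd)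
    from smooth_on_compose[OF o this sm[OF c]]
    show "smooth_on (im c \<times> UNIV) (\<lambda>(x, t). \<rho> (chart_inv c x, t))"
      by (force simp: case_prod_unfold)
  qed
  fix t1 q
  obtain c where c: "c \<in> A" "q \<in> fst c" using ex_chart by blast
  define x1 where "x1 = snd c q"
  obtain e V \<phi> where e: "e > 0" and V: "open V" "snd c q \<in> V" "V \<subseteq> im c"
    and \<phi>: "smooth_on ({t1-e<..<t1+e} \<times> {t1-e<..<t1+e} \<times> V) (\<lambda>(\<tau>, t, x). \<phi> \<tau> t x)"
    "\<And>t x. t \<in> {t1-e<..<t1+e} \<Longrightarrow> x \<in> V \<Longrightarrow> \<phi> t t x = x"
    "\<And>\<tau> t x. \<tau> \<in> {t1-e<..<t1+e} \<Longrightarrow> t \<in> {t1-e<..<t1+e} \<Longrightarrow> x \<in> V \<Longrightarrow>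
       \<phi> \<tau> t x \<in> im c \<and> td_flow A X \<tau> t (chart_inv c x) = chart_inv c (\<phi> \<tau> t x) \<and>
       ((\<lambda>\<tau>. \<phi> \<tau> t x) has_vector_derivative X \<tau> (chart_inv c (\<phi> \<tau> t x)) c) (at \<tau>)"
    by (rule local_flow_in_chart[OF X c, of t1]) blast
  define I where "I = {t1-e<..<t1+e}"
  define \<psi> where "\<psi> s x = \<phi> t1 s x" for s x
  define \<xi> where "\<xi> x = X t1 (chart_inv c x) c" for x
  have I: "open I" "t1 \<in> I" using e by (auto simp: I_def)
  have IV: "open (I \<times> V)" using I V by (simp add: open_Times)
  have x1: "x1 \<in> V" "x1 \<in> im c" "chart_inv c x1 = q" using V c by (auto simp: x1_def)
  have "smooth_on (I \<times> V) (\<lambda>p. (t1, p))"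
    by (intro smooth_on_Pair IV smooth_on_const smooth_on_linear[OF bounded_linear_ident])
  moreover have "(\<lambda>p. (t1, p)) ` (I \<times> V) \<subseteq> {t1-e<..<t1+e} \<times> {t1-e<..<t1+e} \<times> V"
    using I(2) by (auto simp: I_def)
  ultimately have \<psi>: "smooth_on (I \<times> V) (\<lambda>(s, x). \<psi> s x)"
    using smooth_on_compose[OF IV _ _ \<phi>(1), of "\<lambda>p. (t1, p)"] V(1)
    by (simp add: open_Times case_prod_unfold \<psi>_def)
  have \<psi>flow: "\<psi> s x \<in> im c" "td_flow A X t1 s (chart_inv c x) = chart_inv c (\<psi> s x)" if "s \<in> I" "x \<in> V" for s x
    using \<phi>(3)[of t1 s x] that I(2) by (auto simp: I_def \<psi>_def)
  have \<psi>1: "\<psi> t1 x = x" if "x \<in> V" for x using \<phi>(2)[of t1 x] that I(2) by (simp add: \<psi>_def I_def)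
  \<comment> \<open>The velocity in the initial time is minus the velocity in the final time, since \<open>\<phi> t t x = x\<close>.\<close>
  have vel: "((\<lambda>s. \<psi> s x) has_vector_derivative - \<xi> x) (at t1)" if x: "x \<in> V" for x
  proof -
    define E where "E = frechet_derivative (\<lambda>(\<tau>, t, x). \<phi> \<tau> t x) (at (t1, t1, x))"
    have E: "((\<lambda>(\<tau>, t, x). \<phi> \<tau> t x) has_derivative E) (at (t1, t1, x))"
      unfolding E_def by (rule smooth_on_has_derivative[OF \<phi>(1)]) (use I(2) x in \<open>simp add: I_def\<close>)
    interpret E: bounded_linear E using has_derivative_bounded_linear[OF E] .
    have line: "((\<lambda>s. \<phi> (t1 + a * (s - t1)) (t1 + b * (s - t1)) x) has_vector_derivative E (a, b, 0)) (at t1)" for a b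
    proof -
      have "((\<lambda>s. (t1 + a * (s - t1), t1 + b * (s - t1), x)) has_derivative (\<lambda>h. (h * a, h * b, 0))) (at t1)"
        by (auto intro!: derivative_eq_intros)
      from has_derivative_compose[OF this, of "\<lambda>(\<tau>, t, x). \<phi> \<tau> t x" E] E
      have "((\<lambda>s. \<phi> (t1 + a * (s - t1)) (t1 + b * (s - t1)) x) has_derivative (\<lambda>h. E (h * a, h * b, 0))) (at t1)" by simp
      moreover have "E (h * a, h * b, 0) = h *\<^sub>R E (a, b, 0)" for h using E.scaleR[of h "(a, b, 0)"] by simp
      ultimately show ?thesis by (simp add: has_vector_derivative_def)
    qed
    have "E (1, 0, 0) = \<xi> x"
    proof (rule vector_derivative_unique_at)
      show "((\<lambda>s. \<phi> s t1 x) has_vector_derivative E (1, 0, 0)) (at t1)" using line[of 1 0] by simp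
      show "((\<lambda>s. \<phi> s t1 x) has_vector_derivative \<xi> x) (at t1)"
        using \<phi>(3)[of t1 t1 x] \<phi>(2)[of t1 x] I(2) x by (simp add: I_def \<xi>_def)
    qed
    moreover have "E (1, 1, 0) = 0"
    proof (rule vector_derivative_unique_at)
      show "((\<lambda>s. \<phi> s s x) has_vector_derivative E (1, 1, 0)) (at t1)" using line[of 1 1] by simp
      show "((\<lambda>s. \<phi> s s x) has_vector_derivative 0) (at t1)"
        by (rule has_vector_derivative_transform_within_open[OF has_vector_derivative_const I])
          (use \<phi>(2) x in \<open>simp add: I_def\<close>)
    qed
    moreover have "E (0, 1, 0) = E (1, 1, 0) - E (1, 0, 0)" using E.diff[of "(1, 1, 0)" "(1, 0, 0)"] by simp
    ultimately show ?thesis using line[of 0 1] by (simp add: \<psi>_def)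
  qed
  define r where "r x = \<rho> (chart_inv c x, t1)" for x
  define Dr where "Dr = frechet_derivative r (at x1)"
  define m where "m = dens \<mu> c"
  define Dm where "Dm = frechet_derivative m (at x1)"
  define \<sigma> where "\<sigma> x = r x * m x" for x
  have r: "(r has_derivative Dr) (at x1)"
  proof -
    have o: "open ((UNIV :: real set) \<times> im c)" using open_im[OF c(1)] by (simp add: open_Times)
    have "smooth_on (im c) (\<lambda>x. (t1, x))"
      by (intro smooth_on_Pair open_im c(1) smooth_on_const smooth_on_linear[OF bounded_linear_ident])
    from smooth_on_compose[OF open_im[OF c(1)] o this sm[OF c(1)]]
    have "smooth_on (im c) r" by (force simp: r_def[abs_def])
    then show ?thesis unfolding Dr_def using x1(2) by (rule smooth_on_has_derivative)
  qed
  have m: "(m has_derivative Dm) (at x1)"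
    unfolding m_def Dm_def by (rule smooth_on_has_derivative[OF smooth_density_in_chart[OF \<mu> c(1)] x1(2)])
  have mpos: "m x1 > 0" using positive_density_frame[OF pos c] by (simp add: m_def x1(3))
  have \<sigma>: "(\<sigma> has_derivative (\<lambda>h. r x1 * Dm h + Dr h * m x1)) (at x1)"
    unfolding \<sigma>_def[abs_def] by (rule has_derivative_mult[OF r m])
  have \<xi>d: "(\<xi> has_derivative frechet_derivative \<xi> (at x1)) (at x1)"
  proof -
    have o: "open ((UNIV :: real set) \<times> im c)" using open_im[OF c(1)] by (simp add: open_Times)
    have sX: "smooth_on (UNIV \<times> im c) (\<lambda>(t, x). X t (chart_inv c x) c)" using X c(1) by (simp add: smooth_components_def)
    have sp: "smooth_on (im c) (\<lambda>x. (t1, x))"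
      by (intro smooth_on_Pair open_im c(1) smooth_on_const smooth_on_linear[OF bounded_linear_ident])
    have "(\<lambda>x. (t1, x)) ` im c \<subseteq> UNIV \<times> im c" by auto
    from smooth_on_compose[OF open_im[OF c(1)] o sp sX this]
    have "smooth_on (im c) (\<lambda>x. (\<lambda>(t, x). X t (chart_inv c x) c) (t1, x))" .
    then have "smooth_on (im c) \<xi>" by (simp add: \<xi>_def[abs_def])
    then show ?thesis using x1(2) by (rule smooth_on_has_derivative)
  qed
  have negd: "frechet_derivative (\<lambda>x. - \<xi> x) (at x1) = (\<lambda>h. - frechet_derivative \<xi> (at x1) h)"
    using frechet_derivative_at[OF has_derivative_minus[OF \<xi>d]] by simp
  \<comment> \<open>The coefficient at time t is that at time t1, evaluated at the moved point,
    times the Jacobian of the short-time map. The dependence on t thus no longer involves the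
    long-time flow.\<close>
  have push: "\<sigma> (\<psi> t x1) * \<bar>det (matrix (frechet_derivative (\<psi> t) (at x1)))\<bar> = \<rho> (q, t) * m x1" if t: "t \<in> I" for t
  proof -
    define q' where "q' = chart_inv c (\<psi> t x1)"
    define y where "y = \<psi> t x1"
    have y: "y \<in> im c" "q' \<in> fst c" "snd c q' = y"
      using \<psi>flow(1)[OF t x1(1)] c(1) by (auto simp: y_def q'_def simp del: image_eqI)
    have q': "q' = td_flow A X t1 t q" using \<psi>flow(2)[OF t x1(1)] by (simp add: q'_def x1(3))
    have Fq': "td_flow A X 0 t1 q' = td_flow A X 0 t q" by (simp add: q' flow(3))
    \<comment> \<open>The trajectories from q at time t and from q' at time t1 end at the same
      point, so one chart d serves both Jacobians and the chain rule relates them.\<close>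
    obtain d where d: "d \<in> A" "td_flow A X 0 t q \<in> fst d" using ex_chart by blast
    have pS: "(t, x1) \<in> S c d" using x1 d by (simp add: S_def' F_def)
    have yS: "(t1, y) \<in> S c d" using y d Fq' by (simp add: S_def' F_def q'_def y_def)
    define D1 where "D1 v = frechet_derivative (H c d) (at (t, x1)) (0, v)" for v
    define D2 where "D2 v = frechet_derivative (H c d) (at (t1, y)) (0, v)" for v
    have D1: "((\<lambda>x. H c d (t, x)) has_derivative D1) (at x1)"
      using fic(4)[OF c(1) d(1) pS] by (simp add: D1_def[abs_def])
    have D2: "((\<lambda>x. H c d (t1, x)) has_derivative D2) (at y)"
      using fic(4)[OF c(1) d(1) yS] by (simp add: D2_def[abs_def])
    note der = smooth_on_slice(1)[OF \<psi> t x1(1)]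
    have D: "(\<psi> t has_derivative frechet_derivative (\<psi> t) (at x1)) (at x1)"
      using der frechet_derivative_at[OF der] by simp
    have "((\<lambda>x. H c d (t1, \<psi> t x)) has_derivative (\<lambda>v. D2 (frechet_derivative (\<psi> t) (at x1) v))) (at x1)"
      by (rule has_derivative_compose[OF D]) (use D2 in \<open>simp add: y_def\<close>)
    then have "((\<lambda>x. H c d (t, x)) has_derivative (\<lambda>v. D2 (frechet_derivative (\<psi> t) (at x1) v))) (at x1)"
    proof (rule has_derivative_transform_within_open[OF _ V(1) x1(1)])
      show "H c d (t1, \<psi> t x) = H c d (t, x)" if "x \<in> V" for x
        using flow(3)[of 0 t1 t "chart_inv c x"] \<psi>flow(2)[OF t that] by (simp add: H_def' F_def)
    qed
    from has_derivative_unique[OF D1 this] have "D1 = D2 \<circ> frechet_derivative (\<psi> t) (at x1)" by (simp add: o_def)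
    then have "matrix D1 = matrix D2 ** matrix (frechet_derivative (\<psi> t) (at x1))"
      using matrix_compose[OF has_derivative_linear[OF D] has_derivative_linear[OF D2]] by simp
    then have det: "\<bar>det (matrix D1)\<bar> = \<bar>det (matrix D2)\<bar> * \<bar>det (matrix (frechet_derivative (\<psi> t) (at x1)))\<bar>"
      by (simp add: det_mul abs_mult)
    have k1: "\<rho> (q, t) = k c d (t, x1)" using \<rho>k[OF c d] by (simp add: x1_def)
    have "td_flow A X 0 t1 q' \<in> fst d" using d(2) Fq' by simp
    from \<rho>k[OF c(1) y(2) d(1) this] have k2: "\<rho> (q', t1) = k c d (t1, y)" by (simp add: y(3))
    have my: "m y > 0" using positive_density_frame[OF pos c(1) y(2)] by (simp add: m_def q'_def y_def)
    define N where "N = \<rho>0 (td_flow A X 0 t q) * \<mu> (td_flow A X 0 t q) (frame (td_flow A X 0 t q) d)"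
    have "\<rho> (q, t) * m x1 = N * \<bar>det (matrix D1)\<bar>"
      using mpos by (simp add: k1 k_def N_def D1_def[abs_def] F_def x1(3) m_def)
    moreover have "\<rho> (q', t1) * m y = N * \<bar>det (matrix D2)\<bar>"
      unfolding k2 using my Fq' by (simp add: k_def N_def D2_def[abs_def] F_def m_def q'_def y_def)
    moreover have "\<sigma> (\<psi> t x1) = \<rho> (q', t1) * m y" by (simp add: \<sigma>_def r_def q'_def y_def)
    ultimately show ?thesis by (simp add: det)
  qed
  define tr where "tr = (\<Sum>i\<in>UNIV. frechet_derivative \<xi> (at x1) (axis i 1) $ i)"
  have "((\<lambda>s. \<sigma> (\<psi> s x1) * \<bar>det (matrix (frechet_derivative (\<psi> s) (at x1)))\<bar>) has_real_derivative
     r x1 * Dm (- \<xi> x1) + Dr (- \<xi> x1) * m x1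
     + \<sigma> x1 * (\<Sum>i\<in>UNIV. frechet_derivative (\<lambda>x. - \<xi> x) (at x1) (axis i 1) $ i)) (at t1)"
    by (rule has_real_derivative_pullback_volume[OF \<psi> I V(1) x1(1) \<psi>1 vel \<sigma>])
  also have "(\<Sum>i\<in>UNIV. frechet_derivative (\<lambda>x. - \<xi> x) (at x1) (axis i 1) $ i) = - tr"
    by (simp add: negd tr_def sum_negf)
  finally have "((\<lambda>s. \<rho> (q, s) * m x1) has_real_derivative
     r x1 * Dm (- \<xi> x1) + Dr (- \<xi> x1) * m x1 + \<sigma> x1 * (- tr)) (at t1)"
    by (rule has_field_derivative_transform_within_open[OF _ I]) (rule push)
  from DERIV_cdivide[OF this, of "m x1"]
  have "((\<lambda>s. \<rho> (q, s)) has_real_derivative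
     (r x1 * Dm (- \<xi> x1) + Dr (- \<xi> x1) * m x1 + \<sigma> x1 * (- tr)) / m x1) (at t1)"
    using mpos by simp
  from DERIV_imp_deriv[OF this]
  have "deriv (\<lambda>s. \<rho> (q, s)) t1 * m x1 = r x1 * Dm (- \<xi> x1) + Dr (- \<xi> x1) * m x1 + \<sigma> x1 * (- tr)"
    using mpos by simp
  then have time: "deriv (\<lambda>s. \<rho> (q, s)) t1 * m x1 = - (r x1 * Dm (\<xi> x1) + Dr (\<xi> x1) * m x1 + r x1 * m x1 * tr)"
    using linear_neg[OF has_derivative_linear[OF m]] linear_neg[OF has_derivative_linear[OF r]]
    by (simp add: \<sigma>_def algebra_simps)
  have Xq: "X t1 q c = \<xi> x1" by (simp add: \<xi>_def x1(3))
  have dir: "directional A (X t1) (\<lambda>p. \<rho> (p, t1)) q = Dr (\<xi> x1)"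
    using directional_in_chart[OF c, of "X t1" "\<lambda>p. \<rho> (p, t1)" Dr] X r
    by (simp add: smooth_components_def r_def[abs_def] x1_def[symmetric] Xq)
  have div: "divergence A \<mu> (X t1) q * m x1 = Dm (\<xi> x1) + m x1 * tr"
  proof -
    have "\<mu> q (frame q c) = m x1" by (simp add: m_def x1(3))
    moreover have "(\<lambda>x. X t1 (chart_inv c x) c) = \<xi>" by (simp add: \<xi>_def[abs_def])
    ultimately show ?thesis
      using divergence_in_chart[OF \<mu> pos smooth_components_frozen[OF X, of t1] c]
      unfolding m_def[symmetric] x1_def[symmetric] Dm_def[symmetric] tr_def Xq by (simp only:)
  qed
  \<comment> \<open>The comparison is made after multiplication by the positive coefficient
    \<open>m x1\<close>, the form in which both \<open>div\<close> and \<open>time\<close> are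
    available.\<close>
  have "(Dr (\<xi> x1) + \<rho> (q, t1) * divergence A \<mu> (X t1) q) * m x1
     = Dr (\<xi> x1) * m x1 + \<rho> (q, t1) * (divergence A \<mu> (X t1) q * m x1)" by (simp add: algebra_simps)
  also have "\<dots> = - (deriv (\<lambda>s. \<rho> (q, s)) t1 * m x1)"
    unfolding div time by (simp add: r_def x1(3) algebra_simps)
  finally have "(Dr (\<xi> x1) + \<rho> (q, t1) * divergence A \<mu> (X t1) q) * m x1 = (- deriv (\<lambda>s. \<rho> (q, s)) t1) * m x1"
    by (simp only: mult_minus_left)
  then show "directional A (X t1) (\<lambda>p. \<rho> (p, t1)) q + \<rho> (q, t1) * divergence A \<mu> (X t1) q = - deriv (\<lambda>s. \<rho> (q, s)) t1"
    unfolding dir using mult_right_cancel[OF less_imp_neq[OF mpos, symmetric]] by blast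
qed

end

text \<open>That \<rho> is determined by its equation is expressed by unique existence; smoothness
  and the differential equation are then asserted for every function with the defining
  property.\<close>

theorem mainTheorem2:
  fixes A :: "('m::{t2_space,second_countable_topology}, real ^ 'n::finite) chart set"
    and \<mu> :: "('m, 'n) density"
    and X :: "real \<Rightarrow> 'm \<Rightarrow> ('m, 'n) tangent"
    and \<rho>\<^sub>0 :: "'m \<Rightarrow> real"
  assumes "smooth_manifold A"
    and "smooth_density A \<mu>" and "positive_density A \<mu>"
    and "smooth_td_vector_field A X" and "complete_td_vector_field A X"
    and "smooth_fun A \<rho>\<^sub>0"
  shows "(\<exists>!\<rho> :: 'm \<times> real \<Rightarrow> real.
            \<forall>t. scale_density (\<lambda>q. \<rho> (q, t)) \<mu> =
                pullback A (td_flow A X 0 t) (scale_density \<rho>\<^sub>0 \<mu>)) \<and>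
         (\<forall>\<rho> :: 'm \<times> real \<Rightarrow> real.
            (\<forall>t. scale_density (\<lambda>q. \<rho> (q, t)) \<mu> =
                 pullback A (td_flow A X 0 t) (scale_density \<rho>\<^sub>0 \<mu>)) \<longrightarrow>
            smooth_fun (prod_atlas A real_atlas) \<rho> \<and>
            (\<forall>t q. directional A (X t) (\<lambda>p. \<rho> (p, t)) q + \<rho> (q, t) * divergence A \<mu> (X t) q =
                   - deriv (\<lambda>s. \<rho> (q, s)) t))"
proof -
  interpret density_manifold A by unfold_locales (rule assms(1))
  note td = transported_density[OF assms(2,3) smooth_td_vector_field_components[OF assms(4)] assms(5,6)]
  show ?thesis
  proof (intro conjI allI impI)
    show "\<exists>!\<rho> :: 'm \<times> real \<Rightarrow> real.
        \<forall>t. scale_density (\<lambda>q. \<rho> (q, t)) \<mu> = pullback A (td_flow A X 0 t) (scale_density \<rho>\<^sub>0 \<mu>)"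
      by (rule td(1))
    fix \<rho> :: "'m \<times> real \<Rightarrow> real"
    assume \<rho>: "\<forall>t. scale_density (\<lambda>q. \<rho> (q, t)) \<mu> = pullback A (td_flow A X 0 t) (scale_density \<rho>\<^sub>0 \<mu>)"
    show "smooth_fun (prod_atlas A real_atlas) \<rho>" by (rule td(2)) (rule spec[OF \<rho>])
    show "directional A (X t) (\<lambda>p. \<rho> (p, t)) q + \<rho> (q, t) * divergence A \<mu> (X t) q = - deriv (\<lambda>s. \<rho> (q, s)) t" for t q
      by (rule td(3)) (rule spec[OF \<rho>])
  qed
qed

end
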